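(* Let $T>0$ and let $(\Omega,\mathcal F,\mathbb P)$ be a probability space. 1. Let $Y=\varphi(X)$, where $\varphi:\mathbb R\to\mathbb R$ is a $C^1$ function and $X=(X_t)_{t\in[0,T]}$ is a real-valued càdlàg process of finite quadratic variation. Then $$[Y,Y]_t=\int_0^t(\varphi'(X_{s-}))^2\,d[X,X]^c_s+\sum_{s\le t}(\Delta\varphi(X_s))^2,\qquad t\in[0,T].$$ In particular, $Y$ is also a finite quadratic variation process. 2. Let $Y^1=\varphi(X^1)$ and $Y^2=\phi(X^2)$, where $\varphi,\phi:\mathbb R\to\mathbb R$ are $C^1$ functions and $X^1,X^2$ are real-valued càdlàg processes on $[0,T]$ such that $(X^1,X^2)$ has all its mutual covariations. Then $$[Y^1,Y^2]_t=\int_0^t\varphi'(X^1_s)\,\phi'(X^2_{s-})\,d[X^1,X^2]^c_s+\sum_{s\le t}\Delta\varphi(X^1_s)\,\Delta\phi(X^2_s),\qquad t\in[0,T].$$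
   Context: Covariation: for càdlàg processes $Y,Z$ on $[0,T]$, $[Y,Z]$ is the u.c.p. limit (limit in probability, uniformly on $[0,T]$) as $\varepsilon\to0+$, if it exists, of $t\mapsto\frac1\varepsilon\int_0^t(Y_{(s+\varepsilon)\wedge t}-Y_s)(Z_{(s+\varepsilon)\wedge t}-Z_s)\,ds$. An equality for $[Y,Z]$ includes the assertion that it exists. $Y$ is a finite quadratic variation process if $[Y,Y]$ exists; then $[Y,Y]=[Y,Y]^c+\sum_{s\le\cdot}|\Delta Y_s|^2$, where $[Y,Y]^c$ is the continuous component of $[Y,Y]$. "$(X^1,X^2)$ has all its mutual covariations" means that $[X^1,X^1]$, $[X^1,X^2]$ and $[X^2,X^2]$ all exist; $[X^1,X^2]^c$ is then the continuous component of the bounded variation process $[X^1,X^2]$, i.e. $[X^1,X^2]=[X^1,X^2]^c+\sum_{s\le\cdot}\Delta X^1_s\Delta X^2_s$. Notation: $\Delta\varphi(X_s)=\varphi(X_s)-\varphi(X_{s-})$, and sums over $s\le t$ run over jump times in $]0,t]$. *)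

theory Defs
  imports "HOL-Probability.Probability"
begin

text \<open>A real-valued process on $[0,T]$ is a function \<open>X :: real \<Rightarrow> 'a \<Rightarrow> real\<close> of which only the
  values \<open>X t \<omega>\<close> with \<open>t \<in> {0..T}\<close> matter.\<close>

definition cadlag_on :: "real \<Rightarrow> (real \<Rightarrow> real) \<Rightarrow> bool" where
  "cadlag_on T f \<longleftrightarrow>
     (\<forall>t\<in>{0..<T}. continuous (at_right t) f) \<and> (\<forall>t\<in>{0<..T}. \<exists>l. (f \<longlongrightarrow> l) (at_left t))"

definition cadlag_process :: "'a measure \<Rightarrow> real \<Rightarrow> (real \<Rightarrow> 'a \<Rightarrow> real) \<Rightarrow> bool" where
  "cadlag_process M T X \<longleftrightarrow>
     (\<forall>t\<in>{0..T}. X t \<in> borel_measurable M) \<and> (AE \<omega> in M. cadlag_on T (\<lambda>t. X t \<omega>))"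

definition left_lim :: "(real \<Rightarrow> real) \<Rightarrow> real \<Rightarrow> real" where
  "left_lim f t = Lim (at_left t) f"

definition jump :: "(real \<Rightarrow> real) \<Rightarrow> real \<Rightarrow> real" where
  "jump f t = f t - left_lim f t"

text \<open>Uniform convergence in probability on $[0,T]$ as \<open>\<epsilon> \<rightarrow> 0+\<close>. The probability of the supremum
  exceeding \<open>\<delta>\<close> is taken as an outer probability: it is the ordinary one whenever the event is
  measurable (as for cadlag processes), and it makes the notion insensitive to null sets without
  assuming that \<open>M\<close> is complete. In contrast, \<open>measure M\<close> would be 0 on a non-measurable set.\<close>

definition ucp_limit ::
    "'a measure \<Rightarrow> real \<Rightarrow> (real \<Rightarrow> real \<Rightarrow> 'a \<Rightarrow> real) \<Rightarrow> (real \<Rightarrow> 'a \<Rightarrow> real) \<Rightarrow> bool" where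
  "ucp_limit M T H A \<longleftrightarrow>
     (\<forall>\<delta>>0. ((\<lambda>\<epsilon>. outer_measure_of M
         {\<omega> \<in> space M. (SUP t\<in>{0..T}. ereal \<bar>H \<epsilon> t \<omega> - A t \<omega>\<bar>) > ereal \<delta>}) \<longlongrightarrow> 0) (at_right 0))"

definition covariation_approx ::
    "(real \<Rightarrow> 'a \<Rightarrow> real) \<Rightarrow> (real \<Rightarrow> 'a \<Rightarrow> real) \<Rightarrow> real \<Rightarrow> real \<Rightarrow> 'a \<Rightarrow> real" where
  "covariation_approx Y Z \<epsilon> t \<omega> =
     1 / \<epsilon> * (LINT s:{0..t}|lborel.
       (Y (min (s + \<epsilon>) t) \<omega> - Y s \<omega>) * (Z (min (s + \<epsilon>) t) \<omega> - Z s \<omega>))"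

text \<open>\<open>is_covariation M T Y Z A\<close> reads: $[Y,Z]$ exists on $[0,T]$ and equals \<open>A\<close>
  (up to indistinguishability).\<close>

definition is_covariation ::
    "'a measure \<Rightarrow> real \<Rightarrow> (real \<Rightarrow> 'a \<Rightarrow> real) \<Rightarrow> (real \<Rightarrow> 'a \<Rightarrow> real) \<Rightarrow> (real \<Rightarrow> 'a \<Rightarrow> real) \<Rightarrow> bool" where
  "is_covariation M T Y Z A \<longleftrightarrow> ucp_limit M T (covariation_approx Y Z) A"

definition finite_quadratic_variation :: "'a measure \<Rightarrow> real \<Rightarrow> (real \<Rightarrow> 'a \<Rightarrow> real) \<Rightarrow> bool" where
  "finite_quadratic_variation M T X \<longleftrightarrow> cadlag_process M T X \<and> (\<exists>A. is_covariation M T X X A)"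

definition all_mutual_covariations ::
    "'a measure \<Rightarrow> real \<Rightarrow> (real \<Rightarrow> 'a \<Rightarrow> real) \<Rightarrow> (real \<Rightarrow> 'a \<Rightarrow> real) \<Rightarrow> bool" where
  "all_mutual_covariations M T X1 X2 \<longleftrightarrow>
     (\<exists>A. is_covariation M T X1 X1 A) \<and> (\<exists>A. is_covariation M T X1 X2 A) \<and>
     (\<exists>A. is_covariation M T X2 X2 A)"

text \<open>The continuous component of \<open>A\<close> $= [X,Z]$, path by path. Non-jump times contribute 0 to the
  unordered sum over the whole interval.\<close>

definition continuous_component ::
    "(real \<Rightarrow> 'a \<Rightarrow> real) \<Rightarrow> (real \<Rightarrow> 'a \<Rightarrow> real) \<Rightarrow> (real \<Rightarrow> 'a \<Rightarrow> real) \<Rightarrow> real \<Rightarrow> 'a \<Rightarrow> real" where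
  "continuous_component X Z A t \<omega> =
     A t \<omega> - (\<Sum>\<^sub>\<infinity>s\<in>{0<..t}. jump (\<lambda>u. X u \<omega>) s * jump (\<lambda>u. Z u \<omega>) s)"

definition variation_sums :: "(real \<Rightarrow> real) \<Rightarrow> real \<Rightarrow> real \<Rightarrow> real set" where
  "variation_sums F a b =
     {(\<Sum>i<n. \<bar>F (x (Suc i)) - F (x i)\<bar>) | (n::nat) x. incseq x \<and> range x \<subseteq> {a..b}}"

definition total_variation :: "(real \<Rightarrow> real) \<Rightarrow> real \<Rightarrow> real \<Rightarrow> real" where
  "total_variation F a b = Sup (variation_sums F a b)"

text \<open>The Lebesgue-Stieltjes integral of \<open>f\<close> over $]0,t]$ against a continuous function \<open>F\<close> of
  bounded variation on $[0,t]$. With \<open>V\<close> the variation function of \<open>F\<close>, the signed measure $dF$ has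
  the Jordan decomposition $d((V+F)/2) - d((V-F)/2)$. Both functions are extended from $[0,t]$ to
  the real line as constants, since \<open>interval_measure\<close> expects functions on the whole line.\<close>

definition pos_variation_measure :: "(real \<Rightarrow> real) \<Rightarrow> real \<Rightarrow> real measure" where
  "pos_variation_measure F t = interval_measure
     (\<lambda>s. let r = max 0 (min t s) in (total_variation F 0 r + F r) / 2)"

definition neg_variation_measure :: "(real \<Rightarrow> real) \<Rightarrow> real \<Rightarrow> real measure" where
  "neg_variation_measure F t = interval_measure
     (\<lambda>s. let r = max 0 (min t s) in (total_variation F 0 r - F r) / 2)"

definition stieltjes_integral :: "(real \<Rightarrow> real) \<Rightarrow> real \<Rightarrow> (real \<Rightarrow> real) \<Rightarrow> real" where
  "stieltjes_integral F t f =
     (LINT s:{0<..t}|pos_variation_measure F t. f s) - (LINT s:{0<..t}|neg_variation_measure F t. f s)"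

definition stieltjes_integrable :: "(real \<Rightarrow> real) \<Rightarrow> real \<Rightarrow> (real \<Rightarrow> real) \<Rightarrow> bool" where
  "stieltjes_integrable F t f \<longleftrightarrow>
     continuous_on {0..t} F \<and> bdd_above (variation_sums F 0 t) \<and>
     set_integrable (pos_variation_measure F t) {0<..t} f \<and>
     set_integrable (neg_variation_measure F t) {0<..t} f"

end

theory Submission
  imports Defs
begin

text \<open>
  Everything reduces to a statement about single paths. A limit in outer probability is an almost
  sure limit along a subsequence of any given sequence \<open>\<epsilon>\<^sub>n \<longrightarrow> 0\<close>
  (\<open>ucp_limit_AE_subseq\<close>), and, as soon as the errors are measurable, the converse holds by
  the subsequence principle (\<open>ucp_limitI\<close>). So fix two cadlag paths \<open>f\<close> and \<open>g\<close>
  and a sequence \<open>\<epsilon>\<^sub>n\<close> along which the averaged products of increments of \<open>(f, f)\<close>,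
  \<open>(f, g)\<close> and \<open>(g, g)\<close> converge uniformly to \<open>A11\<close>, \<open>A12\<close> and
  \<open>A22\<close>; the claim is that those of \<open>(\<phi> \<circ> f, \<psi> \<circ> g)\<close> converge uniformly to the
  asserted limit (\<open>C1_image_covariation\<close>).

  The averages of \<open>(f, f)\<close> are nearly increasing in time, hence \<open>A11\<close> is increasing.
  Since the convergence is uniform, jumps pass to the limit, and \<open>A11\<close> jumps by the square of
  the jump of \<open>f\<close> (\<open>quadratic_variation_structure\<close>). Therefore the squared jumps are
  summable, and what remains of \<open>A11\<close> after removing them is increasing and continuous.
  Polarization carries this over to \<open>A12\<close>: the increments of its continuous component are
  bounded by those of a continuous increasing function. In particular it has bounded variation, and
  Stieltjes integrals against it can be estimated by means of the dominating function.

  Consider now an interval \<open>[a, b)\<close> on which \<open>f\<close> and \<open>g\<close> oscillate little. By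
  the mean value theorem a product of increments of \<open>\<phi> \<circ> f\<close> and \<open>\<psi> \<circ> g\<close> is
  \<open>c\<close> times that of \<open>f\<close> and \<open>g\<close>, where \<open>c\<close> is a fixed value of
  \<open>\<phi>' \<psi>'\<close>, up to \<open>\<kappa>\<close> times the sum of the squared increments. Averaging
  shows that from \<open>a\<close> to \<open>t\<close> the averages for the images change by \<open>c\<close> times
  the increment of \<open>A12\<close>, up to \<open>\<kappa>\<close> times the increment of
  \<open>A11 + A22\<close> and an error that vanishes with \<open>\<epsilon>\<close> (\<open>incr_avg_approx\<close>). The
  asserted limit satisfies the same estimate (\<open>limit_path_approx\<close>), and a jump at \<open>b\<close>
  enters both in the same way. Hence the difference of the two changes on \<open>[a, b]\<close> by at most
  \<open>2 \<kappa>\<close> times the increment of \<open>A11 + A22 + t\<close>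
  (\<open>controlled_of_proportional\<close>). This bound is additive over adjacent intervals and holds on
  all short intervals ending or starting at any given point, thus a bisection argument extends it to
  \<open>[0, T]\<close>; finally \<open>\<kappa>\<close> tends to \<open>0\<close>.
\<close>

section \<open>Cadlag paths\<close>

lemma cadlag_right:
  assumes "cadlag_on T f" "0 \<le> t" "t < T" "0 < e"
  obtains d where "0 < d" "\<And>u. t \<le> u \<Longrightarrow> u < t + d \<Longrightarrow> \<bar>f u - f t\<bar> \<le> e"
proof -
  have "(f \<longlongrightarrow> f t) (at_right t)"
    using assms by (auto simp: cadlag_on_def continuous_within)
  then have "\<forall>\<^sub>F u in at_right t. \<bar>f u - f t\<bar> < e"
    using assms(4) by (auto dest!: tendstoD simp: dist_real_def)
  then obtain b where b: "b > t" "\<And>u. t < u \<Longrightarrow> u < b \<Longrightarrow> \<bar>f u - f t\<bar> < e"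
    by (auto simp: eventually_at_right_field)
  show thesis
  proof (rule that[of "b - t"])
    fix u assume "t \<le> u" "u < t + (b - t)"
    then show "\<bar>f u - f t\<bar> \<le> e"
      using b(2)[of u] assms(4) by (cases "u = t") auto
  qed (use b in auto)
qed

lemma tendsto_left_lim:
  assumes "cadlag_on T f" "0 < t" "t \<le> T"
  shows "(f \<longlongrightarrow> left_lim f t) (at_left t)"
proof -
  obtain l where "(f \<longlongrightarrow> l) (at_left t)"
    using assms unfolding cadlag_on_def by (meson greaterThanAtMost_iff)
  moreover from this have "left_lim f t = l"
    unfolding left_lim_def by (intro tendsto_Lim) auto
  ultimately show ?thesis by simp
qed

lemma left_lim_eq: "(f \<longlongrightarrow> l) (at_left t) \<Longrightarrow> left_lim f t = l" for t :: real
  unfolding left_lim_def by (intro tendsto_Lim) auto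

lemma cadlag_left:
  assumes "cadlag_on T f" "0 < t" "t \<le> T" "0 < e"
  obtains d where "0 < d" "d \<le> t" "\<And>u. t - d < u \<Longrightarrow> u < t \<Longrightarrow> \<bar>f u - left_lim f t\<bar> \<le> e"
proof -
  have "\<forall>\<^sub>F u in at_left t. \<bar>f u - left_lim f t\<bar> < e"
    using tendsto_left_lim[OF assms(1-3)] assms(4) by (auto dest!: tendstoD simp: dist_real_def)
  then obtain b where b: "b < t" "\<And>u. b < u \<Longrightarrow> u < t \<Longrightarrow> \<bar>f u - left_lim f t\<bar> < e"
    by (auto simp: eventually_at_left_field)
  show thesis
  proof (rule that[of "min (t - b) t"])
    fix u assume "t - min (t - b) t < u" "u < t"
    then show "\<bar>f u - left_lim f t\<bar> \<le> e"
      using b(2)[of u] by (auto simp: min_def split: if_splits)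
  qed (use b assms in auto)
qed

lemma left_lim_in_closed:
  assumes "cadlag_on T f" "0 < t" "t \<le> T" "a < t" "\<And>u. a \<le> u \<Longrightarrow> u < t \<Longrightarrow> f u \<in> S" "closed S"
  shows "left_lim f t \<in> S"
proof -
  have "\<forall>\<^sub>F u in at_left t. f u \<in> S"
    using eventually_at_left_real[OF assms(4)] by eventually_elim (use assms in auto)
  then show ?thesis
    using Lim_in_closed_set[OF assms(6) _ _ tendsto_left_lim[OF assms(1-3)]] by auto
qed

text \<open>Boundedness of a path is a local property at every point, by the one-sided limits, and it is
  inherited by unions of adjacent intervals, so bisection gives it on all of \<open>[0, T]\<close>.\<close>

lemma cadlag_bounded:
  assumes f: "cadlag_on T f" and "0 < T"
  obtains C where "0 < C" "\<And>u. 0 \<le> u \<Longrightarrow> u \<le> T \<Longrightarrow> \<bar>f u\<bar> \<le> C"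
proof -
  define P where "P a b \<longleftrightarrow> (0 \<le> a \<longrightarrow> b \<le> T \<longrightarrow> (\<exists>C. \<forall>u\<in>{a..b}. \<bar>f u\<bar> \<le> C))" for a b
  have "0 \<le> T" using assms by simp
  then have "P 0 T"
  proof (induction rule: Bolzano)
    case (trans a b c)
    show ?case unfolding P_def
    proof (intro impI)
      assume "0 \<le> a" "c \<le> T"
      then obtain C1 C2 where C: "\<forall>u\<in>{a..b}. \<bar>f u\<bar> \<le> C1" "\<forall>u\<in>{b..c}. \<bar>f u\<bar> \<le> C2"
        using trans unfolding P_def by (smt (verit))
      have "\<bar>f u\<bar> \<le> max C1 C2" if "u \<in> {a..c}" for u
        using C that by (cases "u \<le> b") (auto simp: le_max_iff_disj)
      then show "\<exists>C. \<forall>u\<in>{a..c}. \<bar>f u\<bar> \<le> C" by blast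
    qed
  next
    case (local x)
    obtain d1 where d1: "0 < d1" "\<And>u. x \<le> u \<Longrightarrow> u < x + d1 \<Longrightarrow> u \<le> T \<Longrightarrow> \<bar>f u - f x\<bar> \<le> 1"
    proof (cases "x < T")
      case True
      obtain d where d: "0 < d" "\<And>u. x \<le> u \<Longrightarrow> u < x + d \<Longrightarrow> \<bar>f u - f x\<bar> \<le> 1"
        using cadlag_right[OF f \<open>0 \<le> x\<close> True zero_less_one] by blast
      show ?thesis by (rule that[of d]) (use d in auto)
    next
      case False
      show ?thesis by (rule that[of 1]) (use False local in auto)
    qed
    obtain d2 where d2: "0 < d2"
      "\<And>u. x - d2 < u \<Longrightarrow> u < x \<Longrightarrow> 0 \<le> u \<Longrightarrow> \<bar>f u - left_lim f x\<bar> \<le> 1"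
    proof (cases "x > 0")
      case True
      show ?thesis
        by (rule cadlag_left[OF f True \<open>x \<le> T\<close> zero_less_one]) (rule that, auto)
    next
      case False
      show ?thesis by (rule that[of 1]) (use False local in auto)
    qed
    show ?case unfolding P_def
    proof (rule exI[of _ "min d1 d2"], intro conjI allI impI)
      fix a b assume ab: "a \<le> x \<and> x \<le> b \<and> b - a < min d1 d2" "0 \<le> a" "b \<le> T"
      show "\<exists>C. \<forall>u\<in>{a..b}. \<bar>f u\<bar> \<le> C"
      proof (intro exI[of _ "1 + \<bar>f x\<bar> + \<bar>left_lim f x\<bar>"] ballI)
        fix u assume "u \<in> {a..b}"
        then show "\<bar>f u\<bar> \<le> 1 + \<bar>f x\<bar> + \<bar>left_lim f x\<bar>"
          using d1(2)[of u] d2(2)[of u] ab by (cases "u < x") auto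
      qed
    qed (use d1 d2 in auto)
  qed
  then obtain C where "\<forall>u\<in>{0..T}. \<bar>f u\<bar> \<le> C" using assms(2) by (auto simp: P_def)
  then show thesis
    by (intro that[of "max 1 C"]) (auto simp: le_max_iff_disj)
qed

lemma cadlag_bounded2:
  assumes f: "cadlag_on T f" and g: "cadlag_on T g" and "0 < T"
  obtains C where "0 < C" "\<And>u. 0 \<le> u \<Longrightarrow> u \<le> T \<Longrightarrow> \<bar>f u\<bar> \<le> C" "\<And>u. 0 \<le> u \<Longrightarrow> u \<le> T \<Longrightarrow> \<bar>g u\<bar> \<le> C"
proof -
  obtain C1 where C1: "0 < C1" "\<And>u. 0 \<le> u \<Longrightarrow> u \<le> T \<Longrightarrow> \<bar>f u\<bar> \<le> C1"
    by (rule cadlag_bounded[OF f \<open>0 < T\<close>]) blast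
  obtain C2 where C2: "0 < C2" "\<And>u. 0 \<le> u \<Longrightarrow> u \<le> T \<Longrightarrow> \<bar>g u\<bar> \<le> C2"
    by (rule cadlag_bounded[OF g \<open>0 < T\<close>]) blast
  show thesis
    by (rule that[of "max C1 C2"]) (use C1 C2 in \<open>auto simp: le_max_iff_disj\<close>)
qed

lemma cadlag_on_add:
  assumes "cadlag_on T f" "cadlag_on T g" shows "cadlag_on T (\<lambda>t. f t + g t)"
  using assms unfolding cadlag_on_def by (fast intro: continuous_add tendsto_add)

lemma cadlag_on_diff:
  assumes "cadlag_on T f" "cadlag_on T g" shows "cadlag_on T (\<lambda>t. f t - g t)"
  using assms unfolding cadlag_on_def by (fast intro: continuous_diff tendsto_diff)

lemma tendsto_compose_continuous:
  fixes \<phi> :: "real \<Rightarrow> real"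
  assumes "continuous_on UNIV \<phi>" "(f \<longlongrightarrow> l) F"
  shows "((\<lambda>t. \<phi> (f t)) \<longlongrightarrow> \<phi> l) F"
  using assms continuous_on_tendsto_compose by fastforce

lemma cadlag_on_compose:
  assumes "continuous_on UNIV \<phi>" "cadlag_on T f"
  shows "cadlag_on T (\<lambda>t. \<phi> (f t))"
  using assms unfolding cadlag_on_def continuous_within
  by (fast intro: tendsto_compose_continuous)

lemma jump_compose:
  assumes "continuous_on UNIV \<phi>" "cadlag_on T f" "0 < t" "t \<le> T"
  shows "jump (\<lambda>u. \<phi> (f u)) t = \<phi> (f t) - \<phi> (left_lim f t)"
  unfolding jump_def
  using left_lim_eq[OF tendsto_compose_continuous[OF assms(1) tendsto_left_lim[OF assms(2-4)]]]
  by simp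

lemma jump_add:
  assumes "cadlag_on T f" "cadlag_on T g" "0 < t" "t \<le> T"
  shows "jump (\<lambda>u. f u + g u) t = jump f t + jump g t"
  unfolding jump_def
  using left_lim_eq[OF tendsto_add[OF tendsto_left_lim[OF assms(1,3,4)] tendsto_left_lim[OF assms(2,3,4)]]]
  by simp

lemma jump_diff:
  assumes "cadlag_on T f" "cadlag_on T g" "0 < t" "t \<le> T"
  shows "jump (\<lambda>u. f u - g u) t = jump f t - jump g t"
  unfolding jump_def
  using left_lim_eq[OF tendsto_diff[OF tendsto_left_lim[OF assms(1,3,4)] tendsto_left_lim[OF assms(2,3,4)]]]
  by simp

text \<open>Sampling a cadlag path at the next point of the grid of mesh \<open>1/(n+1)\<close> converges back to the
  path, by right continuity. As each sampled process takes its times from a countable set, this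
  makes a cadlag process jointly measurable, and a single cadlag path Borel.\<close>

definition next_grid_point :: "real \<Rightarrow> nat \<Rightarrow> real \<Rightarrow> real" where
  "next_grid_point T n s = min T (max 0 (of_int \<lceil>real (Suc n) * s\<rceil> / real (Suc n)))"

definition grid_lim :: "real \<Rightarrow> (real \<Rightarrow> real) \<Rightarrow> real \<Rightarrow> real" where
  "grid_lim T f s = lim (\<lambda>n. f (next_grid_point T n s))"

lemma grid_lim_eq:
  assumes f: "cadlag_on T f" and s: "0 \<le> s" "s \<le> T"
  shows "grid_lim T f s = f s"
proof -
  have lo: "s \<le> next_grid_point T n s" for n
  proof -
    have "real (Suc n) * s \<le> of_int \<lceil>real (Suc n) * s\<rceil>" by linarith
    then have "s \<le> of_int \<lceil>real (Suc n) * s\<rceil> / real (Suc n)"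
      by (simp add: field_simps del: of_nat_Suc)
    then show ?thesis using s by (auto simp: next_grid_point_def)
  qed
  have hi: "next_grid_point T n s \<le> s + 1 / real (Suc n)" for n
  proof -
    have "of_int \<lceil>real (Suc n) * s\<rceil> \<le> real (Suc n) * s + 1" by linarith
    then have "of_int \<lceil>real (Suc n) * s\<rceil> / real (Suc n) \<le> s + 1 / real (Suc n)"
      by (simp add: field_simps del: of_nat_Suc)
    then show ?thesis using s by (auto simp: next_grid_point_def le_max_iff_disj min_le_iff_disj)
  qed
  have "(\<lambda>n. f (next_grid_point T n s)) \<longlonglongrightarrow> f s"
  proof (cases "s < T")
    case True
    show ?thesis
    proof (rule LIMSEQ_I)
      fix r :: real assume "0 < r"
      then obtain d where d: "0 < d" "\<And>u. s \<le> u \<Longrightarrow> u < s + d \<Longrightarrow> \<bar>f u - f s\<bar> \<le> r/2"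
        using cadlag_right[OF f s(1) True half_gt_zero] by blast
      obtain N where N: "1 / real (Suc N) < d"
        using d(1) nat_approx_posE by blast
      show "\<exists>no. \<forall>n\<ge>no. norm (f (next_grid_point T n s) - f s) < r"
      proof (intro exI[of _ N] allI impI)
        fix n assume "N \<le> n"
        then have "1 / real (Suc n) \<le> 1 / real (Suc N)" by (simp add: frac_le)
        then have "next_grid_point T n s < s + d" using hi[of n] N by linarith
        then show "norm (f (next_grid_point T n s) - f s) < r"
          using d(2)[OF lo] \<open>0 < r\<close> by fastforce
      qed
    qed
  next
    case False
    then have "next_grid_point T n s = s" for n
      using lo[of n] s by (auto simp: next_grid_point_def)
    then show ?thesis by simp
  qed
  then show ?thesis unfolding grid_lim_def by (rule limI)
qed

lemma measurable_grid_lim: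
  assumes "\<And>t. t \<in> {0..T} \<Longrightarrow> X t \<in> borel_measurable M" "0 \<le> T"
  shows "(\<lambda>(s, \<omega>). grid_lim T (\<lambda>t. X t \<omega>) s) \<in> borel_measurable (borel \<Otimes>\<^sub>M M)"
proof -
  have "(\<lambda>p. X (next_grid_point T n (fst p)) (snd p)) \<in> borel_measurable (borel \<Otimes>\<^sub>M M)" for n
    unfolding next_grid_point_def
  proof (rule measurable_compose_countable[where
        f = "\<lambda>i p. X (min T (max 0 (of_int i / real (Suc n)))) (snd p)"
        and g = "\<lambda>p. \<lceil>real (Suc n) * fst p\<rceil>"])
    fix i :: int
    show "(\<lambda>p. X (min T (max 0 (of_int i / real (Suc n)))) (snd p)) \<in> borel_measurable (borel \<Otimes>\<^sub>M M)"
      by (rule measurable_compose[OF measurable_snd]) (use assms in auto)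
  qed simp
  then show ?thesis
    unfolding grid_lim_def split_def by (intro borel_measurable_lim_metric)
qed

lemma borel_measurable_grid_lim:
  assumes "0 \<le> T" shows "grid_lim T f \<in> borel_measurable borel"
proof -
  have "(\<lambda>(s, \<omega>). grid_lim T (\<lambda>t. f t) s) \<in> borel_measurable (borel \<Otimes>\<^sub>M (borel :: real measure))"
    by (rule measurable_grid_lim[where X = "\<lambda>t _. f t"]) (use assms in auto)
  from measurable_compose[OF measurable_Pair2'[of 0] this] show ?thesis by simp
qed

text \<open>The left limit at \<open>s\<close> is approached along \<open>s - s/(n+1)\<close>, points of
  \<open>[0, s)\<close> that depend measurably on \<open>s\<close>.\<close>

lemma left_lim_borel:
  assumes f: "cadlag_on T f" and T: "0 < T"
  obtains h where "h \<in> borel_measurable borel" "\<And>s. s \<in> {0<..T} \<Longrightarrow> h s = left_lim f s"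
proof -
  define h where "h s = lim (\<lambda>n. grid_lim T f (s - s / real (Suc n)))" for s
  have [measurable]: "grid_lim T f \<in> borel_measurable borel"
    using borel_measurable_grid_lim T by simp
  have "h \<in> borel_measurable borel" unfolding h_def by measurable
  moreover have "h s = left_lim f s" if s: "s \<in> {0<..T}" for s
  proof -
    have pt: "0 \<le> s - s / real (Suc n) \<and> s - s / real (Suc n) < s" for n
      using s by (auto simp: field_simps)
    have "(\<lambda>n. s - s / real (Suc n)) \<longlonglongrightarrow> s - 0"
      by (intro tendsto_diff tendsto_const) (rule LIMSEQ_Suc, rule lim_const_over_n)
    then have "filterlim (\<lambda>n. s - s / real (Suc n)) (at_left s) sequentially"
      unfolding filterlim_at using pt by (auto intro!: always_eventually simp del: of_nat_Suc simp: less_le)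
    from filterlim_compose[OF tendsto_left_lim[OF f] this]
    have "(\<lambda>n. f (s - s / real (Suc n))) \<longlonglongrightarrow> left_lim f s" using s by auto
    moreover have "f (s - s / real (Suc n)) = grid_lim T f (s - s / real (Suc n))" for n
      using grid_lim_eq[OF f, of "s - s / real (Suc n)"] pt[of n] s by auto
    ultimately show ?thesis unfolding h_def by (simp add: limI)
  qed
  ultimately show thesis by (rule that)
qed

section \<open>Averaged products of increments\<close>

definition incr_prod :: "(real \<Rightarrow> real) \<Rightarrow> (real \<Rightarrow> real) \<Rightarrow> real \<Rightarrow> real \<Rightarrow> real \<Rightarrow> real" where
  "incr_prod f g \<epsilon> t s = (f (min (s + \<epsilon>) t) - f s) * (g (min (s + \<epsilon>) t) - g s)"

definition incr_avg :: "(real \<Rightarrow> real) \<Rightarrow> (real \<Rightarrow> real) \<Rightarrow> real \<Rightarrow> real \<Rightarrow> real \<Rightarrow> real" where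
  "incr_avg f g \<epsilon> a t = 1 / \<epsilon> * (LINT s:{a..t}|lborel. incr_prod f g \<epsilon> t s)"

lemma covariation_approx_eq:
  "covariation_approx Y Z \<epsilon> t \<omega> = incr_avg (\<lambda>t. Y t \<omega>) (\<lambda>t. Z t \<omega>) \<epsilon> 0 t"
  by (simp add: covariation_approx_def incr_avg_def incr_prod_def)

lemma set_integral_combine_Icc:
  fixes h :: "real \<Rightarrow> real"
  assumes "set_integrable lborel {a..b} h" "a \<le> c" "c \<le> b"
  shows "(LINT s:{a..b}|lborel. h s) = (LINT s:{a..c}|lborel. h s) + (LINT s:{c..b}|lborel. h s)"
proof -
  have 1: "set_integrable lborel {a..c} h" "set_integrable lborel {c..b} h"
    by (rule set_integrable_subset[OF assms(1)]; use assms in auto)+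
  have "integral {a..c} h + integral {c..b} h = integral {a..b} h"
    using assms set_borel_integral_eq_integral(1)[OF assms(1)]
    by (intro Henstock_Kurzweil_Integration.integral_combine) auto
  then show ?thesis
    using set_borel_integral_eq_integral(2)[OF assms(1)] set_borel_integral_eq_integral(2)[OF 1(1)]
      set_borel_integral_eq_integral(2)[OF 1(2)] by simp
qed

lemma set_integrable_indicator_Icc:
  "set_integrable lborel {a..b::real} (\<lambda>s. w * indicator {c..d} s :: real)"
proof -
  have "set_integrable lborel {a..b} (\<lambda>_. w)"
    unfolding set_integrable_def
    by (intro integrable_scaleR_left integrable_real_indicator) (auto simp: emeasure_lborel_Icc_eq)
  from set_integrable_subset[OF this, of "{a..b} \<inter> {c..d}"] show ?thesis
    unfolding set_integrable_def
    by (rule back_subst[where P = "integrable lborel"]) (auto simp: fun_eq_iff indicator_def)+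
qed

lemma set_integral_indicator_Icc:
  fixes w :: real
  assumes "c \<le> d" "a \<le> c" "d \<le> b"
  shows "(LINT s:{a..b}|lborel. w * indicator {c..d} s) = w * (d - c)"
proof -
  have "(\<lambda>s. indicator {a..b} s *\<^sub>R (w * indicator {c..d} s)) = (\<lambda>s. w * indicator {c..d} s :: real)"
    using assms by (auto simp: fun_eq_iff indicator_def)
  then have "(LINT s:{a..b}|lborel. w * indicator {c..d} s) = (LINT s|lborel. w * indicator {c..d} s)"
    unfolding set_lebesgue_integral_def by simp
  also have "\<dots> = w * (d - c)"
    using assms by simp
  finally show ?thesis .
qed

lemma set_integral_indicator_Icc_le:
  fixes w :: real
  assumes "c \<le> d" "0 \<le> w"
  shows "(LINT s:{a..b}|lborel. w * indicator {c..d} s) \<le> w * (d - c)"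
proof -
  have "(LINT s:{a..b}|lborel. w * indicator {c..d} s) \<le> (LINT s|lborel. w * indicator {c..d} s)"
    unfolding set_lebesgue_integral_def
  proof (rule Bochner_Integration.integral_mono)
    show "integrable lborel (\<lambda>s. indicator {a..b} s *\<^sub>R (w * indicator {c..d} s))"
      using set_integrable_indicator_Icc[of a b w c d] unfolding set_integrable_def .
    show "integrable lborel (\<lambda>s. w * indicator {c..d} s)"
      by (intro integrable_mult_right integrable_real_indicator) (auto simp: emeasure_lborel_Icc_eq)
  qed (use assms in \<open>auto simp: indicator_def\<close>)
  also have "\<dots> = w * (d - c)"
    using assms by simp
  finally show ?thesis .
qed

lemma abs_set_integral_le:
  fixes h b :: "real \<Rightarrow> real"
  assumes "set_integrable lborel S h" "set_integrable lborel S b"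
    and "\<And>s. s \<in> S \<Longrightarrow> \<bar>h s\<bar> \<le> b s"
  shows "\<bar>LINT s:S|lborel. h s\<bar> \<le> (LINT s:S|lborel. b s)"
proof -
  have "norm (LINT s:S|lborel. h s) \<le> (LINT s:S|lborel. norm (h s))"
    by (rule set_integral_norm_bound[OF assms(1)])
  also have "\<dots> \<le> (LINT s:S|lborel. b s)"
    by (rule set_integral_mono[OF set_integrable_norm[OF assms(1)] assms(2)]) (use assms in auto)
  finally show ?thesis by simp
qed

lemma abs_incr_prod_le:
  assumes "\<And>u. 0 \<le> u \<Longrightarrow> u \<le> T \<Longrightarrow> \<bar>f u\<bar> \<le> C" "\<And>u. 0 \<le> u \<Longrightarrow> u \<le> T \<Longrightarrow> \<bar>g u\<bar> \<le> C"
    and "0 < \<epsilon>" "0 \<le> s" "s \<le> t" "t \<le> T"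
  shows "\<bar>incr_prod f g \<epsilon> t s\<bar> \<le> 4 * C\<^sup>2"
proof -
  have "0 \<le> min (s + \<epsilon>) t" "min (s + \<epsilon>) t \<le> T" "s \<le> T"
    using assms(3-) by auto
  then have "\<bar>f (min (s + \<epsilon>) t)\<bar> \<le> C" "\<bar>f s\<bar> \<le> C" "\<bar>g (min (s + \<epsilon>) t)\<bar> \<le> C" "\<bar>g s\<bar> \<le> C"
    using assms(1,2,4) by blast+
  then have "\<bar>f (min (s + \<epsilon>) t) - f s\<bar> \<le> 2 * C" "\<bar>g (min (s + \<epsilon>) t) - g s\<bar> \<le> 2 * C"
    by linarith+
  then have "\<bar>incr_prod f g \<epsilon> t s\<bar> \<le> (2 * C) * (2 * C)"
    unfolding incr_prod_def abs_mult by (intro mult_mono) auto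
  then show ?thesis by (simp add: power2_eq_square)
qed

lemma incr_prod_integrable:
  assumes f: "cadlag_on T f" and g: "cadlag_on T g" and "0 < T" "0 < \<epsilon>" "0 \<le> a" "t \<le> T"
  shows "set_integrable lborel {a..t} (incr_prod f g \<epsilon> t)"
proof -
  obtain C where C0: "0 < C" and C: "\<And>u. 0 \<le> u \<Longrightarrow> u \<le> T \<Longrightarrow> \<bar>f u\<bar> \<le> C"
      "\<And>u. 0 \<le> u \<Longrightarrow> u \<le> T \<Longrightarrow> \<bar>g u\<bar> \<le> C"
    by (rule cadlag_bounded2[OF f g \<open>0 < T\<close>]) blast
  have [measurable]: "grid_lim T f \<in> borel_measurable borel" "grid_lim T g \<in> borel_measurable borel"
    using borel_measurable_grid_lim \<open>0 < T\<close> by auto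
  have eq: "indicator {a..t} s *\<^sub>R incr_prod f g \<epsilon> t s
      = indicator {a..t} s *\<^sub>R incr_prod (grid_lim T f) (grid_lim T g) \<epsilon> t s" for s
  proof (cases "s \<in> {a..t}")
    case True
    then have "grid_lim T f s = f s" "grid_lim T g s = g s"
      "grid_lim T f (min (s + \<epsilon>) t) = f (min (s + \<epsilon>) t)"
      "grid_lim T g (min (s + \<epsilon>) t) = g (min (s + \<epsilon>) t)"
      using assms by (auto intro!: grid_lim_eq)
    then show ?thesis by (simp add: incr_prod_def)
  qed simp
  have "integrable lborel (\<lambda>s. indicator {a..t} s *\<^sub>R incr_prod (grid_lim T f) (grid_lim T g) \<epsilon> t s)"
  proof (rule Bochner_Integration.integrable_bound)
    show "integrable lborel (\<lambda>s. indicator {a..t} s *\<^sub>R (4 * C\<^sup>2))"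
      by (intro integrable_scaleR_left integrable_real_indicator) (auto simp: emeasure_lborel_Icc_eq)
    show "(\<lambda>s. indicator {a..t} s *\<^sub>R incr_prod (grid_lim T f) (grid_lim T g) \<epsilon> t s) \<in> borel_measurable lborel"
      unfolding incr_prod_def by measurable
    show "AE s in lborel. norm (indicator {a..t} s *\<^sub>R incr_prod (grid_lim T f) (grid_lim T g) \<epsilon> t s)
      \<le> norm (indicator {a..t} s *\<^sub>R (4 * C\<^sup>2))"
      unfolding eq[symmetric] using abs_incr_prod_le[OF C \<open>0 < \<epsilon>\<close>] assms
      by (intro AE_I2) (auto simp: indicator_def)
  qed
  then show ?thesis unfolding set_integrable_def eq .
qed

lemma incr_avg_nonneg: "0 < \<epsilon> \<Longrightarrow> 0 \<le> incr_avg f f \<epsilon> a t"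
  unfolding incr_avg_def set_lebesgue_integral_def incr_prod_def
  by (intro mult_nonneg_nonneg integral_nonneg_AE) (auto intro!: AE_I2)

lemma incr_avg_start: "0 < \<epsilon> \<Longrightarrow> incr_avg f g \<epsilon> a a = 0"
proof -
  assume "0 < \<epsilon>"
  then have "(\<lambda>s. indicator {a} s *\<^sub>R incr_prod f g \<epsilon> a s) = (\<lambda>s. 0)"
    by (auto simp: fun_eq_iff indicator_def incr_prod_def)
  then show ?thesis by (simp add: incr_avg_def set_lebesgue_integral_def)
qed

text \<open>Quadratic variations are increasing and so easier to handle than covariations; these identities
  reduce the latter to the former.\<close>

lemma incr_avg_polarize:
  assumes f: "cadlag_on T f" and g: "cadlag_on T g" and "0 < T" "0 < \<epsilon>" "0 \<le> a" "t \<le> T"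
  shows "incr_avg (\<lambda>u. f u + g u) (\<lambda>u. f u + g u) \<epsilon> a t
      = incr_avg f f \<epsilon> a t + 2 * incr_avg f g \<epsilon> a t + incr_avg g g \<epsilon> a t"
    and "incr_avg (\<lambda>u. f u - g u) (\<lambda>u. f u - g u) \<epsilon> a t
      = incr_avg f f \<epsilon> a t - 2 * incr_avg f g \<epsilon> a t + incr_avg g g \<epsilon> a t"
proof -
  note i = incr_prod_integrable[OF f f assms(3-)] incr_prod_integrable[OF f g assms(3-)]
    incr_prod_integrable[OF g g assms(3-)]
  note i2 = set_integrable_mult_right[OF i(2), of 2]
  have "incr_prod (\<lambda>u. f u + g u) (\<lambda>u. f u + g u) \<epsilon> t s
      = incr_prod f f \<epsilon> t s + 2 * incr_prod f g \<epsilon> t s + incr_prod g g \<epsilon> t s" for s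
    unfolding incr_prod_def by algebra
  then show "incr_avg (\<lambda>u. f u + g u) (\<lambda>u. f u + g u) \<epsilon> a t
      = incr_avg f f \<epsilon> a t + 2 * incr_avg f g \<epsilon> a t + incr_avg g g \<epsilon> a t"
    using set_integral_add(2)[OF set_integral_add(1)[OF i(1) i2] i(3)] set_integral_add(2)[OF i(1) i2]
    by (simp add: incr_avg_def algebra_simps)
  have "incr_prod (\<lambda>u. f u - g u) (\<lambda>u. f u - g u) \<epsilon> t s
      = incr_prod f f \<epsilon> t s - 2 * incr_prod f g \<epsilon> t s + incr_prod g g \<epsilon> t s" for s
    unfolding incr_prod_def by algebra
  then have *: "(LINT s:{a..t}|lborel. incr_prod (\<lambda>u. f u - g u) (\<lambda>u. f u - g u) \<epsilon> t s)
      = (LINT s:{a..t}|lborel. incr_prod f f \<epsilon> t s) - 2 * (LINT s:{a..t}|lborel. incr_prod f g \<epsilon> t s)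
        + (LINT s:{a..t}|lborel. incr_prod g g \<epsilon> t s)"
    using set_integral_add(2)[OF set_integral_diff(1)[OF i(1) i2] i(3)] set_integral_diff(2)[OF i(1) i2]
    by simp
  show "incr_avg (\<lambda>u. f u - g u) (\<lambda>u. f u - g u) \<epsilon> a t
      = incr_avg f f \<epsilon> a t - 2 * incr_avg f g \<epsilon> a t + incr_avg g g \<epsilon> a t"
    unfolding incr_avg_def * by (simp add: algebra_simps add_divide_distrib diff_divide_distrib)
qed

lemma abs_incr_avg_le:
  assumes f: "cadlag_on T f" and g: "cadlag_on T g" and "0 < T"
    and C: "\<And>u. 0 \<le> u \<Longrightarrow> u \<le> T \<Longrightarrow> \<bar>f u\<bar> \<le> C" "\<And>u. 0 \<le> u \<Longrightarrow> u \<le> T \<Longrightarrow> \<bar>g u\<bar> \<le> C"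
    and "0 < \<epsilon>" "0 \<le> a" "a \<le> t" "t \<le> T"
  shows "\<bar>incr_avg f g \<epsilon> a t\<bar> \<le> 4 * C\<^sup>2 * (t - a) / \<epsilon>"
proof -
  have "\<bar>LINT s:{a..t}|lborel. incr_prod f g \<epsilon> t s\<bar> \<le> (LINT s:{a..t}|lborel. (4 * C\<^sup>2) * indicator {a..t} s)"
    by (rule abs_set_integral_le[OF incr_prod_integrable set_integrable_indicator_Icc])
      (use abs_incr_prod_le[OF C] assms in auto)
  also have "\<dots> \<le> 4 * C\<^sup>2 * (t - a)"
    by (rule set_integral_indicator_Icc_le) (use assms in auto)
  finally show ?thesis
    using \<open>0 < \<epsilon>\<close> by (simp add: incr_avg_def abs_mult divide_right_mono)
qed

text \<open>The average is additive over adjacent time intervals up to a boundary term: stopping at \<open>a\<close>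
  or at \<open>t\<close> matters only for starting times \<open>s\<close> within \<open>\<epsilon>\<close> of \<open>a\<close>,
  and there the two products differ by little if the paths barely move on
  \<open>[a, a + \<epsilon>]\<close>. Right continuity at \<open>a\<close> makes \<open>w\<close> small, uniformly in
  \<open>t\<close>.\<close>

lemma incr_avg_restart:
  assumes f: "cadlag_on T f" and g: "cadlag_on T g" and "0 < T"
    and C: "\<And>u. 0 \<le> u \<Longrightarrow> u \<le> T \<Longrightarrow> \<bar>f u\<bar> \<le> C" "\<And>u. 0 \<le> u \<Longrightarrow> u \<le> T \<Longrightarrow> \<bar>g u\<bar> \<le> C"
    and "0 < \<epsilon>" "0 \<le> a" "a \<le> t" "t \<le> T"
    and w: "\<And>u. a \<le> u \<Longrightarrow> u \<le> t \<Longrightarrow> u \<le> a + \<epsilon> \<Longrightarrow> \<bar>f u - f a\<bar> \<le> w \<and> \<bar>g u - g a\<bar> \<le> w"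
  shows "\<bar>incr_avg f g \<epsilon> 0 t - incr_avg f g \<epsilon> 0 a - incr_avg f g \<epsilon> a t\<bar> \<le> 4 * C * w"
proof -
  have w0: "0 \<le> w" and C0: "0 \<le> C"
    using w[of a] order_trans[OF abs_ge_zero C(1)[of a]] assms by auto
  have it: "set_integrable lborel {0..t} (incr_prod f g \<epsilon> t)"
    by (rule incr_prod_integrable[OF f g]) (use assms in auto)
  have ia: "set_integrable lborel {0..a} (incr_prod f g \<epsilon> a)"
    by (rule incr_prod_integrable[OF f g]) (use assms in auto)
  have ita: "set_integrable lborel {0..a} (incr_prod f g \<epsilon> t)"
    by (rule set_integrable_subset[OF it]) (use assms in auto)
  have eq: "incr_avg f g \<epsilon> 0 t - incr_avg f g \<epsilon> 0 a - incr_avg f g \<epsilon> a t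
     = 1 / \<epsilon> * (LINT s:{0..a}|lborel. incr_prod f g \<epsilon> t s - incr_prod f g \<epsilon> a s)"
    unfolding incr_avg_def set_integral_combine_Icc[OF it \<open>0 \<le> a\<close> \<open>a \<le> t\<close>] set_integral_diff(2)[OF ita ia]
    by (simp add: algebra_simps)
  have "\<bar>incr_prod f g \<epsilon> t s - incr_prod f g \<epsilon> a s\<bar> \<le> (4 * C * w) * indicator {a - \<epsilon>..a} s"
    if s: "s \<in> {0..a}" for s
  proof (cases "s < a - \<epsilon>")
    case True
    then have "min (s + \<epsilon>) t = s + \<epsilon>" "min (s + \<epsilon>) a = s + \<epsilon>" using assms by auto
    then show ?thesis using w0 C0 by (simp add: incr_prod_def)
  next
    case False
    define u where "u = min (s + \<epsilon>) t"
    have u: "a \<le> u" "u \<le> t" "u \<le> a + \<epsilon>" "min (s + \<epsilon>) a = a"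
      using False s assms by (auto simp: u_def)
    have "\<bar>f u - f a\<bar> \<le> w" "\<bar>g u - g a\<bar> \<le> w" using w[of u] u by auto
    moreover have "\<bar>f a\<bar> \<le> C" "\<bar>f s\<bar> \<le> C" "\<bar>g u\<bar> \<le> C" "\<bar>g s\<bar> \<le> C"
      using u s assms by (auto intro!: C)
    then have "\<bar>g u - g s\<bar> \<le> 2 * C" "\<bar>f a - f s\<bar> \<le> 2 * C" by linarith+
    ultimately have "\<bar>(f u - f a) * (g u - g s)\<bar> \<le> w * (2 * C)" "\<bar>(f a - f s) * (g u - g a)\<bar> \<le> (2 * C) * w"
      unfolding abs_mult using w0 C0 by (auto intro!: mult_mono)
    moreover have "incr_prod f g \<epsilon> t s - incr_prod f g \<epsilon> a s
        = (f u - f a) * (g u - g s) + (f a - f s) * (g u - g a)"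
      unfolding incr_prod_def u(4) by (simp add: u_def algebra_simps)
    ultimately show ?thesis using False s by (simp add: indicator_def algebra_simps)
  qed
  then have "\<bar>LINT s:{0..a}|lborel. incr_prod f g \<epsilon> t s - incr_prod f g \<epsilon> a s\<bar>
     \<le> (LINT s:{0..a}|lborel. (4 * C * w) * indicator {a - \<epsilon>..a} s)"
    by (intro abs_set_integral_le set_integral_diff(1) ita ia set_integrable_indicator_Icc)
  also have "\<dots> \<le> (4 * C * w) * (a - (a - \<epsilon>))"
    by (rule set_integral_indicator_Icc_le) (use assms w0 C0 in auto)
  finally show ?thesis
    unfolding eq using \<open>0 < \<epsilon>\<close> by (simp add: abs_mult field_simps)
qed

text \<open>The jump of the average at \<open>b\<close> for fixed \<open>\<epsilon>\<close>, in quantitative form: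
  \<open>l\<close> stands for the left limit of \<open>f\<close> at \<open>b\<close>. When time passes from
  \<open>t\<close> to \<open>b\<close>, the integrand changes from nearly \<open>0\<close> to nearly
  \<open>(f b - l)\<^sup>2\<close> for starting times in \<open>(b - \<epsilon>, t)\<close>; all other changes happen on
  a set of starting times of length at most \<open>2 (b - t)\<close>.\<close>

lemma incr_avg_jump:
  assumes f: "cadlag_on T f" and "0 < T"
    and C: "\<And>u. 0 \<le> u \<Longrightarrow> u \<le> T \<Longrightarrow> \<bar>f u\<bar> \<le> C" "\<bar>l\<bar> \<le> C"
    and "0 < \<epsilon>" "\<epsilon> \<le> t" "t < b" "b - t \<le> \<epsilon>" "b \<le> T"
    and w: "\<And>u. t - \<epsilon> \<le> u \<Longrightarrow> u < b \<Longrightarrow> \<bar>f u - l\<bar> \<le> w"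
  shows "\<bar>incr_avg f f \<epsilon> 0 b - incr_avg f f \<epsilon> 0 t - (f b - l)\<^sup>2\<bar> \<le> 8 * C * w + 20 * C\<^sup>2 * (b - t) / \<epsilon>"
proof -
  define D where "D = (f b - l)\<^sup>2"
  have w0: "0 \<le> w" and C0: "0 \<le> C"
    using order_trans[OF abs_ge_zero w[of t]] order_trans[OF abs_ge_zero C(2)] assms by auto
  have fb: "\<bar>f b\<bar> \<le> C" using C(1)[of b] assms by auto
  have D: "0 \<le> D" "D \<le> 4 * C\<^sup>2"
  proof -
    have "\<bar>f b - l\<bar> \<le> 2 * C" using fb C(2) by linarith
    from power_mono[OF this, of 2] show "D \<le> 4 * C\<^sup>2" by (simp add: D_def power_mult_distrib)
  qed (simp add: D_def)
  have ib: "set_integrable lborel {0..b} (incr_prod f f \<epsilon> b)"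
    and it: "set_integrable lborel {0..t} (incr_prod f f \<epsilon> t)"
    and itb: "set_integrable lborel {t..b} (incr_prod f f \<epsilon> b)"
    by (rule incr_prod_integrable[OF f f]; use assms in simp)+
  have ibt: "set_integrable lborel {0..t} (incr_prod f f \<epsilon> b)"
    by (rule set_integrable_subset[OF ib]) (use assms in auto)
  let ?I = "\<lambda>s. D * indicator {b - \<epsilon>..t} s :: real"
  let ?P = "\<lambda>s. incr_prod f f \<epsilon> b s - incr_prod f f \<epsilon> t s - ?I s"
  have iP: "set_integrable lborel {0..t} ?P"
    by (intro set_integral_diff(1) ibt it set_integrable_indicator_Icc)
  have eqP: "(LINT s:{0..t}|lborel. ?P s) = (LINT s:{0..t}|lborel. incr_prod f f \<epsilon> b s)
      - (LINT s:{0..t}|lborel. incr_prod f f \<epsilon> t s) - D * (t - (b - \<epsilon>))"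
    using set_integral_diff(2)[OF set_integral_diff(1)[OF ibt it] set_integrable_indicator_Icc[of 0 t D "b - \<epsilon>" t]]
      set_integral_diff(2)[OF ibt it] set_integral_indicator_Icc[of "b - \<epsilon>" t 0 t D] assms by simp
  have bd: "\<bar>?P s\<bar> \<le> (8 * C * w) * indicator {b - \<epsilon>..t} s + (12 * C\<^sup>2) * indicator {t - \<epsilon>..b - \<epsilon>} s"
    if s: "s \<in> {0..t}" for s
  proof -
    have Cw: "0 \<le> C * w" "0 \<le> C\<^sup>2" using w0 C0 by auto
    consider "s < t - \<epsilon>" | "t - \<epsilon> \<le> s" "s \<le> b - \<epsilon>" | "b - \<epsilon> < s" by linarith
    then show ?thesis
    proof cases
      case 1
      then have "min (s + \<epsilon>) t = s + \<epsilon>" "min (s + \<epsilon>) b = s + \<epsilon>" using assms by auto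
      then show ?thesis using 1 assms w0 C0 by (simp add: incr_prod_def)
    next
      case 2
      have "\<bar>incr_prod f f \<epsilon> b s\<bar> \<le> 4 * C\<^sup>2" "\<bar>incr_prod f f \<epsilon> t s\<bar> \<le> 4 * C\<^sup>2"
        using s assms by (auto intro!: abs_incr_prod_le[OF C(1) C(1)])
      moreover have "0 \<le> ?I s" "?I s \<le> 4 * C\<^sup>2" using D Cw by (auto simp: indicator_def)
      ultimately have "\<bar>?P s\<bar> \<le> 12 * C\<^sup>2" by linarith
      moreover have "0 \<le> (8 * C * w) * indicator {b - \<epsilon>..t} s" using Cw by (simp add: indicator_def)
      moreover have "(12 * C\<^sup>2) * indicator {t - \<epsilon>..b - \<epsilon>} s = 12 * C\<^sup>2" using 2 by simp
      ultimately show ?thesis by linarith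
    next
      case 3
      then have m: "min (s + \<epsilon>) t = t" "min (s + \<epsilon>) b = b" using assms by auto
      have fs: "\<bar>f s - l\<bar> \<le> w" and ft: "\<bar>f t - l\<bar> \<le> w" using w[of s] w[of t] 3 s assms by auto
      have Cs: "\<bar>f s\<bar> \<le> C" "\<bar>f t\<bar> \<le> C" using C(1)[of s] C(1)[of t] s assms by auto
      have "\<bar>(l - f s) * (2 * f b - f s - l)\<bar> \<le> w * (4 * C)" unfolding abs_mult
        using fs fb Cs C(2) by (intro mult_mono) auto
      moreover have "\<bar>(f t - f s) * (f t - f s)\<bar> \<le> (2 * w) * (2 * C)" unfolding abs_mult
        using fs ft Cs w0 by (intro mult_mono) auto
      moreover have "incr_prod f f \<epsilon> b s - D = (l - f s) * (2 * f b - f s - l)"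
        unfolding incr_prod_def m D_def by (simp add: power2_eq_square algebra_simps)
      moreover have "incr_prod f f \<epsilon> t s = (f t - f s) * (f t - f s)"
        unfolding incr_prod_def m ..
      moreover have I: "?I s = D" "indicator {b - \<epsilon>..t} s = (1 :: real)" using 3 s by auto
      moreover have "w * (4 * C) + (2 * w) * (2 * C) = 8 * C * w" by simp
      ultimately have "\<bar>?P s\<bar> \<le> 8 * C * w" by linarith
      moreover have "0 \<le> (12 * C\<^sup>2) * indicator {t - \<epsilon>..b - \<epsilon>} s" using Cw by (simp add: indicator_def)
      ultimately show ?thesis unfolding I by linarith
    qed
  qed
  have "\<bar>LINT s:{0..t}|lborel. ?P s\<bar> \<le> (LINT s:{0..t}|lborel. (8 * C * w) * indicator {b - \<epsilon>..t} s
      + (12 * C\<^sup>2) * indicator {t - \<epsilon>..b - \<epsilon>} s)"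
    by (intro abs_set_integral_le iP set_integral_add(1) set_integrable_indicator_Icc bd)
  also have "\<dots> = (LINT s:{0..t}|lborel. (8 * C * w) * indicator {b - \<epsilon>..t} s)
      + (LINT s:{0..t}|lborel. (12 * C\<^sup>2) * indicator {t - \<epsilon>..b - \<epsilon>} s)"
    by (intro set_integral_add(2) set_integrable_indicator_Icc)
  also have "\<dots> \<le> (8 * C * w) * (t - (b - \<epsilon>)) + (12 * C\<^sup>2) * (b - \<epsilon> - (t - \<epsilon>))"
    by (intro add_mono set_integral_indicator_Icc_le) (use assms w0 C0 in auto)
  also have "\<dots> \<le> (8 * C * w) * \<epsilon> + 12 * C\<^sup>2 * (b - t)"
    using w0 C0 assms by (intro add_mono mult_left_mono) auto
  finally have 1: "\<bar>LINT s:{0..t}|lborel. ?P s\<bar> \<le> (8 * C * w) * \<epsilon> + 12 * C\<^sup>2 * (b - t)" .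
  have "\<bar>LINT s:{t..b}|lborel. incr_prod f f \<epsilon> b s\<bar> \<le> (LINT s:{t..b}|lborel. (4 * C\<^sup>2) * indicator {t..b} s)"
    by (rule abs_set_integral_le[OF itb set_integrable_indicator_Icc])
      (use abs_incr_prod_le[OF C(1) C(1)] assms in auto)
  also have "\<dots> \<le> 4 * C\<^sup>2 * (b - t)"
    by (rule set_integral_indicator_Icc_le) (use assms in auto)
  finally have 2: "\<bar>LINT s:{t..b}|lborel. incr_prod f f \<epsilon> b s\<bar> \<le> 4 * C\<^sup>2 * (b - t)" .
  have 3: "\<bar>D * (b - t)\<bar> \<le> 4 * C\<^sup>2 * (b - t)"
    using D assms by (simp add: abs_mult mult_right_mono)
  have "\<epsilon> * (incr_avg f f \<epsilon> 0 b - incr_avg f f \<epsilon> 0 t - D)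
     = (LINT s:{0..t}|lborel. ?P s) + (LINT s:{t..b}|lborel. incr_prod f f \<epsilon> b s) - D * (b - t)"
    using set_integral_combine_Icc[OF ib, of t] \<open>0 < \<epsilon>\<close> assms unfolding eqP incr_avg_def
    by (simp add: algebra_simps)
  then have "\<bar>\<epsilon> * (incr_avg f f \<epsilon> 0 b - incr_avg f f \<epsilon> 0 t - D)\<bar> \<le> (8 * C * w) * \<epsilon> + 20 * C\<^sup>2 * (b - t)"
    using 1 2 3 by linarith
  then have "\<epsilon> * \<bar>incr_avg f f \<epsilon> 0 b - incr_avg f f \<epsilon> 0 t - D\<bar> \<le> \<epsilon> * (8 * C * w + 20 * C\<^sup>2 * (b - t) / \<epsilon>)"
    using \<open>0 < \<epsilon>\<close> by (simp add: abs_mult distrib_left mult.commute)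
  then show ?thesis
    using \<open>0 < \<epsilon>\<close> by (simp add: D_def)
qed

text \<open>The alternative in the premise serves two purposes: small \<open>\<epsilon>\<close> and arbitrary \<open>t\<close> for
  limits along \<open>\<epsilon>\<^sub>n\<close>, and \<open>t\<close> near \<open>a\<close> for the right continuity at fixed
  \<open>\<epsilon>\<close>.\<close>

lemma incr_avg_restart_small:
  assumes f: "cadlag_on T f" and g: "cadlag_on T g" and "0 < T" "0 \<le> a" "a \<le> T" "0 < e"
  obtains d where "0 < d" "\<And>\<epsilon> t. 0 < \<epsilon> \<Longrightarrow> a \<le> t \<Longrightarrow> t \<le> T \<Longrightarrow> \<epsilon> < d \<or> t < a + d \<Longrightarrow>
    \<bar>incr_avg f g \<epsilon> 0 t - incr_avg f g \<epsilon> 0 a - incr_avg f g \<epsilon> a t\<bar> \<le> e"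
proof (cases "a < T")
  case False
  then have "t = a" if "a \<le> t" "t \<le> T" for t using assms that by auto
  then show thesis
    by (intro that[of 1]) (use incr_avg_start \<open>0 < e\<close> in fastforce)+
next
  case True
  obtain C where C0: "0 < C" and C: "\<And>u. 0 \<le> u \<Longrightarrow> u \<le> T \<Longrightarrow> \<bar>f u\<bar> \<le> C"
      "\<And>u. 0 \<le> u \<Longrightarrow> u \<le> T \<Longrightarrow> \<bar>g u\<bar> \<le> C"
    by (rule cadlag_bounded2[OF f g \<open>0 < T\<close>]) blast
  define w where "w = e / (4 * C)"
  have w: "0 < w" "4 * C * w = e" using C0 \<open>0 < e\<close> by (auto simp: w_def)
  obtain d1 where d1: "0 < d1" "\<And>u. a \<le> u \<Longrightarrow> u < a + d1 \<Longrightarrow> \<bar>f u - f a\<bar> \<le> w"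
    using cadlag_right[OF f \<open>0 \<le> a\<close> True w(1)] by blast
  obtain d2 where d2: "0 < d2" "\<And>u. a \<le> u \<Longrightarrow> u < a + d2 \<Longrightarrow> \<bar>g u - g a\<bar> \<le> w"
    using cadlag_right[OF g \<open>0 \<le> a\<close> True w(1)] by blast
  show thesis
  proof (rule that[of "min d1 d2"])
    fix \<epsilon> t assume t: "0 < \<epsilon>" "a \<le> t" "t \<le> T" "\<epsilon> < min d1 d2 \<or> t < a + min d1 d2"
    show "\<bar>incr_avg f g \<epsilon> 0 t - incr_avg f g \<epsilon> 0 a - incr_avg f g \<epsilon> a t\<bar> \<le> e"
      unfolding w(2)[symmetric]
      by (rule incr_avg_restart[OF f g \<open>0 < T\<close> C]) (use t assms d1 d2 in auto)
  qed (use d1 d2 in auto)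
qed

lemma incr_avg_right_cont:
  assumes f: "cadlag_on T f" and g: "cadlag_on T g" and "0 < T" "0 \<le> a" "a \<le> T" "0 < e" "0 < \<epsilon>"
  obtains d where "0 < d" "\<And>t. a \<le> t \<Longrightarrow> t \<le> T \<Longrightarrow> t < a + d \<Longrightarrow>
    \<bar>incr_avg f g \<epsilon> 0 t - incr_avg f g \<epsilon> 0 a\<bar> \<le> e"
proof -
  obtain C where C0: "0 < C" and C: "\<And>u. 0 \<le> u \<Longrightarrow> u \<le> T \<Longrightarrow> \<bar>f u\<bar> \<le> C"
      "\<And>u. 0 \<le> u \<Longrightarrow> u \<le> T \<Longrightarrow> \<bar>g u\<bar> \<le> C"
    by (rule cadlag_bounded2[OF f g \<open>0 < T\<close>]) blast
  have e2: "0 < e / 2" using \<open>0 < e\<close> by simp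
  obtain d where d: "0 < d" "\<And>\<epsilon> t. 0 < \<epsilon> \<Longrightarrow> a \<le> t \<Longrightarrow> t \<le> T \<Longrightarrow> \<epsilon> < d \<or> t < a + d \<Longrightarrow>
    \<bar>incr_avg f g \<epsilon> 0 t - incr_avg f g \<epsilon> 0 a - incr_avg f g \<epsilon> a t\<bar> \<le> e / 2"
    using incr_avg_restart_small[OF f g assms(3-5) e2] by blast
  define d' where "d' = min d (e * \<epsilon> / (8 * C\<^sup>2))"
  show thesis
  proof (rule that[of d'])
    show "0 < d'" using d C0 assms by (auto simp: d'_def)
    fix t assume t: "a \<le> t" "t \<le> T" "t < a + d'"
    have "\<bar>incr_avg f g \<epsilon> a t\<bar> \<le> 4 * C\<^sup>2 * (t - a) / \<epsilon>"
      by (rule abs_incr_avg_le[OF f g \<open>0 < T\<close> C]) (use assms t in auto)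
    also have "\<dots> \<le> 4 * C\<^sup>2 * (e * \<epsilon> / (8 * C\<^sup>2)) / \<epsilon>"
      using t C0 assms by (intro divide_right_mono mult_left_mono) (auto simp: d'_def)
    also have "\<dots> = e / 2" using C0 assms by (simp add: field_simps)
    finally have "\<bar>incr_avg f g \<epsilon> a t\<bar> \<le> e / 2" .
    moreover have "\<bar>incr_avg f g \<epsilon> 0 t - incr_avg f g \<epsilon> 0 a - incr_avg f g \<epsilon> a t\<bar> \<le> e / 2"
      by (rule d(2)) (use t assms in \<open>auto simp: d'_def\<close>)
    ultimately show "\<bar>incr_avg f g \<epsilon> 0 t - incr_avg f g \<epsilon> 0 a\<bar> \<le> e" by linarith
  qed
qed

section \<open>The jumps and the continuous component of a covariation\<close>

lemma infsum_Ioc_diff: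
  fixes h :: "real \<Rightarrow> real"
  assumes "h summable_on {0<..T}" "0 \<le> x" "x \<le> y" "y \<le> T"
  shows "infsum h {0<..y} - infsum h {0<..x} = infsum h {x<..y}"
proof -
  have "h summable_on {0<..x}" "h summable_on {x<..y}"
    by (rule summable_on_subset_banach[OF assms(1)]; use assms in auto)+
  from infsum_Un_disjoint[OF this] have "infsum h ({0<..x} \<union> {x<..y}) = infsum h {0<..x} + infsum h {x<..y}"
    by auto
  moreover have "{0<..x} \<union> {x<..y} = {0<..y}" using assms by auto
  ultimately show ?thesis by simp
qed

text \<open>What a quadratic variation looks like: right continuous and increasing, with a jump of size
  \<open>q t\<close> at time \<open>t\<close>.\<close>

locale increasing_with_jumps =
  fixes T :: real and A q :: "real \<Rightarrow> real"
  assumes T_pos: "0 < T"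
    and mono: "\<And>x y. 0 \<le> x \<Longrightarrow> x \<le> y \<Longrightarrow> y \<le> T \<Longrightarrow> A x \<le> A y"
    and q_nonneg: "\<And>s. 0 \<le> q s"
    and right: "\<And>t e. 0 \<le> t \<Longrightarrow> t \<le> T \<Longrightarrow> 0 < e \<Longrightarrow>
      \<exists>d>0. \<forall>u. t \<le> u \<and> u < t + d \<and> u \<le> T \<longrightarrow> \<bar>A u - A t\<bar> \<le> e"
    and left: "\<And>t e. 0 < t \<Longrightarrow> t \<le> T \<Longrightarrow> 0 < e \<Longrightarrow>
      \<exists>d>0. \<forall>u. t - d < u \<and> u < t \<and> 0 \<le> u \<longrightarrow> \<bar>A t - A u - q t\<bar> \<le> e"
begin

text \<open>By induction on the largest jump time \<open>b\<close>: the earlier jumps are bounded by the increase up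
  to a time shortly before \<open>b\<close>, and letting that time tend to \<open>b\<close> leaves room for the
  jump at \<open>b\<close>.\<close>

lemma sum_jumps_le:
  assumes "finite S" "S \<subseteq> {x<..y}" "0 \<le> x" "x \<le> y" "y \<le> T"
  shows "sum q S \<le> A y - A x"
  using assms
proof (induction S arbitrary: y rule: finite_linorder_max_induct)
  case empty
  then show ?case using mono[of x y] by simp
next
  case (insert b S)
  have b: "x < b" "b \<le> y" using insert.prems by auto
  define m0 where "m0 = Max (insert x S)"
  have m0: "x \<le> m0" "m0 < b" "\<And>s. s \<in> S \<Longrightarrow> s \<le> m0"
    using insert.hyps b by (auto simp: m0_def)
  have "sum q S \<le> A b - q b - A x"
  proof (rule field_le_epsilon)
    fix e :: real assume "0 < e"
    then obtain d where d: "d > 0" "\<And>u. b - d < u \<Longrightarrow> u < b \<Longrightarrow> 0 \<le> u \<Longrightarrow> \<bar>A b - A u - q b\<bar> \<le> e"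
      using left[of b e] b insert.prems by (meson le_less_trans order_trans)
    \<comment> \<open>a time before \<open>b\<close> that is late enough for the left limit and after all of \<open>S\<close>\<close>
    define m where "m = max m0 (b - d / 2)"
    have m: "m0 \<le> m" "b - d < m" "m < b" using d(1) m0(2) by (auto simp: m_def)
    have "S \<subseteq> {x<..m}" using insert.prems m0(3) m(1) by (force intro: order_trans)
    then have "sum q S \<le> A m - A x"
      using insert.IH[of m] m m0 b insert.prems by auto
    moreover have "\<bar>A b - A m - q b\<bar> \<le> e" using d(2)[of m] m m0 insert.prems by auto
    ultimately show "sum q S \<le> A b - q b - A x + e" by linarith
  qed
  moreover have "sum q (insert b S) = q b + sum q S"
    using insert.hyps by (subst sum.insert) auto
  moreover have "A b \<le> A y" using mono[of b y] b insert.prems by auto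
  ultimately show ?case by linarith
qed

lemma summable_jumps: "q summable_on {0<..T}"
proof (rule nonneg_bdd_above_summable_on)
  show "bdd_above (sum q ` {F. F \<subseteq> {0<..T} \<and> finite F})"
    using sum_jumps_le[of _ 0 T] T_pos by (auto intro!: bdd_aboveI[where M = "A T - A 0"])
qed (rule q_nonneg)

lemma summable_jumps_Ioc: "0 \<le> x \<Longrightarrow> y \<le> T \<Longrightarrow> q summable_on {x<..y}"
  by (rule summable_on_subset_banach[OF summable_jumps]) auto

lemma infsum_jumps_le:
  assumes "0 \<le> x" "x \<le> y" "y \<le> T"
  shows "infsum q {x<..y} \<le> A y - A x"
  by (rule infsum_le_finite_sums[OF summable_jumps_Ioc]) (use assms sum_jumps_le in auto)

definition cont_part :: "real \<Rightarrow> real" where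
  "cont_part t = A t - infsum q {0<..t}"

lemma cont_part_diff:
  assumes "0 \<le> x" "x \<le> y" "y \<le> T"
  shows "cont_part y - cont_part x = A y - A x - infsum q {x<..y}"
  using infsum_Ioc_diff[OF summable_jumps assms] by (simp add: cont_part_def)

lemma cont_part_mono:
  assumes "0 \<le> x" "x \<le> y" "y \<le> T" shows "cont_part x \<le> cont_part y"
  using cont_part_diff[OF assms] infsum_jumps_le[OF assms] by simp

lemma cont_part_diff_le:
  assumes "0 \<le> x" "x \<le> y" "y \<le> T"
  shows "cont_part y - cont_part x \<le> A y - A x"
  using cont_part_diff[OF assms] infsum_nonneg[of "{x<..y}" q] q_nonneg by simp

lemma cont_part_diff_le_jump:
  assumes "0 \<le> x" "x < y" "y \<le> T"
  shows "cont_part y - cont_part x \<le> A y - A x - q y"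
proof -
  have "sum q {y} \<le> infsum q {x<..y}"
    by (rule finite_sum_le_infsum[OF summable_jumps_Ioc]) (use assms q_nonneg in auto)
  then show ?thesis using cont_part_diff[of x y] assms by simp
qed

text \<open>To the right the increments of \<open>cont_part\<close> are bounded by those of \<open>A\<close>, to the left
  by those of \<open>A\<close> with the jump at the end point removed; both tend to \<open>0\<close>.\<close>

lemma continuous_cont_part: "continuous_on {0..T} cont_part"
  unfolding continuous_on_iff
proof (intro ballI allI impI)
  fix t e :: real assume t: "t \<in> {0..T}" and e: "0 < e"
  then have e2: "0 < e / 2" by simp
  obtain d1 where d1: "d1 > 0" "\<And>u. t \<le> u \<Longrightarrow> u < t + d1 \<Longrightarrow> u \<le> T \<Longrightarrow> \<bar>A u - A t\<bar> \<le> e / 2"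
    using right[of t "e/2"] t e2 by auto
  obtain d2 where d2: "d2 > 0" "\<And>u. t - d2 < u \<Longrightarrow> u < t \<Longrightarrow> 0 \<le> u \<Longrightarrow> \<bar>A t - A u - q t\<bar> \<le> e / 2"
  proof (cases "0 < t")
    case True
    then obtain d where "d > 0" "\<forall>u. t - d < u \<and> u < t \<and> 0 \<le> u \<longrightarrow> \<bar>A t - A u - q t\<bar> \<le> e / 2"
      using left[of t "e/2"] t e2 by auto
    then show ?thesis by (intro that[of d]) auto
  next
    case False
    show ?thesis by (rule that[of 1]) (use False in auto)
  qed
  show "\<exists>d>0. \<forall>u\<in>{0..T}. dist u t < d \<longrightarrow> dist (cont_part u) (cont_part t) < e"
  proof (intro exI[of _ "min d1 d2"] conjI ballI impI)
    fix u assume u: "u \<in> {0..T}" "dist u t < min d1 d2"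
    show "dist (cont_part u) (cont_part t) < e"
    proof (cases "t \<le> u")
      case True
      then show ?thesis
        using cont_part_mono[of t u] cont_part_diff_le[of t u] d1(2)[of u] u t e
        by (auto simp: dist_real_def)
    next
      case False
      then show ?thesis
        using cont_part_mono[of u t] cont_part_diff_le_jump[of u t] d2(2)[of u] u t e
        by (auto simp: dist_real_def)
    qed
  qed (use d1 d2 in auto)
qed

end

lemma incr_avg_restart_eventually:
  assumes f: "cadlag_on T f" and g: "cadlag_on T g" and "0 < T" "0 \<le> a" "a \<le> T" "0 < e"
    and \<epsilon>: "\<And>n. 0 < \<epsilon> n" "\<epsilon> \<longlonglongrightarrow> 0"
  shows "\<forall>\<^sub>F n in sequentially. \<forall>t\<in>{a..T}.
    \<bar>incr_avg f g (\<epsilon> n) 0 t - incr_avg f g (\<epsilon> n) 0 a - incr_avg f g (\<epsilon> n) a t\<bar> \<le> e"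
proof -
  obtain d where d: "0 < d" "\<And>\<epsilon> t. 0 < \<epsilon> \<Longrightarrow> a \<le> t \<Longrightarrow> t \<le> T \<Longrightarrow> \<epsilon> < d \<or> t < a + d \<Longrightarrow>
    \<bar>incr_avg f g \<epsilon> 0 t - incr_avg f g \<epsilon> 0 a - incr_avg f g \<epsilon> a t\<bar> \<le> e"
    by (rule incr_avg_restart_small[OF f g assms(3-6)]) blast
  have "\<forall>\<^sub>F n in sequentially. \<epsilon> n < d"
    using order_tendstoD(2)[OF \<epsilon>(2) d(1)] .
  then show ?thesis
    by eventually_elim (use d(2) \<epsilon>(1) in auto)
qed

lemma uniform_limitD_abs:
  fixes H :: "nat \<Rightarrow> real \<Rightarrow> real"
  assumes "uniform_limit S H A sequentially" "0 < e"
  shows "\<forall>\<^sub>F n in sequentially. \<forall>t\<in>S. \<bar>H n t - A t\<bar> \<le> e"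
  using uniform_limitD[OF assms] by eventually_elim (auto simp: dist_real_def intro: less_imp_le)

text \<open>Monotonicity holds because the averages over \<open>[x, y]\<close> are nonnegative. Right continuity and
  the jumps are read off from the average for one fixed, sufficiently small \<open>\<epsilon> n\<close>, which by
  uniform convergence differs little from \<open>A\<close> at all times simultaneously.\<close>

lemma quadratic_variation_structure:
  assumes f: "cadlag_on T f" and T: "0 < T"
    and \<epsilon>: "\<And>n. 0 < \<epsilon> n" "\<epsilon> \<longlonglongrightarrow> 0"
    and lim: "uniform_limit {0..T} (\<lambda>n t. incr_avg f f (\<epsilon> n) 0 t) A sequentially"
  shows "increasing_with_jumps T A (\<lambda>s. (jump f s)\<^sup>2)"
proof
  show "0 < T" by fact
  show "0 \<le> (jump f s)\<^sup>2" for s by simp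
  show "A x \<le> A y" if xy: "0 \<le> x" "x \<le> y" "y \<le> T" for x y
  proof (rule field_le_epsilon)
    fix e :: real assume "0 < e"
    then have e: "0 < e / 3" by simp
    have "x \<le> T" using xy by simp
    from eventually_conj[OF incr_avg_restart_eventually[OF f f T \<open>0 \<le> x\<close> this e \<epsilon>] uniform_limitD_abs[OF lim e]]
    obtain n where n: "\<forall>t\<in>{x..T}. \<bar>incr_avg f f (\<epsilon> n) 0 t - incr_avg f f (\<epsilon> n) 0 x - incr_avg f f (\<epsilon> n) x t\<bar> \<le> e / 3"
      "\<forall>t\<in>{0..T}. \<bar>incr_avg f f (\<epsilon> n) 0 t - A t\<bar> \<le> e / 3"
      by (auto dest!: eventually_happens)
    have "\<bar>incr_avg f f (\<epsilon> n) 0 y - incr_avg f f (\<epsilon> n) 0 x - incr_avg f f (\<epsilon> n) x y\<bar> \<le> e / 3"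
      "\<bar>incr_avg f f (\<epsilon> n) 0 x - A x\<bar> \<le> e / 3" "\<bar>incr_avg f f (\<epsilon> n) 0 y - A y\<bar> \<le> e / 3"
      using n xy by auto
    then show "A x \<le> A y + e" using incr_avg_nonneg[OF \<epsilon>(1), of f n x y] by linarith
  qed
  show "\<exists>d>0. \<forall>u. t \<le> u \<and> u < t + d \<and> u \<le> T \<longrightarrow> \<bar>A u - A t\<bar> \<le> e"
    if t: "0 \<le> t" "t \<le> T" "0 < e" for t e
  proof -
    have e: "0 < e / 3" using t by simp
    obtain n where n: "\<forall>t\<in>{0..T}. \<bar>incr_avg f f (\<epsilon> n) 0 t - A t\<bar> \<le> e / 3"
      using uniform_limitD_abs[OF lim e] by (auto dest!: eventually_happens)
    obtain d where d: "0 < d" "\<And>u. t \<le> u \<Longrightarrow> u \<le> T \<Longrightarrow> u < t + d \<Longrightarrow>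
      \<bar>incr_avg f f (\<epsilon> n) 0 u - incr_avg f f (\<epsilon> n) 0 t\<bar> \<le> e / 3"
      by (rule incr_avg_right_cont[OF f f T t(1,2) e \<epsilon>(1)]) blast
    show ?thesis
    proof (intro exI[of _ d] conjI allI impI)
      fix u assume u: "t \<le> u \<and> u < t + d \<and> u \<le> T"
      have "\<bar>incr_avg f f (\<epsilon> n) 0 u - A u\<bar> \<le> e / 3" "\<bar>incr_avg f f (\<epsilon> n) 0 t - A t\<bar> \<le> e / 3"
        using n u t by auto
      then show "\<bar>A u - A t\<bar> \<le> e" using d(2)[of u] u by linarith
    qed (rule d(1))
  qed
  show "\<exists>d>0. \<forall>u. t - d < u \<and> u < t \<and> 0 \<le> u \<longrightarrow> \<bar>A t - A u - (jump f t)\<^sup>2\<bar> \<le> e"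
    if t: "0 < t" "t \<le> T" "0 < e" for t e
  proof -
    have e: "0 < e / 4" using t by simp
    obtain C where C0: "0 < C" and C: "\<And>u. 0 \<le> u \<Longrightarrow> u \<le> T \<Longrightarrow> \<bar>f u\<bar> \<le> C"
      by (rule cadlag_bounded[OF f T]) blast
    define l where "l = left_lim f t"
    have "l \<in> {-C..C}" unfolding l_def
      by (rule left_lim_in_closed[OF f t(1,2), of 0])
        (use C t in \<open>auto simp: abs_le_iff minus_le_iff\<close>)
    then have lC: "\<bar>l\<bar> \<le> C" by auto
    define w where "w = e / (32 * C)"
    have w: "0 < w" "8 * C * w = e / 4" using C0 t by (auto simp: w_def)
    obtain d where d: "0 < d" "d \<le> t" "\<And>u. t - d < u \<Longrightarrow> u < t \<Longrightarrow> \<bar>f u - l\<bar> \<le> w"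
      unfolding l_def by (rule cadlag_left[OF f t(1,2) w(1)]) blast
    have "\<forall>\<^sub>F n in sequentially. \<epsilon> n < d / 3"
      using order_tendstoD(2)[OF \<epsilon>(2), of "d / 3"] d(1) by simp
    from eventually_conj[OF this uniform_limitD_abs[OF lim e]]
    obtain n where n: "\<epsilon> n < d / 3" "\<forall>t\<in>{0..T}. \<bar>incr_avg f f (\<epsilon> n) 0 t - A t\<bar> \<le> e / 4"
      by (auto dest!: eventually_happens)
    \<comment> \<open>makes the second error term of \<open>incr_avg_jump\<close> at most \<open>e / 4\<close>\<close>
    define d' where "d' = min (\<epsilon> n) (e * \<epsilon> n / (80 * C\<^sup>2))"
    have d': "0 < d'" "d' \<le> \<epsilon> n" "20 * C\<^sup>2 * d' / \<epsilon> n \<le> e / 4"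
    proof -
      have "20 * C\<^sup>2 * d' / \<epsilon> n \<le> 20 * C\<^sup>2 * (e * \<epsilon> n / (80 * C\<^sup>2)) / \<epsilon> n"
        using \<epsilon>(1)[of n] by (intro divide_right_mono mult_left_mono) (auto simp: d'_def)
      also have "\<dots> = e / 4" using \<epsilon>(1)[of n] C0 by (simp add: field_simps)
      finally show "20 * C\<^sup>2 * d' / \<epsilon> n \<le> e / 4" .
    qed (use \<epsilon>(1)[of n] C0 t in \<open>auto simp: d'_def\<close>)
    show ?thesis
    proof (intro exI[of _ d'] conjI allI impI)
      fix u assume u: "t - d' < u \<and> u < t \<and> 0 \<le> u"
      have "\<bar>incr_avg f f (\<epsilon> n) 0 t - incr_avg f f (\<epsilon> n) 0 u - (f t - l)\<^sup>2\<bar>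
          \<le> 8 * C * w + 20 * C\<^sup>2 * (t - u) / \<epsilon> n"
      proof (rule incr_avg_jump[OF f T C lC \<epsilon>(1)])
        fix v assume "u - \<epsilon> n \<le> v" "v < t"
        then show "\<bar>f v - l\<bar> \<le> w" using d(3)[of v] u d' n(1) by auto
      qed (use u d d' n t in auto)
      also have "20 * C\<^sup>2 * (t - u) / \<epsilon> n \<le> 20 * C\<^sup>2 * d' / \<epsilon> n"
        using u \<epsilon>(1)[of n] by (intro divide_right_mono mult_left_mono) auto
      finally have "\<bar>incr_avg f f (\<epsilon> n) 0 t - incr_avg f f (\<epsilon> n) 0 u - (f t - l)\<^sup>2\<bar> \<le> e / 2"
        using d'(3) w(2) by linarith
      moreover have "\<bar>incr_avg f f (\<epsilon> n) 0 u - A u\<bar> \<le> e / 4" "\<bar>incr_avg f f (\<epsilon> n) 0 t - A t\<bar> \<le> e / 4"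
        using n u t by auto
      moreover have "(jump f t)\<^sup>2 = (f t - l)\<^sup>2" by (simp add: jump_def l_def)
      ultimately show "\<bar>A t - A u - (jump f t)\<^sup>2\<bar> \<le> e" by linarith
    qed (rule d'(1))
  qed
qed

text \<open>The situation of almost every outcome, along a suitable sequence of mesh sizes.\<close>

locale covariation_paths =
  fixes T :: real and f g :: "real \<Rightarrow> real" and \<epsilon> :: "nat \<Rightarrow> real" and A11 A12 A22 :: "real \<Rightarrow> real"
  assumes T_pos: "0 < T" and f: "cadlag_on T f" and g: "cadlag_on T g"
    and \<epsilon>_pos: "\<And>n. 0 < \<epsilon> n" and \<epsilon>_lim: "\<epsilon> \<longlonglongrightarrow> 0"
    and lim11: "uniform_limit {0..T} (\<lambda>n t. incr_avg f f (\<epsilon> n) 0 t) A11 sequentially"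
    and lim12: "uniform_limit {0..T} (\<lambda>n t. incr_avg f g (\<epsilon> n) 0 t) A12 sequentially"
    and lim22: "uniform_limit {0..T} (\<lambda>n t. incr_avg g g (\<epsilon> n) 0 t) A22 sequentially"
begin

sublocale Q1: increasing_with_jumps T A11 "\<lambda>s. (jump f s)\<^sup>2"
  by (rule quadratic_variation_structure[OF f T_pos \<epsilon>_pos \<epsilon>_lim lim11])

sublocale Q2: increasing_with_jumps T A22 "\<lambda>s. (jump g s)\<^sup>2"
  by (rule quadratic_variation_structure[OF g T_pos \<epsilon>_pos \<epsilon>_lim lim22])

sublocale Qs: increasing_with_jumps T "\<lambda>t. A11 t + 2 * A12 t + A22 t" "\<lambda>s. (jump (\<lambda>u. f u + g u) s)\<^sup>2"
proof (rule quadratic_variation_structure[OF cadlag_on_add[OF f g] T_pos \<epsilon>_pos \<epsilon>_lim])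
  have "uniform_limit {0..T} (\<lambda>n t. incr_avg f f (\<epsilon> n) 0 t + 2 * incr_avg f g (\<epsilon> n) 0 t + incr_avg g g (\<epsilon> n) 0 t)
      (\<lambda>t. A11 t + 2 * A12 t + A22 t) sequentially"
    by (intro uniform_limit_add lim11 lim22 bounded_linear_uniform_limit_intros(1)
        bounded_linear.uniform_limit[OF bounded_linear_mult_right] lim12)
  then show "uniform_limit {0..T} (\<lambda>n t. incr_avg (\<lambda>u. f u + g u) (\<lambda>u. f u + g u) (\<epsilon> n) 0 t)
      (\<lambda>t. A11 t + 2 * A12 t + A22 t) sequentially"
    by (rule uniform_limit_cong'[THEN iffD2, rotated 2])
      (use incr_avg_polarize(1)[OF f g T_pos \<epsilon>_pos] in auto)
qed

sublocale Qd: increasing_with_jumps T "\<lambda>t. A11 t - 2 * A12 t + A22 t" "\<lambda>s. (jump (\<lambda>u. f u - g u) s)\<^sup>2"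
proof (rule quadratic_variation_structure[OF cadlag_on_diff[OF f g] T_pos \<epsilon>_pos \<epsilon>_lim])
  have "uniform_limit {0..T} (\<lambda>n t. incr_avg f f (\<epsilon> n) 0 t - 2 * incr_avg f g (\<epsilon> n) 0 t + incr_avg g g (\<epsilon> n) 0 t)
      (\<lambda>t. A11 t - 2 * A12 t + A22 t) sequentially"
    by (intro uniform_limit_add uniform_limit_minus lim11 lim22
        bounded_linear.uniform_limit[OF bounded_linear_mult_right] lim12)
  then show "uniform_limit {0..T} (\<lambda>n t. incr_avg (\<lambda>u. f u - g u) (\<lambda>u. f u - g u) (\<epsilon> n) 0 t)
      (\<lambda>t. A11 t - 2 * A12 t + A22 t) sequentially"
    by (rule uniform_limit_cong'[THEN iffD2, rotated 2])
      (use incr_avg_polarize(2)[OF f g T_pos \<epsilon>_pos] in auto)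
qed

abbreviation jump_fg :: "real \<Rightarrow> real" where
  "jump_fg s \<equiv> jump f s * jump g s"

lemma summable_jump_fg: "jump_fg summable_on {0<..T}"
proof -
  have "(\<lambda>s. ((jump (\<lambda>u. f u + g u) s)\<^sup>2 + (- 1) * (jump f s)\<^sup>2 + (- 1) * (jump g s)\<^sup>2) * (1 / 2)) summable_on {0<..T}"
    by (intro summable_on_cmult_left summable_on_add summable_on_cmult_right Qs.summable_jumps Q1.summable_jumps Q2.summable_jumps)
  then show ?thesis
    by (rule summable_on_cong[THEN iffD1, rotated]) (simp add: jump_add[OF f g] power2_eq_square algebra_simps)
qed

lemma infsum_jumps_polarize:
  assumes "0 \<le> t" "t \<le> T"
  shows "(\<Sum>\<^sub>\<infinity>s\<in>{0<..t}. (jump (\<lambda>u. f u + g u) s)\<^sup>2)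
      = (\<Sum>\<^sub>\<infinity>s\<in>{0<..t}. (jump f s)\<^sup>2) + 2 * infsum jump_fg {0<..t} + (\<Sum>\<^sub>\<infinity>s\<in>{0<..t}. (jump g s)\<^sup>2)"
    and "(\<Sum>\<^sub>\<infinity>s\<in>{0<..t}. (jump (\<lambda>u. f u - g u) s)\<^sup>2)
      = (\<Sum>\<^sub>\<infinity>s\<in>{0<..t}. (jump f s)\<^sup>2) - 2 * infsum jump_fg {0<..t} + (\<Sum>\<^sub>\<infinity>s\<in>{0<..t}. (jump g s)\<^sup>2)"
proof -
  have s: "jump_fg summable_on {0<..t}" "(\<lambda>s. (jump f s)\<^sup>2) summable_on {0<..t}" "(\<lambda>s. (jump g s)\<^sup>2) summable_on {0<..t}"
    using Q1.summable_jumps_Ioc[of 0 t] Q2.summable_jumps_Ioc[of 0 t] summable_on_subset_banach[OF summable_jump_fg, of "{0<..t}"] assms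
    by (auto simp: subset_eq)
  note h = s(1)[THEN has_sum_infsum] s(2)[THEN has_sum_infsum] s(3)[THEN has_sum_infsum]
  have "((\<lambda>s. (jump f s)\<^sup>2 + 2 * jump_fg s + (jump g s)\<^sup>2) has_sum
     (\<Sum>\<^sub>\<infinity>s\<in>{0<..t}. (jump f s)\<^sup>2) + 2 * infsum jump_fg {0<..t} + (\<Sum>\<^sub>\<infinity>s\<in>{0<..t}. (jump g s)\<^sup>2)) {0<..t}"
    by (intro has_sum_add h has_sum_cmult_right)
  note * = infsumI[OF this]
  have eq: "(\<Sum>\<^sub>\<infinity>s\<in>{0<..t}. (jump (\<lambda>u. f u + g u) s)\<^sup>2) = infsum (\<lambda>s. (jump f s)\<^sup>2 + 2 * jump_fg s + (jump g s)\<^sup>2) {0<..t}"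
    by (rule infsum_cong) (use assms in \<open>simp add: jump_add[OF f g] power2_eq_square algebra_simps\<close>)
  show "(\<Sum>\<^sub>\<infinity>s\<in>{0<..t}. (jump (\<lambda>u. f u + g u) s)\<^sup>2)
      = (\<Sum>\<^sub>\<infinity>s\<in>{0<..t}. (jump f s)\<^sup>2) + 2 * infsum jump_fg {0<..t} + (\<Sum>\<^sub>\<infinity>s\<in>{0<..t}. (jump g s)\<^sup>2)"
    unfolding eq * by simp
  have "((\<lambda>s. (jump f s)\<^sup>2 + (- 2) * jump_fg s + (jump g s)\<^sup>2) has_sum
     (\<Sum>\<^sub>\<infinity>s\<in>{0<..t}. (jump f s)\<^sup>2) + (- 2) * infsum jump_fg {0<..t} + (\<Sum>\<^sub>\<infinity>s\<in>{0<..t}. (jump g s)\<^sup>2)) {0<..t}"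
    by (intro has_sum_add h has_sum_cmult_right)
  note * = infsumI[OF this]
  have eq: "(\<Sum>\<^sub>\<infinity>s\<in>{0<..t}. (jump (\<lambda>u. f u - g u) s)\<^sup>2) = infsum (\<lambda>s. (jump f s)\<^sup>2 + (- 2) * jump_fg s + (jump g s)\<^sup>2) {0<..t}"
    by (rule infsum_cong) (use assms in \<open>simp add: jump_diff[OF f g] power2_eq_square algebra_simps\<close>)
  show "(\<Sum>\<^sub>\<infinity>s\<in>{0<..t}. (jump (\<lambda>u. f u - g u) s)\<^sup>2)
      = (\<Sum>\<^sub>\<infinity>s\<in>{0<..t}. (jump f s)\<^sup>2) - 2 * infsum jump_fg {0<..t} + (\<Sum>\<^sub>\<infinity>s\<in>{0<..t}. (jump g s)\<^sup>2)"
    unfolding eq * by simp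
qed

definition cont_cov :: "real \<Rightarrow> real" where
  "cont_cov t = A12 t - infsum jump_fg {0<..t}"

definition cont_dom :: "real \<Rightarrow> real" where
  "cont_dom t = (Q1.cont_part t + Q2.cont_part t) / 2"

lemma continuous_cont_dom: "continuous_on {0..T} cont_dom"
  unfolding cont_dom_def
  by (intro continuous_intros Q1.continuous_cont_part Q2.continuous_cont_part) auto

text \<open>The continuous components of the quadratic variations of \<open>f + g\<close> and \<open>f - g\<close> are
  increasing, and they are those of \<open>f\<close> and \<open>g\<close> plus or minus twice
  \<open>cont_cov\<close>.\<close>

lemma cont_cov_le_dom:
  assumes "0 \<le> x" "x \<le> y" "y \<le> T"
  shows "\<bar>cont_cov y - cont_cov x\<bar> \<le> cont_dom y - cont_dom x"
proof -
  have eq: "Qs.cont_part t = Q1.cont_part t + 2 * cont_cov t + Q2.cont_part t"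
    "Qd.cont_part t = Q1.cont_part t - 2 * cont_cov t + Q2.cont_part t" if "0 \<le> t" "t \<le> T" for t
    using infsum_jumps_polarize[OF that]
    unfolding Qs.cont_part_def Qd.cont_part_def Q1.cont_part_def Q2.cont_part_def cont_cov_def by auto
  have "0 \<le> y" "x \<le> T" using assms by auto
  note eqs = eq[OF \<open>0 \<le> x\<close> \<open>x \<le> T\<close>] eq[OF \<open>0 \<le> y\<close> \<open>y \<le> T\<close>]
  have aux: "\<bar>v - u\<bar> \<le> (p' + r') / 2 - (p + r) / 2"
    if "p + 2 * u + r \<le> p' + 2 * v + r'" "p - 2 * u + r \<le> p' - 2 * v + r'" for p p' r r' u v :: real
    using that by argo
  show ?thesis
    unfolding cont_dom_def
    by (rule aux) (use Qs.cont_part_mono[OF assms] Qd.cont_part_mono[OF assms] in \<open>simp_all only: eqs\<close>)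
qed

end

section \<open>Stieltjes integrals against a dominated function\<close>

text \<open>A function of bounded variation is accessed through a continuous function \<open>G\<close> that dominates
  its increments, so that total variations only have to be compared with increments of \<open>G\<close>.\<close>

locale dominated_function =
  fixes T :: real and F G :: "real \<Rightarrow> real"
  assumes T_pos: "0 < T"
    and dom: "\<And>x y. 0 \<le> x \<Longrightarrow> x \<le> y \<Longrightarrow> y \<le> T \<Longrightarrow> \<bar>F y - F x\<bar> \<le> G y - G x"
    and cont_G: "continuous_on {0..T} G"
begin

lemma G_mono: "0 \<le> x \<Longrightarrow> x \<le> y \<Longrightarrow> y \<le> T \<Longrightarrow> G x \<le> G y"
  using dom[of x y] by linarith

lemma continuous_of_increments:
  fixes H :: "real \<Rightarrow> real"
  assumes "\<And>x y. 0 \<le> x \<Longrightarrow> x \<le> y \<Longrightarrow> y \<le> T \<Longrightarrow> \<bar>H y - H x\<bar> \<le> G y - G x"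
  shows "continuous_on {0..T} H"
  unfolding continuous_on_iff
proof (intro ballI allI impI)
  fix x e :: real assume x: "x \<in> {0..T}" and "0 < e"
  then obtain d where d: "0 < d" "\<And>y. y \<in> {0..T} \<Longrightarrow> dist y x < d \<Longrightarrow> dist (G y) (G x) < e"
    using cont_G unfolding continuous_on_iff by metis
  have "dist (H y) (H x) < e" if "y \<in> {0..T}" "dist y x < d" for y
    using d(2)[OF that] assms[of x y] assms[of y x] x that
    by (cases "x \<le> y") (auto simp: dist_real_def)
  then show "\<exists>d>0. \<forall>y\<in>{0..T}. dist y x < d \<longrightarrow> dist (H y) (H x) < e"
    using d(1) by blast
qed

lemma continuous_F: "continuous_on {0..T} F"
  by (rule continuous_of_increments[OF dom])

lemma variation_sum_le:
  assumes "incseq x" "range x \<subseteq> {a..b}" "0 \<le> a" "b \<le> T"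
  shows "(\<Sum>i<n. \<bar>F (x (Suc i)) - F (x i)\<bar>) \<le> G b - G a"
proof -
  have x: "a \<le> x i" "x i \<le> b" "x i \<le> x (Suc i)" for i
    using assms(1,2) by (auto simp: incseq_Suc_iff image_subset_iff)
  have "(\<Sum>i<n. \<bar>F (x (Suc i)) - F (x i)\<bar>) \<le> (\<Sum>i<n. G (x (Suc i)) - G (x i))"
    by (intro sum_mono dom) (use x assms order_trans in blast)+
  also have "\<dots> = G (x n) - G (x 0)"
    by (rule sum_lessThan_telescope)
  also have "\<dots> \<le> G b - G a"
    using G_mono[of "x n" b] G_mono[of a "x 0"] x(1)[of n] x(2)[of n] x(1)[of 0] x(2)[of 0] assms by auto
  finally show ?thesis .
qed

lemma bdd_above_variation_sums: "0 \<le> a \<Longrightarrow> b \<le> T \<Longrightarrow> bdd_above (variation_sums F a b)"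
  unfolding variation_sums_def using variation_sum_le by (fastforce intro!: bdd_aboveI[where M = "G b - G a"])

lemma variation_sums_nonempty: "a \<le> b \<Longrightarrow> variation_sums F a b \<noteq> {}"
  unfolding variation_sums_def
  by (auto intro!: exI[of _ "0::nat"] exI[of _ "\<lambda>_. a"] simp: incseq_def)

abbreviation TV :: "real \<Rightarrow> real" where
  "TV t \<equiv> total_variation F 0 t"

text \<open>Cutting a partition of \<open>[0, t]\<close> at \<open>a\<close> splits it into one of \<open>[0, a]\<close> and
  one of \<open>[a, t]\<close>; the latter contributes at most the increment of \<open>G\<close>.\<close>

lemma TV_upper:
  assumes "0 \<le> a" "a \<le> t" "t \<le> T"
  shows "TV t \<le> TV a + (G t - G a)"
  unfolding total_variation_def[of F 0 t]
proof (rule cSup_least[OF variation_sums_nonempty])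
  fix v assume "v \<in> variation_sums F 0 t"
  then obtain n x where v: "v = (\<Sum>i<n. \<bar>F (x (Suc i)) - F (x i)\<bar>)" and x: "incseq x" "range x \<subseteq> {0..t}"
    by (auto simp: variation_sums_def)
  have xi: "0 \<le> x i" "x i \<le> t" "x i \<le> x (Suc i)" for i
    using x by (auto simp: incseq_Suc_iff image_subset_iff)
  define y where "y i = min (x i) a" for i
  define z where "z i = max (x i) a" for i
  have yz: "incseq y" "range y \<subseteq> {0..a}" "incseq z" "range z \<subseteq> {a..t}"
    using xi assms unfolding y_def z_def incseq_Suc_iff
    by (auto intro!: min.mono max.mono simp: min_le_iff_disj le_max_iff_disj) (meson xi(3) linear order_trans)
  have "\<bar>F (x (Suc i)) - F (x i)\<bar> \<le> \<bar>F (y (Suc i)) - F (y i)\<bar> + \<bar>F (z (Suc i)) - F (z i)\<bar>" for i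
    using xi[of i] by (auto simp: y_def z_def min_def max_def)
  then have "v \<le> (\<Sum>i<n. \<bar>F (y (Suc i)) - F (y i)\<bar>) + (\<Sum>i<n. \<bar>F (z (Suc i)) - F (z i)\<bar>)"
    unfolding v sum.distrib[symmetric] by (rule sum_mono)
  moreover have "(\<Sum>i<n. \<bar>F (y (Suc i)) - F (y i)\<bar>) \<le> TV a"
    unfolding total_variation_def
    by (rule cSup_upper[OF _ bdd_above_variation_sums]) (use yz assms in \<open>auto simp: variation_sums_def\<close>)
  moreover have "(\<Sum>i<n. \<bar>F (z (Suc i)) - F (z i)\<bar>) \<le> G t - G a"
    by (rule variation_sum_le) (use yz assms in auto)
  ultimately show "v \<le> TV a + (G t - G a)" by linarith
qed (use assms in auto)

text \<open>A partition of \<open>[0, a]\<close> is extended by the points \<open>a\<close> and \<open>t\<close>.\<close>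

lemma TV_lower:
  assumes "0 \<le> a" "a \<le> t" "t \<le> T"
  shows "TV a + \<bar>F t - F a\<bar> \<le> TV t"
proof -
  have "TV a \<le> TV t - \<bar>F t - F a\<bar>"
    unfolding total_variation_def[of F 0 a]
  proof (rule cSup_least[OF variation_sums_nonempty])
    fix v assume "v \<in> variation_sums F 0 a"
    then obtain n x where v: "v = (\<Sum>i<n. \<bar>F (x (Suc i)) - F (x i)\<bar>)" and x: "incseq x" "range x \<subseteq> {0..a}"
      by (auto simp: variation_sums_def)
    define y where "y i = (if i \<le> n then x i else if i = Suc n then a else t)" for i
    have xi: "0 \<le> x i" "x i \<le> a" "x i \<le> x (Suc i)" for i
      using x by (auto simp: incseq_Suc_iff image_subset_iff)
    have y: "incseq y" "range y \<subseteq> {0..t}"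
    proof -
      show "incseq y" unfolding incseq_Suc_iff
      proof
        fix i
        consider "Suc i \<le> n" | "i = n" | "i = Suc n" | "Suc n < i" by linarith
        then show "y i \<le> y (Suc i)" using xi[of i] assms by cases (auto simp: y_def)
      qed
      show "range y \<subseteq> {0..t}"
        using xi assms order_trans[OF xi(2) assms(2)] by (auto simp: y_def)
    qed
    have "(\<Sum>i<n. \<bar>F (y (Suc i)) - F (y i)\<bar>) = v"
      unfolding v by (rule sum.cong) (auto simp: y_def)
    then have "v + \<bar>F t - F a\<bar> \<le> (\<Sum>i<Suc (Suc n). \<bar>F (y (Suc i)) - F (y i)\<bar>)"
      by (simp add: y_def)
    also have "\<dots> \<le> TV t"
      unfolding total_variation_def
    proof (rule cSup_upper[OF _ bdd_above_variation_sums])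
      show "(\<Sum>i<Suc (Suc n). \<bar>F (y (Suc i)) - F (y i)\<bar>) \<in> variation_sums F 0 t"
        unfolding variation_sums_def using y by blast
    qed (use assms in auto)
    finally show "v \<le> TV t - \<bar>F t - F a\<bar>" by simp
  qed (use assms in auto)
  then show ?thesis by simp
qed

definition clamp :: "real \<Rightarrow> real \<Rightarrow> real" where
  "clamp t s = max 0 (min t s)"

text \<open>With \<open>c = 1\<close> and \<open>c = - 1\<close> these are the distribution functions of the two parts of
  the Jordan decomposition, so that both are treated at once.\<close>

definition half_var :: "real \<Rightarrow> real \<Rightarrow> real" where
  "half_var c r = (TV r + c * F r) / 2"

lemma pos_variation_measure_eq:
  "pos_variation_measure F t = interval_measure (\<lambda>s. half_var 1 (clamp t s))"
  by (simp add: pos_variation_measure_def half_var_def clamp_def Let_def)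

lemma neg_variation_measure_eq:
  "neg_variation_measure F t = interval_measure (\<lambda>s. half_var (- 1) (clamp t s))"
  by (simp add: neg_variation_measure_def half_var_def clamp_def Let_def)

context
  fixes c :: real
  assumes c: "\<bar>c\<bar> = 1"
begin

lemma half_var_mono:
  assumes "0 \<le> a" "a \<le> t" "t \<le> T" shows "half_var c a \<le> half_var c t"
proof -
  have "\<bar>c * (F t - F a)\<bar> = \<bar>F t - F a\<bar>" using c by (simp add: abs_mult)
  then show ?thesis
    using TV_lower[OF assms] by (simp add: half_var_def right_diff_distrib)
qed

lemma half_var_dom:
  assumes "0 \<le> a" "a \<le> t" "t \<le> T" shows "\<bar>half_var c t - half_var c a\<bar> \<le> G t - G a"
proof -
  have "\<bar>c * (F t - F a)\<bar> = \<bar>F t - F a\<bar>" using c by (simp add: abs_mult)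
  moreover have "half_var c t - half_var c a = (TV t - TV a) / 2 + c * (F t - F a) / 2"
    by (simp add: half_var_def field_simps)
  ultimately show ?thesis
    using TV_lower[OF assms] TV_upper[OF assms] by argo
qed

lemma clamped_mono: "0 \<le> t \<Longrightarrow> t \<le> T \<Longrightarrow> x \<le> y \<Longrightarrow> half_var c (clamp t x) \<le> half_var c (clamp t y)"
  by (rule half_var_mono) (auto simp: clamp_def)

lemma clamped_cont:
  assumes "0 \<le> t" "t \<le> T" shows "continuous_on UNIV (\<lambda>s. half_var c (clamp t s))"
proof (rule continuous_on_compose2[of "{0..T}" "half_var c" UNIV "clamp t"])
  show "continuous_on {0..T} (half_var c)" by (rule continuous_of_increments[OF half_var_dom])
  show "continuous_on UNIV (clamp t)" unfolding clamp_def by (intro continuous_intros)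
qed (use assms in \<open>auto simp: clamp_def\<close>)

lemma clamped_right_cont:
  assumes "0 \<le> t" "t \<le> T" shows "continuous (at_right a) (\<lambda>s. half_var c (clamp t s))"
  using clamped_cont[OF assms] by (auto simp: continuous_on_eq_continuous_at intro: continuous_at_imp_continuous_at_within)

abbreviation "\<mu> t \<equiv> interval_measure (\<lambda>s. half_var c (clamp t s))"

lemma emeasure_\<mu>:
  assumes "0 \<le> t" "t \<le> T" "a \<le> b"
  shows "emeasure (\<mu> t) {a<..b} = ennreal (half_var c (clamp t b) - half_var c (clamp t a))"
  using emeasure_interval_measure_Ioc[OF assms(3) clamped_mono[OF assms(1,2)] clamped_right_cont[OF assms(1,2)]] .

lemma emeasure_\<mu>_point:
  assumes "0 \<le> t" "t \<le> T" shows "emeasure (\<mu> t) {a} = 0"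
  using emeasure_interval_measure_Icc[OF order_refl clamped_mono[OF assms] clamped_cont[OF assms], of a] by simp

text \<open>The integral up to \<open>t\<close> is defined with a measure that depends on \<open>t\<close>. On
  \<open>(0, t]\<close> this measure agrees with the one for \<open>T\<close>, since the distribution functions
  agree there; hence all integrals may be taken with respect to the latter.\<close>

lemma restricted_\<mu>_eq:
  assumes "0 \<le> t" "t \<le> T"
  shows "density (\<mu> t) (indicator {0<..t}) = density (\<mu> T) (indicator {0<..t})"
proof (rule cdf_unique')
  have E: "emeasure (density (\<mu> r) (indicator {0<..t})) {..x} = ennreal (half_var c (clamp t x) - half_var c 0)"
    if "t \<le> r" "r \<le> T" for x r
  proof -
    have "emeasure (density (\<mu> r) (indicator {0<..t})) {..x} = emeasure (\<mu> r) ({0<..t} \<inter> {..x})"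
      by (subst emeasure_density) (auto simp: nn_integral_indicator[symmetric] indicator_inter_arith[symmetric]
          simp del: nn_integral_indicator)
    also have "{0<..t} \<inter> {..x} = {0<..clamp t x}" by (auto simp: clamp_def)
    also have "emeasure (\<mu> r) \<dots> = ennreal (half_var c (clamp t x) - half_var c 0)"
      using that assms by (subst emeasure_\<mu>) (auto simp: clamp_def max_def min_def)
    finally show ?thesis .
  qed
  have fin: "finite_borel_measure (density (\<mu> r) (indicator {0<..t}))" if "t \<le> r" "r \<le> T" for r
  proof (intro finite_borel_measure.intro finite_measureI finite_borel_measure_axioms.intro)
    have "emeasure (density (\<mu> r) (indicator {0<..t})) UNIV = emeasure (\<mu> r) {0<..t}"
      by (subst emeasure_density) auto
    also have "\<dots> = ennreal (half_var c (clamp r t) - half_var c (clamp r 0))"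
      using that assms by (intro emeasure_\<mu>) auto
    finally show "emeasure (density (\<mu> r) (indicator {0<..t})) (space (density (\<mu> r) (indicator {0<..t}))) \<noteq> \<infinity>"
      by simp
  qed simp
  show "finite_borel_measure (density (\<mu> t) (indicator {0<..t}))"
    "finite_borel_measure (density (\<mu> T) (indicator {0<..t}))"
    using fin assms by auto
  show "cdf (density (\<mu> t) (indicator {0<..t})) = cdf (density (\<mu> T) (indicator {0<..t}))"
    using E assms by (auto simp: cdf_def fun_eq_iff measure_def)
qed

lemma set_integral_\<mu>_eq:
  assumes "0 \<le> t" "t \<le> T" and k: "(\<lambda>s. indicator {0<..T} s * k s :: real) \<in> borel_measurable borel"
  shows "(LINT s:{0<..t}|\<mu> t. k s) = (LINT s:{0<..t}|\<mu> T. k s)"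
proof -
  let ?k = "\<lambda>s. indicator {0<..T} s * k s"
  have "(LINT s:{0<..t}|\<mu> r. k s) = (LINT s|density (\<mu> r) (indicator {0<..t}). ?k s)" for r
  proof -
    have "(LINT s|density (\<mu> r) (indicator {0<..t}). ?k s) = (LINT s|density (\<mu> r) (\<lambda>s. ennreal (indicator {0<..t} s)). ?k s)"
      by (simp add: ennreal_indicator)
    also have "\<dots> = (LINT s|\<mu> r. indicator {0<..t} s *\<^sub>R ?k s)"
      using k by (intro integral_density) auto
    also have "\<dots> = (LINT s|\<mu> r. indicator {0<..t} s *\<^sub>R k s)"
      by (rule Bochner_Integration.integral_cong) (use assms in \<open>auto simp: indicator_def\<close>)
    finally show ?thesis by (simp add: set_lebesgue_integral_def)
  qed
  then show ?thesis using restricted_\<mu>_eq[OF assms(1,2)] by simp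
qed

lemma set_integrable_\<mu>:
  assumes k: "(\<lambda>s. indicator {0<..T} s * k s :: real) \<in> borel_measurable borel"
    and bd: "\<And>s. s \<in> {0<..T} \<Longrightarrow> \<bar>k s\<bar> \<le> L"
  shows "set_integrable (\<mu> T) {0<..T} k"
  unfolding set_integrable_def
proof (rule Bochner_Integration.integrable_bound)
  have "emeasure (\<mu> T) {0<..T} < \<infinity>" using T_pos by (subst emeasure_\<mu>) auto
  then show "integrable (\<mu> T) (\<lambda>s. indicator {0<..T} s * L)"
    by (intro integrable_mult_left integrable_real_indicator) auto
  show "(\<lambda>s. indicator {0<..T} s *\<^sub>R k s) \<in> borel_measurable (\<mu> T)" using k by simp
  show "AE s in \<mu> T. norm (indicator {0<..T} s *\<^sub>R k s) \<le> norm (indicator {0<..T} s * L)"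
    using bd by (intro AE_I2) (force simp: indicator_def)
qed

lemma set_integral_\<mu>_diff:
  assumes k: "(\<lambda>s. indicator {0<..T} s * k s :: real) \<in> borel_measurable borel"
    and bd: "\<And>s. s \<in> {0<..T} \<Longrightarrow> \<bar>k s\<bar> \<le> L"
    and at: "0 \<le> a" "a \<le> t" "t \<le> T"
  shows "(LINT s:{0<..t}|\<mu> T. k s) - (LINT s:{0<..a}|\<mu> T. k s) = (LINT s:{a<..t}|\<mu> T. k s)"
proof -
  have i: "set_integrable (\<mu> T) {0<..a} k" "set_integrable (\<mu> T) {a<..t} k"
    by (rule set_integrable_subset[OF set_integrable_\<mu>[OF k bd]]; use at in auto)+
  have "{0<..t} = {0<..a} \<union> {a<..t}" using at by auto
  then show ?thesis using set_integral_Un[OF _ i] by auto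
qed

lemma set_integral_\<mu>_approx:
  assumes k: "(\<lambda>s. indicator {0<..T} s * k s :: real) \<in> borel_measurable borel"
    and bd: "\<And>s. s \<in> {0<..T} \<Longrightarrow> \<bar>k s\<bar> \<le> L"
    and at: "0 \<le> a" "a \<le> t" "t \<le> T"
    and near: "\<And>s. a < s \<Longrightarrow> s < t \<Longrightarrow> \<bar>k s - l\<bar> \<le> \<kappa>" and "0 \<le> \<kappa>"
  shows "\<bar>(LINT s:{a<..t}|\<mu> T. k s) - l * (half_var c t - half_var c a)\<bar> \<le> \<kappa> * (half_var c t - half_var c a)"
proof -
  have m: "emeasure (\<mu> T) {a<..t} = ennreal (half_var c t - half_var c a)"
    using at by (subst emeasure_\<mu>) (auto simp: clamp_def)
  have ge: "0 \<le> half_var c t - half_var c a" using half_var_mono[OF at] by simp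
  then have meas: "measure (\<mu> T) {a<..t} = half_var c t - half_var c a"
    using m by (simp add: measure_def)
  have const: "set_integrable (\<mu> T) {a<..t} (\<lambda>_. r)" "(LINT s:{a<..t}|\<mu> T. r) = r * (half_var c t - half_var c a)" for r :: real
    using m meas by (auto simp: set_integrable_def set_lebesgue_integral_def mult.commute
      intro!: integrable_mult_left)
  have i: "set_integrable (\<mu> T) {a<..t} k"
    by (rule set_integrable_subset[OF set_integrable_\<mu>[OF k bd]]) (use at in auto)
  note id = set_integral_diff[OF i const(1)[of l]]
  have "\<bar>LINT s:{a<..t}|\<mu> T. k s - l\<bar> \<le> (LINT s:{a<..t}|\<mu> T. \<kappa>)"
  proof -
    have "norm (LINT s|\<mu> T. indicator {a<..t} s *\<^sub>R (k s - l)) \<le> (LINT s|\<mu> T. norm (indicator {a<..t} s *\<^sub>R (k s - l)))"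
      by (rule integral_norm_bound)
    also have "\<dots> \<le> (LINT s|\<mu> T. indicator {a<..t} s *\<^sub>R \<kappa>)"
    proof (rule integral_mono_AE)
      show "integrable (\<mu> T) (\<lambda>s. norm (indicator {a<..t} s *\<^sub>R (k s - l)))"
        using id(1) unfolding set_integrable_def by (rule integrable_norm)
      show "integrable (\<mu> T) (\<lambda>s. indicator {a<..t} s *\<^sub>R \<kappa>)"
        using const(1) unfolding set_integrable_def .
      have "AE s in \<mu> T. s \<noteq> t"
        using emeasure_\<mu>_point[of T t] T_pos by (intro AE_I[where N = "{t}"]) auto
      then show "AE s in \<mu> T. norm (indicator {a<..t} s *\<^sub>R (k s - l)) \<le> indicator {a<..t} s *\<^sub>R \<kappa>"
        by eventually_elim (use near in \<open>auto simp: indicator_def\<close>)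
    qed
    finally show ?thesis by (simp add: set_lebesgue_integral_def)
  qed
  then show ?thesis unfolding id(2) const(2) .
qed

end

lemma stieltjes_integrable:
  assumes k: "(\<lambda>s. indicator {0<..T} s * k s :: real) \<in> borel_measurable borel"
    and bd: "\<And>s. s \<in> {0<..T} \<Longrightarrow> \<bar>k s\<bar> \<le> L"
  shows "stieltjes_integrable F T k"
  unfolding stieltjes_integrable_def pos_variation_measure_eq neg_variation_measure_eq
  using continuous_F bdd_above_variation_sums set_integrable_\<mu>[OF _ k bd] by auto

lemma stieltjes_integral_start: "stieltjes_integral F 0 k = 0"
  by (simp add: stieltjes_integral_def set_lebesgue_integral_def)

text \<open>The integrand is controlled on the open interval only, since the path in it may have a large jump at
  \<open>t\<close>. The end point does not contribute, because the measures have no atoms.\<close>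

lemma stieltjes_integral_approx:
  assumes k: "(\<lambda>s. indicator {0<..T} s * k s :: real) \<in> borel_measurable borel"
    and bd: "\<And>s. s \<in> {0<..T} \<Longrightarrow> \<bar>k s\<bar> \<le> L"
    and at: "0 \<le> a" "a \<le> t" "t \<le> T"
    and near: "\<And>s. a < s \<Longrightarrow> s < t \<Longrightarrow> \<bar>k s - l\<bar> \<le> \<kappa>" and "0 \<le> \<kappa>"
  shows "\<bar>stieltjes_integral F t k - stieltjes_integral F a k - l * (F t - F a)\<bar> \<le> \<kappa> * (G t - G a)"
proof -
  have T: "0 \<le> t" "a \<le> T" using at by auto
  have 1: "\<bar>1\<bar> = (1::real)" "\<bar>- 1\<bar> = (1::real)" by auto
  let ?I = "\<lambda>c. LINT s:{a<..t}|interval_measure (\<lambda>s. half_var c (clamp T s)). k s"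
  have eq: "stieltjes_integral F t k - stieltjes_integral F a k = ?I 1 - ?I (- 1)"
    unfolding stieltjes_integral_def pos_variation_measure_eq neg_variation_measure_eq
      set_integral_\<mu>_eq[OF 1(1) T(1) at(3) k] set_integral_\<mu>_eq[OF 1(2) T(1) at(3) k]
      set_integral_\<mu>_eq[OF 1(1) at(1) T(2) k] set_integral_\<mu>_eq[OF 1(2) at(1) T(2) k]
    using set_integral_\<mu>_diff[OF 1(1) k bd at] set_integral_\<mu>_diff[OF 1(2) k bd at]
    by simp
  have "\<bar>?I 1 - l * (half_var 1 t - half_var 1 a)\<bar> \<le> \<kappa> * (half_var 1 t - half_var 1 a)"
    "\<bar>?I (- 1) - l * (half_var (- 1) t - half_var (- 1) a)\<bar> \<le> \<kappa> * (half_var (- 1) t - half_var (- 1) a)"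
    using set_integral_\<mu>_approx[OF 1(1) k bd at near \<open>0 \<le> \<kappa>\<close>] set_integral_\<mu>_approx[OF 1(2) k bd at near \<open>0 \<le> \<kappa>\<close>]
    by auto
  moreover have "half_var 1 t - half_var 1 a - (half_var (- 1) t - half_var (- 1) a) = F t - F a"
    "half_var 1 t - half_var 1 a + (half_var (- 1) t - half_var (- 1) a) = TV t - TV a"
    by (simp_all add: half_var_def field_simps)
  then have "l * (F t - F a) = l * (half_var 1 t - half_var 1 a) - l * (half_var (- 1) t - half_var (- 1) a)"
    "\<kappa> * (TV t - TV a) = \<kappa> * (half_var 1 t - half_var 1 a) + \<kappa> * (half_var (- 1) t - half_var (- 1) a)"
    by (metis right_diff_distrib distrib_left)+
  moreover have "\<kappa> * (TV t - TV a) \<le> \<kappa> * (G t - G a)"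
    using TV_upper[OF at] \<open>0 \<le> \<kappa>\<close> by (intro mult_left_mono) auto
  ultimately show ?thesis unfolding eq by linarith
qed

end

section \<open>Uniform convergence along one path\<close>

lemma infsum_approx:
  fixes u v p :: "real \<Rightarrow> real"
  assumes u: "u summable_on S" and v: "v summable_on S" and p: "p summable_on S"
    and le: "\<And>s. s \<in> S \<Longrightarrow> \<bar>u s - c * v s\<bar> \<le> \<kappa> * p s"
  shows "\<bar>infsum u S - c * infsum v S\<bar> \<le> \<kappa> * infsum p S"
proof -
  have d: "((\<lambda>s. u s + (- c) * v s) has_sum infsum u S + (- c) * infsum v S) S"
    by (intro has_sum_add has_sum_cmult_right has_sum_infsum u v)
  have b: "((\<lambda>s. \<kappa> * p s) has_sum \<kappa> * infsum p S) S"
    by (intro has_sum_cmult_right has_sum_infsum p)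
  have b': "((\<lambda>s. (- \<kappa>) * p s) has_sum (- \<kappa>) * infsum p S) S"
    by (intro has_sum_cmult_right has_sum_infsum p)
  have "infsum u S + (- c) * infsum v S \<le> \<kappa> * infsum p S"
    by (rule has_sum_mono[OF d b]) (use le in \<open>fastforce simp: abs_le_iff\<close>)
  moreover have "(- \<kappa>) * infsum p S \<le> infsum u S + (- c) * infsum v S"
    by (rule has_sum_mono[OF b' d]) (use le in \<open>fastforce simp: abs_le_iff\<close>)
  ultimately show ?thesis by (simp add: abs_le_iff)
qed

lemma abs_four_terms_le: "\<bar>p + q + r - s\<bar> \<le> \<bar>p\<bar> + \<bar>q\<bar> + \<bar>r\<bar> + \<bar>s\<bar>" for p q r s :: real
  by linarith

text \<open>The limit theorem depends on \<open>\<phi>\<close> and \<open>\<psi>\<close> only through the two image paths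
  \<open>Y\<close>, \<open>Z\<close> and the integrand \<open>k\<close>, so it is stated for such triples.\<close>

locale transformed_paths = covariation_paths +
  fixes Y Z k :: "real \<Rightarrow> real" and L :: real
  assumes Y: "cadlag_on T Y" and Z: "cadlag_on T Z"
    and integrand_borel: "(\<lambda>s. indicator {0<..T} s * k s) \<in> borel_measurable borel"
    and integrand_bound: "\<And>s. s \<in> {0<..T} \<Longrightarrow> \<bar>k s\<bar> \<le> L"
    and jump_bound: "\<And>s. s \<in> {0<..T} \<Longrightarrow> \<bar>jump Y s * jump Z s\<bar> \<le> L * ((jump f s)\<^sup>2 + (jump g s)\<^sup>2)"
begin

sublocale Dom: dominated_function T cont_cov cont_dom
  by unfold_locales (use T_pos cont_cov_le_dom continuous_cont_dom in auto)

text \<open>On \<open>[a, b)\<close> the pair \<open>(Y, Z)\<close> behaves like \<open>(f, g)\<close>, with products of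
  increments and of jumps multiplied by \<open>c\<close>. The point \<open>b\<close> is excluded because a large
  jump may occur there.\<close>

definition proportional_on :: "real \<Rightarrow> real \<Rightarrow> real \<Rightarrow> real \<Rightarrow> bool" where
  "proportional_on a b c \<kappa> \<longleftrightarrow>
     (\<forall>s s'. a \<le> s \<and> s < b \<and> a \<le> s' \<and> s' < b \<longrightarrow>
        \<bar>(Y s' - Y s) * (Z s' - Z s) - c * ((f s' - f s) * (g s' - g s))\<bar>
          \<le> \<kappa> * ((f s' - f s) * (f s' - f s) + (g s' - g s) * (g s' - g s))) \<and>
     (\<forall>s. a < s \<and> s < b \<longrightarrow>
        \<bar>jump Y s * jump Z s - c * (jump f s * jump g s)\<bar> \<le> \<kappa> * ((jump f s)\<^sup>2 + (jump g s)\<^sup>2)) \<and>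
     (\<forall>s. a < s \<and> s < b \<longrightarrow> \<bar>k s - c\<bar> \<le> \<kappa>)"

abbreviation jump_YZ :: "real \<Rightarrow> real" where
  "jump_YZ s \<equiv> jump Y s * jump Z s"

abbreviation jump_sq :: "real \<Rightarrow> real" where
  "jump_sq s \<equiv> (jump f s)\<^sup>2 + (jump g s)\<^sup>2"

definition limit_path :: "real \<Rightarrow> real" where
  "limit_path t = stieltjes_integral cont_cov t k + infsum jump_YZ {0<..t}"

text \<open>The correction at a possibly large jump at the right end \<open>b\<close>, where proportionality
  fails.\<close>

definition end_jump :: "real \<Rightarrow> real \<Rightarrow> real \<Rightarrow> real" where
  "end_jump b c t = (if t = b then jump_YZ b - c * jump_fg b else 0)"

lemma summable_jump_sq: "jump_sq summable_on {0<..T}"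
  by (intro summable_on_add Q1.summable_jumps Q2.summable_jumps)

lemma summable_jump_YZ: "jump_YZ summable_on {0<..T}"
proof -
  have "(\<lambda>s. norm (jump_YZ s)) summable_on {0<..T}"
  proof (rule summable_on_comparison_test[OF summable_on_cmult_right[OF summable_jump_sq, of L]])
    show "norm (jump_YZ s) \<le> L * jump_sq s" if "s \<in> {0<..T}" for s
      using jump_bound[OF that] by simp
  qed simp
  then show ?thesis by (rule abs_summable_summable)
qed

lemma stieltjes_integrable_integrand: "stieltjes_integrable cont_cov T k"
  by (rule Dom.stieltjes_integrable[OF integrand_borel integrand_bound])

lemma limit_path_start: "limit_path 0 = 0"
  by (simp add: limit_path_def Dom.stieltjes_integral_start)

text \<open>The Stieltjes part is compared on the open interval \<open>(a, t)\<close>, where \<open>k\<close> is near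
  \<open>c\<close>; the jumps are compared one by one, except the one at \<open>b\<close>, which is
  \<open>end_jump\<close>.\<close>

lemma limit_path_approx:
  assumes ab: "0 \<le> a" "a < b" "b \<le> T" and pr: "proportional_on a b c \<kappa>" and "0 \<le> \<kappa>"
    and t: "a \<le> t" "t \<le> b"
  shows "\<bar>limit_path t - limit_path a - c * (A12 t - A12 a) - end_jump b c t\<bar>
     \<le> \<kappa> * (A11 t - A11 a + (A22 t - A22 a))"
proof -
  have at: "0 \<le> a" "a \<le> t" "t \<le> T" using ab t by auto
  define S where "S = (if t = b then {a<..<b} else {a<..t})"
  have S: "S \<subseteq> {a<..t}" "S \<subseteq> {0<..T}" "S \<subseteq> {a<..<b}"
    using ab t by (auto simp: S_def)
  have sum_split: "infsum h {a<..t} = infsum h S + (if t = b then h b else 0)"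
    if "h summable_on {0<..T}" for h :: "real \<Rightarrow> real"
  proof (cases "t = b")
    case True
    have "h summable_on S" by (rule summable_on_subset_banach[OF that S(2)])
    then have "infsum h (S \<union> {b}) = infsum h S + infsum h {b}"
      by (intro infsum_Un_disjoint) (use True in \<open>auto simp: S_def\<close>)
    moreover have "S \<union> {b} = {a<..t}" using True ab by (auto simp: S_def)
    ultimately show ?thesis using True by simp
  qed (simp add: S_def)
  have "\<bar>infsum jump_YZ S - c * infsum jump_fg S\<bar> \<le> \<kappa> * infsum jump_sq S"
    by (rule infsum_approx)
      (use pr S(3) in \<open>auto simp: proportional_on_def
         intro!: summable_on_subset_banach[OF _ S(2)] summable_jump_YZ summable_jump_fg summable_jump_sq\<close>)
  also have "\<kappa> * infsum jump_sq S \<le> \<kappa> * infsum jump_sq {a<..t}"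
    using sum_split[OF summable_jump_sq] \<open>0 \<le> \<kappa>\<close> by (intro mult_left_mono) auto
  finally have jumps: "\<bar>infsum jump_YZ {a<..t} - c * infsum jump_fg {a<..t} - end_jump b c t\<bar> \<le> \<kappa> * infsum jump_sq {a<..t}"
    unfolding sum_split[OF summable_jump_YZ] sum_split[OF summable_jump_fg]
    by (cases "t = b") (simp_all add: end_jump_def algebra_simps)
  have "\<bar>stieltjes_integral cont_cov t k - stieltjes_integral cont_cov a k - c * (cont_cov t - cont_cov a)\<bar>
      \<le> \<kappa> * (cont_dom t - cont_dom a)"
    by (rule Dom.stieltjes_integral_approx[OF integrand_borel integrand_bound at])
      (use pr t \<open>0 \<le> \<kappa>\<close> in \<open>auto simp: proportional_on_def\<close>)
  also have "\<dots> \<le> \<kappa> * ((Q1.cont_part t - Q1.cont_part a) + (Q2.cont_part t - Q2.cont_part a))"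
    using Q1.cont_part_mono[OF at] Q2.cont_part_mono[OF at] \<open>0 \<le> \<kappa>\<close>
    unfolding cont_dom_def by (intro mult_left_mono) (auto simp: field_simps)
  finally have cont: "\<bar>stieltjes_integral cont_cov t k - stieltjes_integral cont_cov a k - c * (cont_cov t - cont_cov a)\<bar>
      \<le> \<kappa> * ((Q1.cont_part t - Q1.cont_part a) + (Q2.cont_part t - Q2.cont_part a))" .
  have B: "limit_path t - limit_path a
     = (stieltjes_integral cont_cov t k - stieltjes_integral cont_cov a k) + infsum jump_YZ {a<..t}"
    using infsum_Ioc_diff[OF summable_jump_YZ at] by (simp add: limit_path_def)
  have A: "A12 t - A12 a = (cont_cov t - cont_cov a) + infsum jump_fg {a<..t}"
    using infsum_Ioc_diff[OF summable_jump_fg at] by (simp add: cont_cov_def)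
  have "infsum jump_sq {a<..t} = infsum (\<lambda>s. (jump f s)\<^sup>2) {a<..t} + infsum (\<lambda>s. (jump g s)\<^sup>2) {a<..t}"
    by (intro infsum_add Q1.summable_jumps_Ioc Q2.summable_jumps_Ioc at)
  then have "A11 t - A11 a + (A22 t - A22 a)
    = (Q1.cont_part t - Q1.cont_part a) + (Q2.cont_part t - Q2.cont_part a) + infsum jump_sq {a<..t}"
    using Q1.cont_part_diff[OF at] Q2.cont_part_diff[OF at] by simp
  then have V: "\<kappa> * (A11 t - A11 a + (A22 t - A22 a))
    = \<kappa> * ((Q1.cont_part t - Q1.cont_part a) + (Q2.cont_part t - Q2.cont_part a)) + \<kappa> * infsum jump_sq {a<..t}"
    by (simp only: distrib_left)
  have c: "c * (A12 t - A12 a) = c * (cont_cov t - cont_cov a) + c * infsum jump_fg {a<..t}"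
    unfolding A by (simp only: distrib_left)
  show ?thesis unfolding B c V using jumps cont by linarith
qed

text \<open>As long as both ends of an increment lie in \<open>[a, b)\<close>, proportionality applies to the
  integrand. The increments that reach \<open>b\<close> start in \<open>[b - e, b)\<close>, where their product
  is close to the product of the jumps at \<open>b\<close>; averaged over an interval of length
  \<open>e\<close> they contribute \<open>end_jump\<close>.\<close>

lemma incr_avg_approx:
  assumes ab: "0 \<le> a" "a < b" "b \<le> T" and pr: "proportional_on a b c \<kappa>" and "0 \<le> \<kappa>" "0 < w"
  obtains d where "0 < d" "\<And>e t. 0 < e \<Longrightarrow> e < d \<Longrightarrow> a \<le> t \<Longrightarrow> t \<le> b \<Longrightarrow>
    \<bar>incr_avg Y Z e a t - c * incr_avg f g e a t - end_jump b c t\<bar>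
      \<le> \<kappa> * (incr_avg f f e a t + incr_avg g g e a t) + w"
proof -
  have b0: "0 < b" using ab by auto
  define E where "E = jump_YZ b - c * jump_fg b"
  note ll = tendsto_left_lim[OF _ b0 ab(3)]
  have "((\<lambda>s. (Y b - Y s) * (Z b - Z s) - c * ((f b - f s) * (g b - g s))) \<longlongrightarrow> E) (at_left b)"
    unfolding E_def jump_def by (intro tendsto_intros ll Y Z f g)
  then have "\<forall>\<^sub>F s in at_left b. \<bar>(Y b - Y s) * (Z b - Z s) - c * ((f b - f s) * (g b - g s)) - E\<bar> < w"
    using \<open>0 < w\<close> by (auto dest!: tendstoD simp: dist_real_def)
  then obtain d0 where d0: "d0 < b"
    "\<And>s. d0 < s \<Longrightarrow> s < b \<Longrightarrow> \<bar>(Y b - Y s) * (Z b - Z s) - c * ((f b - f s) * (g b - g s)) - E\<bar> < w"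
    by (auto simp: eventually_at_left_field)
  show thesis
  proof (rule that[of "min (b - d0) (b - a)"])
    show "0 < min (b - d0) (b - a)" using d0 ab by auto
    fix e t assume e: "0 < e" "e < min (b - d0) (b - a)" and t: "a \<le> t" "t \<le> b"
    let ?E = "end_jump b c t"
    let ?q = "\<lambda>u v s. incr_prod u v e t s"
    have tT: "t \<le> T" using t ab by auto
    have i: "set_integrable lborel {a..t} (?q Y Z)" "set_integrable lborel {a..t} (?q f g)"
      "set_integrable lborel {a..t} (?q f f)" "set_integrable lborel {a..t} (?q g g)"
      by (intro incr_prod_integrable[OF _ _ T_pos e(1) ab(1) tT] Y Z f g)+
    note ic = set_integrable_mult_right[OF i(2), of c]
    have h: "\<bar>?q Y Z s - c * ?q f g s - ?E * indicator {b - e..b} s\<bar>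
       \<le> \<kappa> * (?q f f s + ?q g g s) + (w * indicator {b - e..b} s + \<bar>E\<bar> * indicator {b..b} s)"
      if s: "s \<in> {a..t}" for s
    proof -
      define m where "m = min (s + e) t"
      have q: "?q u v s = (u m - u s) * (v m - v s)" for u v by (simp add: incr_prod_def m_def)
      consider "m < b" | "m = b" "s < b" | "s = b" using t s e by (fastforce simp: m_def min_def split: if_splits)
      then show ?thesis
      proof cases
        case 1
        have sm: "a \<le> s" "s < b" "a \<le> m" using 1 s e by (auto simp: m_def)
        have "?E * indicator {b - e..b} s = 0"
          using 1 s e by (auto simp: end_jump_def indicator_def m_def)
        moreover have "\<bar>?q Y Z s - c * ?q f g s\<bar> \<le> \<kappa> * (?q f f s + ?q g g s)"
          using pr sm 1 unfolding q proportional_on_def by blast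
        moreover have "0 \<le> w * indicator {b - e..b} s" "0 \<le> \<bar>E\<bar> * indicator {b..b} s"
          using \<open>0 < w\<close> by (auto simp: indicator_def)
        ultimately show ?thesis by linarith
      next
        case 2
        have t': "t = b" "b - e \<le> s" using 2 t s e by (auto simp: m_def min_def split: if_splits)
        have "\<bar>?q Y Z s - c * ?q f g s - E\<bar> < w"
          unfolding q 2(1) by (rule d0(2)) (use t' e 2 in auto)
        moreover have "0 \<le> \<kappa> * (?q f f s + ?q g g s)" unfolding q using \<open>0 \<le> \<kappa>\<close> by simp
        moreover have "0 \<le> \<bar>E\<bar> * indicator {b..b} s" by (simp add: indicator_def)
        moreover have "?E * indicator {b - e..b} s = E" "w * indicator {b - e..b} s = w"
          using 2 t' by (auto simp: end_jump_def E_def)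
        ultimately show ?thesis by linarith
      next
        \<comment> \<open>the start \<open>s = b\<close> yields a zero increment; the null set \<open>{b..b}\<close> in the bound accounts for it\<close>
        case 3
        have "t = b" "m = b" using 3 s t e by (auto simp: m_def)
        then show ?thesis using 3 \<open>0 < w\<close> e unfolding q by (simp add: end_jump_def E_def)
      qed
    qed
    have I: "set_integrable lborel {a..t} (\<lambda>s. ?q Y Z s - c * ?q f g s - ?E * indicator {b - e..b} s)"
      by (intro set_integral_diff(1) i ic set_integrable_indicator_Icc)
    note iff = set_integral_add(1)[OF i(3,4)]
    note iI = set_integral_add(1)[OF set_integrable_indicator_Icc[of a t w "b - e" b] set_integrable_indicator_Icc[of a t "\<bar>E\<bar>" b b]]
    note iB = set_integrable_mult_right[OF iff, of \<kappa>]
    have "\<bar>LINT s:{a..t}|lborel. ?q Y Z s - c * ?q f g s - ?E * indicator {b - e..b} s\<bar>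
       \<le> (LINT s:{a..t}|lborel. \<kappa> * (?q f f s + ?q g g s) + (w * indicator {b - e..b} s + \<bar>E\<bar> * indicator {b..b} s))"
      by (rule abs_set_integral_le[OF I set_integral_add(1)[OF iB iI] h])
    also have "\<dots> = \<kappa> * ((LINT s:{a..t}|lborel. ?q f f s) + (LINT s:{a..t}|lborel. ?q g g s))
       + ((LINT s:{a..t}|lborel. w * indicator {b - e..b} s) + (LINT s:{a..t}|lborel. \<bar>E\<bar> * indicator {b..b} s))"
      using set_integral_add(2)[OF iB iI] set_integral_add(2)[OF i(3,4)]
        set_integral_add(2)[OF set_integrable_indicator_Icc[of a t w "b - e" b] set_integrable_indicator_Icc[of a t "\<bar>E\<bar>" b b]]
      by simp
    also have "\<dots> \<le> \<kappa> * ((LINT s:{a..t}|lborel. ?q f f s) + (LINT s:{a..t}|lborel. ?q g g s)) + w * e"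
    proof -
      have "(LINT s:{a..t}|lborel. w * indicator {b - e..b} s) \<le> w * (b - (b - e))"
        "(LINT s:{a..t}|lborel. \<bar>E\<bar> * indicator {b..b} s) \<le> \<bar>E\<bar> * (b - b)"
        by (rule set_integral_indicator_Icc_le; use e \<open>0 < w\<close> in simp)+
      moreover have "w * (b - (b - e)) = w * e" "\<bar>E\<bar> * (b - b) = 0" by auto
      ultimately show ?thesis by linarith
    qed
    finally have 1: "\<bar>LINT s:{a..t}|lborel. ?q Y Z s - c * ?q f g s - ?E * indicator {b - e..b} s\<bar>
       \<le> \<kappa> * ((LINT s:{a..t}|lborel. ?q f f s) + (LINT s:{a..t}|lborel. ?q g g s)) + w * e" .
    have 2: "(LINT s:{a..t}|lborel. ?E * indicator {b - e..b} s) = ?E * e"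
    proof (cases "t = b")
      case True
      then show ?thesis using set_integral_indicator_Icc[of "b - e" b a t ?E] e by simp
    qed (simp add: end_jump_def set_lebesgue_integral_def)
    have 3: "(LINT s:{a..t}|lborel. ?q Y Z s - c * ?q f g s - ?E * indicator {b - e..b} s)
       = (LINT s:{a..t}|lborel. ?q Y Z s) - c * (LINT s:{a..t}|lborel. ?q f g s) - ?E * e"
      using set_integral_diff(2)[OF set_integral_diff(1)[OF i(1) ic] set_integrable_indicator_Icc[of a t ?E "b - e" b]]
        set_integral_diff(2)[OF i(1) ic] 2 by simp
    have K: "(LINT s:{a..t}|lborel. ?q u v s) = e * incr_avg u v e a t" for u v
      using e by (simp add: incr_avg_def)
    have "e * \<bar>incr_avg Y Z e a t - c * incr_avg f g e a t - ?E\<bar>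
        = \<bar>e * incr_avg Y Z e a t - c * (e * incr_avg f g e a t) - ?E * e\<bar>"
    proof -
      have "e * incr_avg Y Z e a t - c * (e * incr_avg f g e a t) - ?E * e
        = e * (incr_avg Y Z e a t - c * incr_avg f g e a t - ?E)" by (simp add: algebra_simps)
      then show ?thesis using e by (simp add: abs_mult)
    qed
    also have "\<dots> \<le> \<kappa> * (e * incr_avg f f e a t + e * incr_avg g g e a t) + w * e"
      using 1 unfolding 3 K .
    also have "\<dots> = e * (\<kappa> * (incr_avg f f e a t + incr_avg g g e a t) + w)"
      by (simp add: algebra_simps)
    finally show "\<bar>incr_avg Y Z e a t - c * incr_avg f g e a t - ?E\<bar>
      \<le> \<kappa> * (incr_avg f f e a t + incr_avg g g e a t) + w"
      using e by simp
  qed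
qed

definition error :: "nat \<Rightarrow> real \<Rightarrow> real" where
  "error n t = incr_avg Y Z (\<epsilon> n) 0 t - limit_path t"

text \<open>The measure of progress against which the error is bounded. The summand \<open>t\<close> makes it strictly
  increasing, so that errors vanishing with \<open>\<epsilon> n\<close> can be absorbed on every interval.\<close>

definition clock :: "real \<Rightarrow> real" where
  "clock t = A11 t + A22 t + t"

text \<open>The bound is by the increment of the clock over the whole interval, not up to \<open>t\<close>: so it stays
  positive for \<open>t\<close> near \<open>a\<close>, and it is still additive over adjacent intervals.\<close>

definition controlled :: "real \<Rightarrow> real \<Rightarrow> real \<Rightarrow> bool" where
  "controlled \<kappa> a b \<longleftrightarrow>
     (\<forall>\<^sub>F n in sequentially. \<forall>t\<in>{a..b}. \<bar>error n t - error n a\<bar> \<le> 2 * \<kappa> * (clock b - clock a))"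

lemma clock_mono: "0 \<le> x \<Longrightarrow> x \<le> y \<Longrightarrow> y \<le> T \<Longrightarrow> clock x \<le> clock y"
  using Q1.mono[of x y] Q2.mono[of x y] by (simp add: clock_def)

lemma controlled_trans:
  assumes "controlled \<kappa> a b" "controlled \<kappa> b c" "0 \<le> a" "a \<le> b" "b \<le> c" "c \<le> T" "0 \<le> \<kappa>"
  shows "controlled \<kappa> a c"
  using assms(1,2) unfolding controlled_def
proof eventually_elim
  case (elim n)
  show ?case
  proof
    fix t assume t: "t \<in> {a..c}"
    have eq: "2 * \<kappa> * (clock c - clock a) = 2 * \<kappa> * (clock b - clock a) + 2 * \<kappa> * (clock c - clock b)"
      by (simp add: algebra_simps)
    have ge: "0 \<le> 2 * \<kappa> * (clock c - clock b)" "0 \<le> 2 * \<kappa> * (clock b - clock a)"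
      using clock_mono[of b c] clock_mono[of a b] assms by auto
    show "\<bar>error n t - error n a\<bar> \<le> 2 * \<kappa> * (clock c - clock a)"
    proof (cases "t \<le> b")
      case True
      then have "\<bar>error n t - error n a\<bar> \<le> 2 * \<kappa> * (clock b - clock a)" using elim(1) t by auto
      then show ?thesis using eq ge by linarith
    next
      case False
      then have "\<bar>error n t - error n b\<bar> \<le> 2 * \<kappa> * (clock c - clock b)"
        "\<bar>error n b - error n a\<bar> \<le> 2 * \<kappa> * (clock b - clock a)" using elim t assms by auto
      then show ?thesis using eq by linarith
    qed
  qed
qed

lemma controlled_refl: "controlled \<kappa> a a"
  by (simp add: controlled_def)

text \<open>The two approximations of the increments over \<open>[a, t]\<close> have the same main term, so only
  their errors remain, of which all but those proportional to \<open>\<kappa>\<close> vanish in the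
  limit.\<close>

lemma controlled_of_proportional:
  assumes ab: "0 \<le> a" "a < b" "b \<le> T" and pr: "proportional_on a b c \<kappa>" and \<kappa>: "0 < \<kappa>"
  shows "controlled \<kappa> a b"
proof -
  \<comment> \<open>so that all vanishing errors together amount to the share \<open>2 * \<kappa> * (b - a)\<close> of the time in the clock\<close>
  define w where "w = 2 * \<kappa> * (b - a) / (2 + 3 * \<bar>c\<bar> + 6 * \<kappa>)"
  have den: "0 < 2 + 3 * \<bar>c\<bar> + 6 * \<kappa>" using \<kappa> by (intro add_pos_nonneg) auto
  have w: "0 < w" "w * (2 + 3 * \<bar>c\<bar> + 6 * \<kappa>) = 2 * \<kappa> * (b - a)"
    using den ab \<kappa> by (auto simp: w_def)
  obtain d where d: "0 < d" "\<And>e t. 0 < e \<Longrightarrow> e < d \<Longrightarrow> a \<le> t \<Longrightarrow> t \<le> b \<Longrightarrow>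
    \<bar>incr_avg Y Z e a t - c * incr_avg f g e a t - end_jump b c t\<bar>
      \<le> \<kappa> * (incr_avg f f e a t + incr_avg g g e a t) + w"
    by (rule incr_avg_approx[OF ab pr less_imp_le[OF \<kappa>] w(1)]) blast
  have aT: "a \<le> T" using ab by auto
  note re = incr_avg_restart_eventually[OF _ _ T_pos ab(1) aT w(1) \<epsilon>_pos \<epsilon>_lim]
  have "\<forall>\<^sub>F n in sequentially. \<epsilon> n < d"
    using order_tendstoD(2)[OF \<epsilon>_lim d(1)] .
  then show ?thesis
    using re[OF Y Z] re[OF f g] re[OF f f] re[OF g g]
      uniform_limitD_abs[OF lim11 w(1)] uniform_limitD_abs[OF lim12 w(1)] uniform_limitD_abs[OF lim22 w(1)]
    unfolding controlled_def
  proof eventually_elim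
    case (elim n)
    show ?case
    proof
      fix t assume t: "t \<in> {a..b}"
      let ?K = "\<lambda>u v. incr_avg u v (\<epsilon> n) a t"
      let ?H = "\<lambda>u v. incr_avg u v (\<epsilon> n) 0 t - incr_avg u v (\<epsilon> n) 0 a"
      have tT: "t \<in> {a..T}" "t \<in> {0..T}" "a \<in> {0..T}" using t ab by auto
      have 1: "\<bar>?H Y Z - ?K Y Z\<bar> \<le> w" "\<bar>?H f g - ?K f g\<bar> \<le> w" "\<bar>?H f f - ?K f f\<bar> \<le> w" "\<bar>?H g g - ?K g g\<bar> \<le> w"
        using elim(2-5) tT(1) by auto
      have 2: "\<bar>?H f f - (A11 t - A11 a)\<bar> \<le> 2 * w" "\<bar>?H f g - (A12 t - A12 a)\<bar> \<le> 2 * w"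
        "\<bar>?H g g - (A22 t - A22 a)\<bar> \<le> 2 * w"
        using bspec[OF elim(6) tT(2)] bspec[OF elim(6) tT(3)] bspec[OF elim(7) tT(2)] bspec[OF elim(7) tT(3)]
          bspec[OF elim(8) tT(2)] bspec[OF elim(8) tT(3)] by argo+
      have 3: "\<bar>?K Y Z - c * ?K f g - end_jump b c t\<bar> \<le> \<kappa> * (?K f f + ?K g g) + w"
        by (rule d(2)[OF \<epsilon>_pos elim(1)]) (use t in auto)
      have 4: "\<bar>limit_path t - limit_path a - c * (A12 t - A12 a) - end_jump b c t\<bar>
         \<le> \<kappa> * (A11 t - A11 a + (A22 t - A22 a))"
        by (rule limit_path_approx[OF ab pr]) (use t \<kappa> in auto)
      have "\<bar>?K f g - (A12 t - A12 a)\<bar> \<le> 3 * w" using 1(2) 2(2) by argo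
      then have 5: "\<bar>c * ?K f g - c * (A12 t - A12 a)\<bar> \<le> \<bar>c\<bar> * (3 * w)"
        unfolding right_diff_distrib[symmetric] abs_mult by (rule mult_left_mono) simp
      have "?K f f + ?K g g \<le> (A11 t - A11 a + (A22 t - A22 a)) + 6 * w" using 1(3,4) 2(1,3) by argo
      then have 6: "\<kappa> * (?K f f + ?K g g) \<le> \<kappa> * ((A11 t - A11 a + (A22 t - A22 a)) + 6 * w)"
        using \<kappa> by (intro mult_left_mono) auto
      have "A11 t + A22 t \<le> A11 b + A22 b" using Q1.mono[of t b] Q2.mono[of t b] t ab by auto
      then have 7: "\<kappa> * (A11 t - A11 a + (A22 t - A22 a)) \<le> \<kappa> * (A11 b - A11 a + (A22 b - A22 a))"
        using \<kappa> by (intro mult_left_mono) auto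
      have 8: "2 * \<kappa> * (clock b - clock a) = 2 * (\<kappa> * (A11 b - A11 a + (A22 b - A22 a))) + w * (2 + 3 * \<bar>c\<bar> + 6 * \<kappa>)"
        unfolding w(2) clock_def by (simp add: algebra_simps)
      have 9: "w * (2 + 3 * \<bar>c\<bar> + 6 * \<kappa>) = 2 * w + \<bar>c\<bar> * (3 * w) + 6 * (\<kappa> * w)"
        "\<kappa> * ((A11 t - A11 a + (A22 t - A22 a)) + 6 * w) = \<kappa> * (A11 t - A11 a + (A22 t - A22 a)) + 6 * (\<kappa> * w)"
        by (simp_all add: algebra_simps)
      have "\<bar>error n t - error n a\<bar> = \<bar>(?H Y Z - ?K Y Z) + (?K Y Z - c * ?K f g - end_jump b c t)
          + (c * ?K f g - c * (A12 t - A12 a))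
          - (limit_path t - limit_path a - c * (A12 t - A12 a) - end_jump b c t)\<bar>"
        by (simp add: error_def)
      also have "\<dots> \<le> \<bar>?H Y Z - ?K Y Z\<bar> + \<bar>?K Y Z - c * ?K f g - end_jump b c t\<bar>
          + \<bar>c * ?K f g - c * (A12 t - A12 a)\<bar>
          + \<bar>limit_path t - limit_path a - c * (A12 t - A12 a) - end_jump b c t\<bar>"
        by (rule abs_four_terms_le)
      also have "\<dots> \<le> 2 * \<kappa> * (clock b - clock a)"
        unfolding 8 9(1) using add_mono[OF add_mono[OF add_mono[OF 1(1) 3] 5] 4] 6[unfolded 9(2)] 7 by linarith
      finally show "\<bar>error n t - error n a\<bar> \<le> 2 * \<kappa> * (clock b - clock a)" .
    qed
  qed
qed

end

text \<open>Intervals that start or end at \<open>x\<close> see only one of the one-sided limits at \<open>x\<close>, which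
  determines the factor \<open>c\<close>; a short interval around \<open>x\<close> is split there.\<close>

locale locally_proportional_paths = transformed_paths +
  assumes local: "\<And>\<kappa> x. 0 < \<kappa> \<Longrightarrow> 0 \<le> x \<Longrightarrow> x \<le> T \<Longrightarrow> \<exists>d>0. \<forall>a b.
    0 \<le> a \<and> a < b \<and> b \<le> T \<and> b - a < d \<and> (a = x \<or> b = x) \<longrightarrow> (\<exists>c. proportional_on a b c \<kappa>)"
begin

text \<open>Around any point \<open>x\<close>, an interval is split at \<open>x\<close>, and the two pieces are
  proportional. Bisection then covers \<open>[0, T]\<close>.\<close>

lemma controlled_everywhere:
  assumes \<kappa>: "0 < \<kappa>"
  shows "controlled \<kappa> 0 T"
proof -
  define P where "P a b \<longleftrightarrow> (a \<le> b \<longrightarrow> 0 \<le> a \<longrightarrow> b \<le> T \<longrightarrow> controlled \<kappa> a b)" for a b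
  have "0 \<le> T" using T_pos by simp
  then have "P 0 T"
  proof (induction rule: Bolzano)
    case (trans a b c)
    then show ?case unfolding P_def using controlled_trans[of \<kappa> a b c] \<kappa> by auto
  next
    case (local x)
    obtain d where d: "d > 0" "\<And>a b. 0 \<le> a \<Longrightarrow> a < b \<Longrightarrow> b \<le> T \<Longrightarrow> b - a < d \<Longrightarrow> a = x \<or> b = x \<Longrightarrow>
       \<exists>c. proportional_on a b c \<kappa>"
      using locally_proportional_paths.local[OF locally_proportional_paths_axioms \<kappa> local] by blast
    have one: "controlled \<kappa> a b" if "0 \<le> a" "a \<le> b" "b \<le> T" "b - a < d" "a = x \<or> b = x" for a b
    proof (cases "a = b")
      case False
      then show ?thesis using d(2)[of a b] controlled_of_proportional[of a b _ \<kappa>] \<kappa> that by auto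
    qed (simp add: controlled_refl)
    show ?case
    proof (rule exI[of _ d], intro conjI allI impI)
      fix a b assume ab: "a \<le> x \<and> x \<le> b \<and> b - a < d"
      show "P a b" unfolding P_def
      proof (intro impI)
        assume "a \<le> b" "0 \<le> a" "b \<le> T"
        then show "controlled \<kappa> a b"
          using one[of a x] one[of x b] controlled_trans[of \<kappa> a x b] ab \<kappa> by auto
      qed
    qed (rule d(1))
  qed
  then show ?thesis using T_pos by (simp add: P_def)
qed

theorem incr_avg_limit_path: "uniform_limit {0..T} (\<lambda>n t. incr_avg Y Z (\<epsilon> n) 0 t) limit_path sequentially"
proof (rule uniform_limitI)
  fix e :: real assume e: "0 < e"
  have c: "0 < clock T - clock 0"
    using Q1.mono[of 0 T] Q2.mono[of 0 T] T_pos by (simp add: clock_def)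
  define \<kappa> where "\<kappa> = e / (4 * (clock T - clock 0))"
  have \<kappa>: "0 < \<kappa>" "2 * \<kappa> * (clock T - clock 0) = e / 2"
    using e c by (auto simp: \<kappa>_def field_simps)
  have "error n 0 = 0" for n
    by (simp add: error_def limit_path_start incr_avg_start[OF \<epsilon>_pos])
  then show "\<forall>\<^sub>F n in sequentially. \<forall>t\<in>{0..T}. dist (incr_avg Y Z (\<epsilon> n) 0 t) (limit_path t) < e"
    using controlled_everywhere[OF \<kappa>(1)] e unfolding controlled_def \<kappa>(2)
    by (auto elim!: eventually_mono simp: error_def dist_real_def)
qed

end

section \<open>Differentiable images of paths\<close>

lemma C1_deriv:
  assumes "\<phi> C1_differentiable_on UNIV"
  shows "(\<phi> has_real_derivative deriv \<phi> x) (at x)" "continuous_on UNIV (deriv \<phi>)" "continuous_on UNIV \<phi>"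
proof -
  obtain D where D: "\<And>x. (\<phi> has_vector_derivative D x) (at x)" "continuous_on UNIV D"
    using assms by (auto simp: C1_differentiable_on_def)
  have D': "(\<phi> has_real_derivative D x) (at x)" for x
    using D(1) by (simp add: has_real_derivative_iff_has_vector_derivative)
  then have "deriv \<phi> = D" by (auto intro!: DERIV_imp_deriv)
  then show d: "(\<phi> has_real_derivative deriv \<phi> x) (at x)" "continuous_on UNIV (deriv \<phi>)" for x
    using D' D by auto
  show "continuous_on UNIV \<phi>"
    using D' by (intro continuous_at_imp_continuous_on ballI DERIV_isCont)
qed

text \<open>The mean value inequality for \<open>\<phi>\<close> minus its linearization with slope
  \<open>\<phi>' l\<close>.\<close>

lemma C1_linearize:
  assumes \<phi>: "\<phi> C1_differentiable_on UNIV" and near: "\<And>y. y \<in> cball l \<rho> \<Longrightarrow> \<bar>deriv \<phi> y - deriv \<phi> l\<bar> \<le> \<eta>"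
    and y: "y \<in> cball l \<rho>" "y' \<in> cball l \<rho>"
  shows "\<bar>\<phi> y' - \<phi> y - deriv \<phi> l * (y' - y)\<bar> \<le> \<eta> * \<bar>y' - y\<bar>"
proof -
  let ?h = "\<lambda>z. \<phi> z - deriv \<phi> l * z"
  have "norm (?h y' - ?h y) \<le> \<eta> * norm (y' - y)"
  proof (rule field_differentiable_bound[OF convex_cball[of l \<rho>]])
    fix z assume "z \<in> cball l \<rho>"
    show "(?h has_field_derivative deriv \<phi> z - deriv \<phi> l) (at z within cball l \<rho>)"
      by (auto intro!: derivative_eq_intros has_field_derivative_at_within[OF C1_deriv(1)[OF \<phi>]])
    show "norm (deriv \<phi> z - deriv \<phi> l) \<le> \<eta>" using near[OF \<open>z \<in> cball l \<rho>\<close>] by simp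
  qed (use y in auto)
  then show ?thesis by (simp add: algebra_simps)
qed

lemma C1_Lipschitz_on_Icc:
  assumes \<theta>: "\<theta> C1_differentiable_on UNIV"
  obtains L where "0 \<le> L" "\<And>y. y \<in> {- C..C} \<Longrightarrow> \<bar>deriv \<theta> y\<bar> \<le> L"
    "\<And>y y'. y \<in> {- C..C} \<Longrightarrow> y' \<in> {- C..C} \<Longrightarrow> \<bar>\<theta> y' - \<theta> y\<bar> \<le> L * \<bar>y' - y\<bar>"
proof -
  have "compact (deriv \<theta> ` {- C..C})"
    using C1_deriv(2)[OF \<theta>] by (intro compact_continuous_image) (auto intro: continuous_on_subset)
  from compact_imp_bounded[OF this]
  obtain L where L: "0 < L" "\<forall>z\<in>deriv \<theta> ` {- C..C}. norm z \<le> L"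
    unfolding bounded_pos by (elim exE conjE)
  show thesis
  proof (rule that[of L])
    show "\<bar>\<theta> y' - \<theta> y\<bar> \<le> L * \<bar>y' - y\<bar>" if y: "y \<in> {- C..C}" "y' \<in> {- C..C}" for y y'
    proof -
      have "norm (\<theta> y' - \<theta> y) \<le> L * norm (y' - y)"
      proof (rule field_differentiable_bound[of "{- C..C}" \<theta> "deriv \<theta>"])
        show "(\<theta> has_field_derivative deriv \<theta> z) (at z within {- C..C})" for z
          by (rule has_field_derivative_at_within[OF C1_deriv(1)[OF \<theta>]])
      qed (use L y in auto)
      then show ?thesis by simp
    qed
  qed (use L in auto)
qed

lemma C1_slope_near:
  assumes \<theta>: "\<theta> C1_differentiable_on UNIV" and "0 < \<eta>"
  obtains \<rho> where "0 < \<rho>" "\<And>y. y \<in> cball l \<rho> \<Longrightarrow> \<bar>deriv \<theta> y - deriv \<theta> l\<bar> \<le> \<eta>"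
proof -
  have "isCont (deriv \<theta>) l" using C1_deriv(2)[OF \<theta>] by (simp add: continuous_on_eq_continuous_at)
  then obtain d where d: "0 < d" "\<And>y. dist y l < d \<Longrightarrow> dist (deriv \<theta> y) (deriv \<theta> l) < \<eta>"
    using \<open>0 < \<eta>\<close> unfolding continuous_at_eps_delta by blast
  show thesis
  proof (rule that[of "d / 2"])
    fix y assume "y \<in> cball l (d / 2)"
    then have "dist y l < d" using d(1) by (auto simp: dist_commute)
    from d(2)[OF this] show "\<bar>deriv \<theta> y - deriv \<theta> l\<bar> \<le> \<eta>" by (simp add: dist_real_def)
  qed (use d in auto)
qed

lemma product_linearize:
  fixes p q x y :: real
  assumes "\<bar>p - \<alpha> * x\<bar> \<le> \<eta> * \<bar>x\<bar>" "\<bar>q - \<beta> * y\<bar> \<le> \<eta> * \<bar>y\<bar>" "0 \<le> \<eta>"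
  shows "\<bar>p * q - \<alpha> * \<beta> * (x * y)\<bar> \<le> \<eta> * (\<bar>\<alpha>\<bar> + \<bar>\<beta>\<bar> + \<eta>) * (\<bar>x\<bar> * \<bar>y\<bar>)"
proof -
  have q: "\<bar>q\<bar> \<le> (\<bar>\<beta>\<bar> + \<eta>) * \<bar>y\<bar>"
  proof -
    have "\<bar>q\<bar> \<le> \<bar>q - \<beta> * y\<bar> + \<bar>\<beta> * y\<bar>" by linarith
    also have "\<dots> \<le> \<eta> * \<bar>y\<bar> + \<bar>\<beta>\<bar> * \<bar>y\<bar>" using assms(2) by (simp add: abs_mult)
    finally show ?thesis by (simp add: algebra_simps)
  qed
  have "\<bar>(p - \<alpha> * x) * q\<bar> \<le> (\<eta> * \<bar>x\<bar>) * ((\<bar>\<beta>\<bar> + \<eta>) * \<bar>y\<bar>)"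
    unfolding abs_mult by (intro mult_mono assms q) (use assms in auto)
  note 1 = this
  have 2: "\<bar>\<alpha> * x * (q - \<beta> * y)\<bar> \<le> (\<bar>\<alpha>\<bar> * \<bar>x\<bar>) * (\<eta> * \<bar>y\<bar>)"
    unfolding abs_mult by (intro mult_mono assms) auto
  have "p * q - \<alpha> * \<beta> * (x * y) = (p - \<alpha> * x) * q + \<alpha> * x * (q - \<beta> * y)"
    by (simp add: algebra_simps)
  with order_trans[OF abs_triangle_ineq add_mono[OF 1 2]] have "\<bar>p * q - \<alpha> * \<beta> * (x * y)\<bar> \<le> (\<eta> * \<bar>x\<bar>) * ((\<bar>\<beta>\<bar> + \<eta>) * \<bar>y\<bar>) + (\<bar>\<alpha>\<bar> * \<bar>x\<bar>) * (\<eta> * \<bar>y\<bar>)"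
    by (simp only:)
  then show ?thesis by (simp add: algebra_simps)
qed

lemma abs_mult_le_sum_squares: "\<bar>x\<bar> * \<bar>y\<bar> \<le> x\<^sup>2 + y\<^sup>2" for x y :: real
proof -
  have "0 \<le> (\<bar>x\<bar> - \<bar>y\<bar>)\<^sup>2" by simp
  then have "2 * (\<bar>x\<bar> * \<bar>y\<bar>) \<le> x\<^sup>2 + y\<^sup>2" by (simp add: power2_diff)
  moreover have "0 \<le> \<bar>x\<bar> * \<bar>y\<bar>" by simp
  ultimately show ?thesis by linarith
qed

text \<open>The error is stated in terms of squares because their averages converge: this is where the
  quadratic variations of both paths are used.\<close>

lemma product_linearize_squares:
  fixes p q x y :: real
  assumes "\<bar>p - \<alpha> * x\<bar> \<le> \<eta> * \<bar>x\<bar>" "\<bar>q - \<beta> * y\<bar> \<le> \<eta> * \<bar>y\<bar>" "0 \<le> \<eta>"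
    and \<kappa>: "\<eta> * (\<bar>\<alpha>\<bar> + \<bar>\<beta>\<bar> + \<eta>) \<le> \<kappa>"
  shows "\<bar>p * q - \<alpha> * \<beta> * (x * y)\<bar> \<le> \<kappa> * (x\<^sup>2 + y\<^sup>2)"
proof -
  have "\<bar>p * q - \<alpha> * \<beta> * (x * y)\<bar> \<le> \<eta> * (\<bar>\<alpha>\<bar> + \<bar>\<beta>\<bar> + \<eta>) * (\<bar>x\<bar> * \<bar>y\<bar>)"
    by (rule product_linearize[OF assms(1-3)])
  also have "\<dots> \<le> \<kappa> * (x\<^sup>2 + y\<^sup>2)"
    using \<kappa> assms(3) order_trans[OF _ \<kappa>, of 0] by (intro mult_mono abs_mult_le_sum_squares) auto
  finally show ?thesis .
qed

text \<open>Integrands with a path and with its left limits are treated at once: \<open>u\<close> and \<open>v\<close> are the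
  paths at which the derivatives are evaluated.\<close>

locale C1_paths = covariation_paths +
  fixes \<phi> \<psi> u v :: "real \<Rightarrow> real"
  assumes \<phi>: "\<phi> C1_differentiable_on UNIV" and \<psi>: "\<psi> C1_differentiable_on UNIV"
    and u: "u = f \<or> u = left_lim f" and v: "v = g \<or> v = left_lim g"
begin

text \<open>At a time \<open>s > a\<close> the left limit is one of values of \<open>p\<close> on
  \<open>[a, s)\<close>, hence in the closed set \<open>S\<close>.\<close>

lemma version_in_closed:
  assumes p: "cadlag_on T p" and w: "w = p \<or> w = left_lim p" and "0 \<le> a" "b \<le> T"
    and S: "\<And>s. a \<le> s \<Longrightarrow> s < b \<Longrightarrow> p s \<in> S" "closed S" and s: "a < s" "s < b"
  shows "w s \<in> S"
  using w
proof
  assume "w = left_lim p"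
  moreover have "left_lim p s \<in> S"
    by (rule left_lim_in_closed[OF p _ _ s(1) _ S(2)]) (use assms in auto)
  ultimately show ?thesis by simp
qed (use S s in auto)

lemma version_borel:
  assumes p: "cadlag_on T p" and w: "w = p \<or> w = left_lim p"
  shows "\<exists>h. h \<in> borel_measurable borel \<and> (\<forall>s\<in>{0<..T}. h s = w s)"
  using w
proof
  assume "w = p"
  then show ?thesis
    using borel_measurable_grid_lim[of T p] grid_lim_eq[OF p] T_pos by (intro exI[of _ "grid_lim T p"]) auto
next
  assume w: "w = left_lim p"
  obtain h where "h \<in> borel_measurable borel" "\<And>s. s \<in> {0<..T} \<Longrightarrow> h s = left_lim p s"
    by (rule left_lim_borel[OF p T_pos]) blast
  then show ?thesis using w by auto
qed

abbreviation k :: "real \<Rightarrow> real" where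
  "k s \<equiv> deriv \<phi> (u s) * deriv \<psi> (v s)"

lemma integrand_borel: "(\<lambda>s. indicator {0<..T} s * k s) \<in> borel_measurable borel"
proof -
  obtain h1 where [measurable]: "h1 \<in> borel_measurable borel" and h1: "\<forall>s\<in>{0<..T}. h1 s = u s"
    using version_borel[OF f u] by auto
  obtain h2 where [measurable]: "h2 \<in> borel_measurable borel" and h2: "\<forall>s\<in>{0<..T}. h2 s = v s"
    using version_borel[OF g v] by auto
  have [measurable]: "deriv \<phi> \<in> borel_measurable borel" "deriv \<psi> \<in> borel_measurable borel"
    using C1_deriv(2)[OF \<phi>] C1_deriv(2)[OF \<psi>] by (auto intro: borel_measurable_continuous_onI)
  have "(\<lambda>s. indicator {0<..T} s * k s) = (\<lambda>s. indicator {0<..T} s * (deriv \<phi> (h1 s) * deriv \<psi> (h2 s)))"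
    using h1 h2 by (auto simp: fun_eq_iff indicator_def)
  then show ?thesis by simp
qed

lemma transformed: "\<exists>L. transformed_paths T f g \<epsilon> A11 A12 A22 (\<lambda>t. \<phi> (f t)) (\<lambda>t. \<psi> (g t)) k L"
proof -
  obtain C where C: "0 < C" "\<And>s. 0 \<le> s \<Longrightarrow> s \<le> T \<Longrightarrow> \<bar>f s\<bar> \<le> C" "\<And>s. 0 \<le> s \<Longrightarrow> s \<le> T \<Longrightarrow> \<bar>g s\<bar> \<le> C"
    by (rule cadlag_bounded2[OF f g T_pos]) blast
  have mem: "f s \<in> {- C..C}" "g s \<in> {- C..C}" if "0 \<le> s" "s \<le> T" for s
    using C(2)[OF that] C(3)[OF that] by (auto simp: abs_le_iff)
  have lmem: "left_lim f s \<in> {- C..C}" "left_lim g s \<in> {- C..C}" if "s \<in> {0<..T}" for s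
  proof -
    have s: "0 < s" "s \<le> T" using that by auto
    show "left_lim f s \<in> {- C..C}"
      by (rule left_lim_in_closed[OF f s s(1)]) (use mem s in \<open>auto simp del: atLeastAtMost_iff\<close>)
    show "left_lim g s \<in> {- C..C}"
      by (rule left_lim_in_closed[OF g s s(1)]) (use mem s in \<open>auto simp del: atLeastAtMost_iff\<close>)
  qed
  have uv: "u s \<in> {- C..C}" "v s \<in> {- C..C}" if "s \<in> {0<..T}" for s
    using u v mem[of s] lmem[OF that] that by auto
  obtain L1 where L1: "0 \<le> L1" "\<And>y. y \<in> {- C..C} \<Longrightarrow> \<bar>deriv \<phi> y\<bar> \<le> L1"
    "\<And>y y'. y \<in> {- C..C} \<Longrightarrow> y' \<in> {- C..C} \<Longrightarrow> \<bar>\<phi> y' - \<phi> y\<bar> \<le> L1 * \<bar>y' - y\<bar>"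
    by (rule C1_Lipschitz_on_Icc[OF \<phi>, of C]) blast
  obtain L2 where L2: "0 \<le> L2" "\<And>y. y \<in> {- C..C} \<Longrightarrow> \<bar>deriv \<psi> y\<bar> \<le> L2"
    "\<And>y y'. y \<in> {- C..C} \<Longrightarrow> y' \<in> {- C..C} \<Longrightarrow> \<bar>\<psi> y' - \<psi> y\<bar> \<le> L2 * \<bar>y' - y\<bar>"
    by (rule C1_Lipschitz_on_Icc[OF \<psi>, of C]) blast
  have "transformed_paths T f g \<epsilon> A11 A12 A22 (\<lambda>t. \<phi> (f t)) (\<lambda>t. \<psi> (g t)) k (L1 * L2)"
  proof unfold_locales
    show "cadlag_on T (\<lambda>t. \<phi> (f t))" "cadlag_on T (\<lambda>t. \<psi> (g t))"
      by (rule cadlag_on_compose[OF C1_deriv(3)[OF \<phi>] f], rule cadlag_on_compose[OF C1_deriv(3)[OF \<psi>] g])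
    show "(\<lambda>s. indicator {0<..T} s * k s) \<in> borel_measurable borel" by (rule integrand_borel)
    fix s assume s: "s \<in> {0<..T}"
    show "\<bar>k s\<bar> \<le> L1 * L2"
      unfolding abs_mult by (intro mult_mono L1 L2 uv[OF s]) auto
    have s': "0 < s" "s \<le> T" "0 \<le> s" using s by auto
    have "\<bar>jump (\<lambda>t. \<phi> (f t)) s\<bar> \<le> L1 * \<bar>jump f s\<bar>" "\<bar>jump (\<lambda>t. \<psi> (g t)) s\<bar> \<le> L2 * \<bar>jump g s\<bar>"
      using L1(3)[OF lmem(1)[OF s] mem(1)[OF s'(3,2)]] L2(3)[OF lmem(2)[OF s] mem(2)[OF s'(3,2)]]
        jump_compose[OF C1_deriv(3)[OF \<phi>] f s'(1,2)] jump_compose[OF C1_deriv(3)[OF \<psi>] g s'(1,2)]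
      by (auto simp: jump_def)
    then have "\<bar>jump (\<lambda>t. \<phi> (f t)) s * jump (\<lambda>t. \<psi> (g t)) s\<bar> \<le> (L1 * \<bar>jump f s\<bar>) * (L2 * \<bar>jump g s\<bar>)"
      unfolding abs_mult using L1(1) by (intro mult_mono) auto
    also have "\<dots> = (L1 * L2) * (\<bar>jump f s\<bar> * \<bar>jump g s\<bar>)" by simp
    also have "\<dots> \<le> (L1 * L2) * ((jump f s)\<^sup>2 + (jump g s)\<^sup>2)"
      using L1(1) L2(1) by (intro mult_left_mono abs_mult_le_sum_squares) auto
    finally show "\<bar>jump (\<lambda>t. \<phi> (f t)) s * jump (\<lambda>t. \<psi> (g t)) s\<bar> \<le> (L1 * L2) * ((jump f s)\<^sup>2 + (jump g s)\<^sup>2)" .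
  qed
  then show ?thesis by blast
qed

lemma proportional_of_near:
  assumes tp: "transformed_paths T f g \<epsilon> A11 A12 A22 (\<lambda>t. \<phi> (f t)) (\<lambda>t. \<psi> (g t)) k L"
    and ab: "0 \<le> a" "b \<le> T"
    and slope: "\<And>y. y \<in> cball l \<rho> \<Longrightarrow> \<bar>deriv \<phi> y - deriv \<phi> l\<bar> \<le> \<eta>"
      "\<And>y. y \<in> cball m \<sigma> \<Longrightarrow> \<bar>deriv \<psi> y - deriv \<psi> m\<bar> \<le> \<eta>"
    and near: "\<And>s. a \<le> s \<Longrightarrow> s < b \<Longrightarrow> f s \<in> cball l \<rho>" "\<And>s. a \<le> s \<Longrightarrow> s < b \<Longrightarrow> g s \<in> cball m \<sigma>"
    and \<eta>: "0 \<le> \<eta>" "\<eta> * (\<bar>deriv \<phi> l\<bar> + \<bar>deriv \<psi> m\<bar> + \<eta>) \<le> \<kappa>"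
  shows "transformed_paths.proportional_on f g (\<lambda>t. \<phi> (f t)) (\<lambda>t. \<psi> (g t)) k a b (deriv \<phi> l * deriv \<psi> m) \<kappa>"
proof -
  interpret transformed_paths T f g \<epsilon> A11 A12 A22 "\<lambda>t. \<phi> (f t)" "\<lambda>t. \<psi> (g t)" k L by (rule tp)
  note lin = C1_linearize[OF \<phi> slope(1)] C1_linearize[OF \<psi> slope(2)]
  have mid: "w s \<in> cball l \<rho>" if "w = f \<or> w = left_lim f" "a < s" "s < b" for w s
    by (rule version_in_closed[OF f that(1) ab near(1) closed_cball that(2,3)])
  have mid': "w s \<in> cball m \<sigma>" if "w = g \<or> w = left_lim g" "a < s" "s < b" for w s
    by (rule version_in_closed[OF g that(1) ab near(2) closed_cball that(2,3)])
  show ?thesis unfolding proportional_on_def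
  proof (intro conjI allI impI; elim conjE)
    fix s s' assume s: "a \<le> s" "s < b" "a \<le> s'" "s' < b"
    show "\<bar>(\<phi> (f s') - \<phi> (f s)) * (\<psi> (g s') - \<psi> (g s)) - deriv \<phi> l * deriv \<psi> m * ((f s' - f s) * (g s' - g s))\<bar>
      \<le> \<kappa> * ((f s' - f s) * (f s' - f s) + (g s' - g s) * (g s' - g s))"
      unfolding power2_eq_square[symmetric]
      by (rule product_linearize_squares[OF lin(1) lin(2) \<eta>]) (use near s in blast)+
  next
    fix s assume s: "a < s" "s < b"
    have s': "0 < s" "s \<le> T" using s ab by auto
    show "\<bar>jump (\<lambda>t. \<phi> (f t)) s * jump (\<lambda>t. \<psi> (g t)) s - deriv \<phi> l * deriv \<psi> m * (jump f s * jump g s)\<bar>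
      \<le> \<kappa> * ((jump f s)\<^sup>2 + (jump g s)\<^sup>2)"
      unfolding jump_compose[OF C1_deriv(3)[OF \<phi>] f s'] jump_compose[OF C1_deriv(3)[OF \<psi>] g s'] jump_def[of f s] jump_def[of g s]
      by (rule product_linearize_squares[OF lin(1) lin(2) \<eta>]) (use mid[OF _ s] mid'[OF _ s] in blast)+
    have "u s \<in> cball l \<rho>" "v s \<in> cball m \<sigma>" using mid[OF u s] mid'[OF v s] .
    then have "\<bar>deriv \<phi> (u s) * deriv \<psi> (v s) - deriv \<phi> l * deriv \<psi> m * (1 * 1)\<bar>
       \<le> \<eta> * (\<bar>deriv \<phi> l\<bar> + \<bar>deriv \<psi> m\<bar> + \<eta>) * (\<bar>1\<bar> * \<bar>1\<bar>)"
      by (intro product_linearize) (use slope \<eta> in auto)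
    then show "\<bar>deriv \<phi> (u s) * deriv \<psi> (v s) - deriv \<phi> l * deriv \<psi> m\<bar> \<le> \<kappa>"
      using \<eta>(2) by simp
  qed
qed

text \<open>To the right of \<open>x\<close> the paths stay near \<open>f x\<close> and \<open>g x\<close>, to the left near
  their left limits at \<open>x\<close>; the factor \<open>c\<close> is the value of
  \<open>\<phi>' \<psi>'\<close> there.\<close>

lemma locally_proportional:
  "\<exists>L. locally_proportional_paths T f g \<epsilon> A11 A12 A22 (\<lambda>t. \<phi> (f t)) (\<lambda>t. \<psi> (g t)) k L"
proof -
  obtain L where tp: "transformed_paths T f g \<epsilon> A11 A12 A22 (\<lambda>t. \<phi> (f t)) (\<lambda>t. \<psi> (g t)) k L"
    using transformed by blast
  interpret TP: transformed_paths T f g \<epsilon> A11 A12 A22 "\<lambda>t. \<phi> (f t)" "\<lambda>t. \<psi> (g t)" k L by (rule tp)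
  have tolerance: "\<exists>\<rho>>0. \<forall>a b. 0 \<le> a \<and> b \<le> T \<and> (\<forall>s. a \<le> s \<and> s < b \<longrightarrow> f s \<in> cball l \<rho> \<and> g s \<in> cball m \<rho>)
      \<longrightarrow> (\<exists>c. TP.proportional_on a b c \<kappa>)" if \<kappa>: "0 < \<kappa>" for l m \<kappa>
  proof -
    \<comment> \<open>the bound by \<open>1\<close> turns the quadratic inequality for \<open>\<eta>\<close> into a linear one\<close>
    define \<eta> where "\<eta> = min 1 (\<kappa> / (\<bar>deriv \<phi> l\<bar> + \<bar>deriv \<psi> m\<bar> + 1))"
    have \<eta>: "0 < \<eta>" "\<eta> \<le> 1" using \<kappa> by (auto simp: \<eta>_def intro!: divide_pos_pos add_nonneg_pos)
    have "\<eta> * (\<bar>deriv \<phi> l\<bar> + \<bar>deriv \<psi> m\<bar> + \<eta>) \<le> \<kappa> / (\<bar>deriv \<phi> l\<bar> + \<bar>deriv \<psi> m\<bar> + 1) * (\<bar>deriv \<phi> l\<bar> + \<bar>deriv \<psi> m\<bar> + 1)"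
      using \<eta> \<kappa> by (intro mult_mono) (auto simp: \<eta>_def)
    also have "\<dots> = \<kappa>" by (rule nonzero_eq_divide_eq[THEN iffD1, rotated, OF refl]) linarith
    finally have \<eta>\<kappa>: "\<eta> * (\<bar>deriv \<phi> l\<bar> + \<bar>deriv \<psi> m\<bar> + \<eta>) \<le> \<kappa>" .
    obtain \<rho> where \<rho>: "0 < \<rho>" "\<And>y. y \<in> cball l \<rho> \<Longrightarrow> \<bar>deriv \<phi> y - deriv \<phi> l\<bar> \<le> \<eta>"
      by (rule C1_slope_near[OF \<phi> \<eta>(1)]) blast
    obtain \<sigma> where \<sigma>: "0 < \<sigma>" "\<And>y. y \<in> cball m \<sigma> \<Longrightarrow> \<bar>deriv \<psi> y - deriv \<psi> m\<bar> \<le> \<eta>"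
      by (rule C1_slope_near[OF \<psi> \<eta>(1)]) blast
    show ?thesis
    proof (rule exI[of _ "min \<rho> \<sigma>"], (intro conjI allI impI; (elim conjE)?))
      fix a b :: real
      assume ab: "0 \<le> a" "b \<le> T" and near: "\<forall>s. a \<le> s \<and> s < b \<longrightarrow> f s \<in> cball l (min \<rho> \<sigma>) \<and> g s \<in> cball m (min \<rho> \<sigma>)"
      have "TP.proportional_on a b (deriv \<phi> l * deriv \<psi> m) \<kappa>"
        by (rule proportional_of_near[OF tp ab \<rho>(2) \<sigma>(2) _ _ _ \<eta>\<kappa>]) (use near \<eta> in auto)
      then show "\<exists>c. TP.proportional_on a b c \<kappa>" by blast
    qed (use \<rho> \<sigma> in auto)
  qed
  have "locally_proportional_paths T f g \<epsilon> A11 A12 A22 (\<lambda>t. \<phi> (f t)) (\<lambda>t. \<psi> (g t)) k L"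
  proof unfold_locales
    fix \<kappa> x :: real assume \<kappa>: "0 < \<kappa>" and x: "0 \<le> x" "x \<le> T"
    have R: "\<exists>d>0. \<forall>b. x < b \<and> b \<le> T \<and> b - x < d \<longrightarrow> (\<exists>c. TP.proportional_on x b c \<kappa>)"
    proof (cases "x < T")
      case True
      obtain \<rho> where \<rho>: "0 < \<rho>" "\<forall>a b. 0 \<le> a \<and> b \<le> T \<and>
          (\<forall>s. a \<le> s \<and> s < b \<longrightarrow> f s \<in> cball (f x) \<rho> \<and> g s \<in> cball (g x) \<rho>) \<longrightarrow> (\<exists>c. TP.proportional_on a b c \<kappa>)"
        using tolerance[OF \<kappa>, of "f x" "g x"] by (elim exE conjE)
      obtain d1 where d1: "0 < d1" "\<And>s. x \<le> s \<Longrightarrow> s < x + d1 \<Longrightarrow> \<bar>f s - f x\<bar> \<le> \<rho>"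
        by (rule cadlag_right[OF f x(1) True \<rho>(1)]) blast
      obtain d2 where d2: "0 < d2" "\<And>s. x \<le> s \<Longrightarrow> s < x + d2 \<Longrightarrow> \<bar>g s - g x\<bar> \<le> \<rho>"
        by (rule cadlag_right[OF g x(1) True \<rho>(1)]) blast
      show ?thesis
      proof (rule exI[of _ "min d1 d2"], (intro conjI allI impI; (elim conjE)?))
        fix b assume b: "x < b" "b \<le> T" "b - x < min d1 d2"
        show "\<exists>c. TP.proportional_on x b c \<kappa>"
          by (rule \<rho>(2)[THEN spec, THEN spec, THEN mp])
            (use x b d1(2) d2(2) in \<open>simp add: dist_real_def abs_minus_commute\<close>)
      qed (use d1 d2 in auto)
    next
      case False
      then show ?thesis by (intro exI[of _ 1]) auto
    qed
    have Lf: "\<exists>d>0. \<forall>a. 0 \<le> a \<and> a < x \<and> x - a < d \<longrightarrow> (\<exists>c. TP.proportional_on a x c \<kappa>)"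
    proof (cases "0 < x")
      case True
      obtain \<rho> where \<rho>: "0 < \<rho>" "\<forall>a b. 0 \<le> a \<and> b \<le> T \<and>
          (\<forall>s. a \<le> s \<and> s < b \<longrightarrow> f s \<in> cball (left_lim f x) \<rho> \<and> g s \<in> cball (left_lim g x) \<rho>) \<longrightarrow> (\<exists>c. TP.proportional_on a b c \<kappa>)"
        using tolerance[OF \<kappa>, of "left_lim f x" "left_lim g x"] by (elim exE conjE)
      obtain d1 where d1: "0 < d1" "\<And>s. x - d1 < s \<Longrightarrow> s < x \<Longrightarrow> \<bar>f s - left_lim f x\<bar> \<le> \<rho>"
        by (rule cadlag_left[OF f True x(2) \<rho>(1)]) blast
      obtain d2 where d2: "0 < d2" "\<And>s. x - d2 < s \<Longrightarrow> s < x \<Longrightarrow> \<bar>g s - left_lim g x\<bar> \<le> \<rho>"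
        by (rule cadlag_left[OF g True x(2) \<rho>(1)]) blast
      show ?thesis
      proof (rule exI[of _ "min d1 d2"], (intro conjI allI impI; (elim conjE)?))
        fix a assume a: "0 \<le> a" "a < x" "x - a < min d1 d2"
        show "\<exists>c. TP.proportional_on a x c \<kappa>"
          by (rule \<rho>(2)[THEN spec, THEN spec, THEN mp])
            (use x a d1(2) d2(2) in \<open>simp add: dist_real_def abs_minus_commute\<close>)
      qed (use d1 d2 in auto)
    next
      case False
      then show ?thesis using x by (intro exI[of _ 1]) auto
    qed
    obtain dR where dR: "dR > 0" "\<forall>b. x < b \<and> b \<le> T \<and> b - x < dR \<longrightarrow> (\<exists>c. TP.proportional_on x b c \<kappa>)"
      using R by blast
    obtain dL where dL: "dL > 0" "\<forall>a. 0 \<le> a \<and> a < x \<and> x - a < dL \<longrightarrow> (\<exists>c. TP.proportional_on a x c \<kappa>)"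
      using Lf by blast
    show "\<exists>d>0. \<forall>a b. 0 \<le> a \<and> a < b \<and> b \<le> T \<and> b - a < d \<and> (a = x \<or> b = x) \<longrightarrow> (\<exists>c. TP.proportional_on a b c \<kappa>)"
      by (rule exI[of _ "min dR dL"]) (use dR dL in auto)
  qed
  then show ?thesis by blast
qed

theorem C1_image_covariation:
  defines "F \<equiv> \<lambda>t. A12 t - (\<Sum>\<^sub>\<infinity>s\<in>{0<..t}. jump f s * jump g s)"
    and "J \<equiv> \<lambda>s. jump (\<lambda>t. \<phi> (f t)) s * jump (\<lambda>t. \<psi> (g t)) s"
  shows "(\<lambda>s. jump f s * jump g s) summable_on {0<..T}" "stieltjes_integrable F T k" "J summable_on {0<..T}"
    "uniform_limit {0..T} (\<lambda>n t. incr_avg (\<lambda>t. \<phi> (f t)) (\<lambda>t. \<psi> (g t)) (\<epsilon> n) 0 t)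
       (\<lambda>t. stieltjes_integral F t k + infsum J {0<..t}) sequentially"
proof -
  obtain L where lp: "locally_proportional_paths T f g \<epsilon> A11 A12 A22 (\<lambda>t. \<phi> (f t)) (\<lambda>t. \<psi> (g t)) k L"
    using locally_proportional by blast
  interpret LP: locally_proportional_paths T f g \<epsilon> A11 A12 A22 "\<lambda>t. \<phi> (f t)" "\<lambda>t. \<psi> (g t)" k L by (rule lp)
  have F: "F = cont_cov" by (simp add: F_def cont_cov_def fun_eq_iff)
  show "(\<lambda>s. jump f s * jump g s) summable_on {0<..T}" by (rule summable_jump_fg)
  show "stieltjes_integrable F T k" unfolding F by (rule LP.stieltjes_integrable_integrand)
  show "J summable_on {0<..T}" unfolding J_def by (rule LP.summable_jump_YZ)
  show "uniform_limit {0..T} (\<lambda>n t. incr_avg (\<lambda>t. \<phi> (f t)) (\<lambda>t. \<psi> (g t)) (\<epsilon> n) 0 t)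
       (\<lambda>t. stieltjes_integral F t k + infsum J {0<..t}) sequentially"
    using LP.incr_avg_limit_path unfolding F J_def LP.limit_path_def[abs_def] .
qed

end

section \<open>Uniform convergence in probability\<close>

lemma strict_mono_choice:
  assumes "\<And>k. \<forall>\<^sub>F n in sequentially. P k n"
  obtains r :: "nat \<Rightarrow> nat" where "strict_mono r" "\<And>k. P k (r k)"
proof -
  obtain N where N: "\<And>k n. N k \<le> n \<Longrightarrow> P k n"
    using assms unfolding eventually_sequentially by metis
  \<comment> \<open>the summand \<open>k\<close> makes \<open>r\<close> strictly increasing even if \<open>N\<close> is eventually \<open>0\<close>\<close>
  define r where "r k = k + (\<Sum>i\<le>k. N i)" for k
  have "N k \<le> r k" for k
    unfolding r_def using member_le_sum[of k "{..k}" N] by auto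
  then show thesis
    by (intro that[of r] N) (auto simp: r_def strict_mono_Suc_iff)
qed

lemma uniform_limit_subseq:
  assumes "uniform_limit S (\<lambda>n. h (\<epsilon> n)) l sequentially" "strict_mono r"
  shows "uniform_limit S (\<lambda>n. h (\<epsilon> (r n))) l sequentially"
  unfolding uniform_limit_iff
proof (intro allI impI)
  fix e :: real assume "0 < e"
  from eventually_subseq[OF assms(2) uniform_limitD[OF assms(1) this]]
  show "\<forall>\<^sub>F n in sequentially. \<forall>x\<in>S. dist (h (\<epsilon> (r n)) x) (l x) < e" .
qed

lemma SUP_ereal_le_iff:
  "(SUP t\<in>S. ereal (h t)) \<le> ereal \<delta> \<longleftrightarrow> (\<forall>t\<in>S. h t \<le> \<delta>)"
  by (simp add: SUP_le_iff)

text \<open>Choose the subsequence such that the \<open>k\<close>-th error exceeds \<open>2\<^sup>-\<^sup>k\<close> with outer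
  probability less than \<open>2\<^sup>-\<^sup>k\<close>, cover these events by measurable ones of the same size,
  and apply the Borel-Cantelli lemma.\<close>

lemma ucp_limit_AE_subseq:
  assumes M: "prob_space M" and ucp: "ucp_limit M T H A" and \<epsilon>: "\<And>n. 0 < \<epsilon> n" "\<epsilon> \<longlonglongrightarrow> 0"
  obtains r :: "nat \<Rightarrow> nat" where "strict_mono r"
    "AE \<omega> in M. uniform_limit {0..T} (\<lambda>n t. H (\<epsilon> (r n)) t \<omega>) (\<lambda>t. A t \<omega>) sequentially"
proof -
  interpret prob_space M by fact
  define bad where "bad k e = {\<omega> \<in> space M. (SUP t\<in>{0..T}. ereal \<bar>H e t \<omega> - A t \<omega>\<bar>) > ereal ((1/2) ^ k)}"
    for k :: nat and e
  have at0: "filterlim \<epsilon> (at_right 0) sequentially"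
    unfolding filterlim_at using \<epsilon> by (auto intro!: always_eventually simp: less_imp_neq[THEN not_sym])
  have "\<forall>\<^sub>F n in sequentially. outer_measure_of M (bad k (\<epsilon> n)) < ennreal ((1/2) ^ k)" for k
  proof -
    have "((\<lambda>e. outer_measure_of M (bad k e)) \<longlongrightarrow> 0) (at_right 0)"
      using ucp unfolding ucp_limit_def bad_def by simp
    from order_tendstoD(2)[OF filterlim_compose[OF this at0]] show ?thesis by simp
  qed
  from strict_mono_choice[of "\<lambda>k n. outer_measure_of M (bad k (\<epsilon> n)) < ennreal ((1/2) ^ k)", OF this]
  obtain r where r: "strict_mono r" "\<And>k. outer_measure_of M (bad k (\<epsilon> (r k))) < ennreal ((1/2) ^ k)"
    by blast
  have "\<exists>E. E \<in> sets M \<and> bad k (\<epsilon> (r k)) \<subseteq> E \<and> emeasure M E < ennreal ((1/2) ^ k)" for k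
    using outer_measure_of_attain[of "bad k (\<epsilon> (r k))" M] r(2)[of k] by (auto simp: bad_def)
  then have "\<exists>E. \<forall>k. E k \<in> sets M \<and> bad k (\<epsilon> (r k)) \<subseteq> E k \<and> emeasure M (E k) < ennreal ((1/2) ^ k)"
    by (intro choice allI)
  then obtain E where "\<forall>k. E k \<in> sets M \<and> bad k (\<epsilon> (r k)) \<subseteq> E k \<and> emeasure M (E k) < ennreal ((1/2) ^ k)"
    by (elim exE)
  then have E: "E k \<in> sets M" "bad k (\<epsilon> (r k)) \<subseteq> E k" "emeasure M (E k) < ennreal ((1/2) ^ k)" for k
    by simp_all
  have "AE \<omega> in M. eventually (\<lambda>k. \<omega> \<in> space M - E k) sequentially"
  proof (rule borel_cantelli_AE1)
    show "summable (\<lambda>k. measure M (E k))"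
    proof (rule summable_comparison_test')
      show "summable (\<lambda>k. (1/2 :: real) ^ k)" by (rule summable_geometric) simp
      show "norm (measure M (E k)) \<le> (1/2) ^ k" for k
        using E(3)[of k] by (simp add: emeasure_eq_measure ennreal_less_iff)
    qed
  qed (use E(1) in \<open>auto simp: less_top[symmetric]\<close>)
  then have "AE \<omega> in M. uniform_limit {0..T} (\<lambda>n t. H (\<epsilon> (r n)) t \<omega>) (\<lambda>t. A t \<omega>) sequentially"
  proof (rule AE_mp, intro AE_I2 impI)
    fix \<omega> assume "\<omega> \<in> space M" and ev: "\<forall>\<^sub>F k in sequentially. \<omega> \<in> space M - E k"
    show "uniform_limit {0..T} (\<lambda>n t. H (\<epsilon> (r n)) t \<omega>) (\<lambda>t. A t \<omega>) sequentially"
    proof (rule uniform_limitI)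
      fix e :: real assume "0 < e"
      have "(\<lambda>k. (1/2 :: real) ^ k) \<longlonglongrightarrow> 0" by (rule LIMSEQ_power_zero) simp
      from order_tendstoD(2)[OF this \<open>0 < e\<close>] ev
      show "\<forall>\<^sub>F n in sequentially. \<forall>t\<in>{0..T}. dist (H (\<epsilon> (r n)) t \<omega>) (A t \<omega>) < e"
      proof eventually_elim
        case (elim k)
        then have "\<omega> \<notin> bad k (\<epsilon> (r k))" using E(2)[of k] by auto
        then have "\<forall>t\<in>{0..T}. \<bar>H (\<epsilon> (r k)) t \<omega> - A t \<omega>\<bar> \<le> (1/2) ^ k"
          using \<open>\<omega> \<in> space M\<close> unfolding SUP_ereal_le_iff[symmetric] by (auto simp: bad_def not_less)
        then show ?case using elim(1) by (fastforce simp: dist_real_def)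
      qed
    qed
  qed
  then show thesis by (rule that[OF r(1)])
qed

lemma uniform_limit_right_cont:
  fixes h :: "nat \<Rightarrow> real \<Rightarrow> real"
  assumes lim: "uniform_limit {0..T} h A sequentially" and a: "a \<in> {0..T}" "0 < \<eta>"
    and rc: "\<And>n \<eta>. 0 < \<eta> \<Longrightarrow> \<exists>d>0. \<forall>t. a \<le> t \<and> t \<le> T \<and> t < a + d \<longrightarrow> \<bar>h n t - h n a\<bar> \<le> \<eta>"
  shows "\<exists>d>0. \<forall>t. a \<le> t \<and> t \<le> T \<and> t < a + d \<longrightarrow> \<bar>A t - A a\<bar> \<le> \<eta>"
proof -
  have \<eta>: "0 < \<eta> / 3" using a by simp
  obtain n where n: "\<forall>t\<in>{0..T}. \<bar>h n t - A t\<bar> \<le> \<eta> / 3"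
    using uniform_limitD_abs[OF lim \<eta>] by (auto dest!: eventually_happens)
  obtain d where d: "d > 0" "\<And>t. a \<le> t \<Longrightarrow> t \<le> T \<Longrightarrow> t < a + d \<Longrightarrow> \<bar>h n t - h n a\<bar> \<le> \<eta> / 3"
    using rc[OF \<eta>, of n] by blast
  have "\<bar>A t - A a\<bar> \<le> \<eta>" if t: "a \<le> t" "t \<le> T" "t < a + d" for t
  proof -
    have "\<bar>h n t - A t\<bar> \<le> \<eta> / 3" "\<bar>h n a - A a\<bar> \<le> \<eta> / 3" using n a t by auto
    then show ?thesis using d(2)[OF t] by linarith
  qed
  then show ?thesis using d(1) by blast
qed

text \<open>The rationals alone do not suffice: nothing to the right of \<open>T\<close> approximates \<open>T\<close>
  within \<open>[0, T]\<close>.\<close>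

definition countable_times :: "real \<Rightarrow> real set" where
  "countable_times T = {0..T} \<inter> (\<rat> \<union> {T})"

lemma countable_countable_times: "countable (countable_times T)"
  unfolding countable_times_def by (intro countable_Int2 countable_Un countable_rat) auto

lemma right_cont_bound_countable:
  fixes h :: "real \<Rightarrow> real"
  assumes rc: "\<And>a \<eta>. a \<in> {0..T} \<Longrightarrow> 0 < \<eta> \<Longrightarrow> \<exists>d>0. \<forall>t. a \<le> t \<and> t \<le> T \<and> t < a + d \<longrightarrow> \<bar>h t - h a\<bar> \<le> \<eta>"
    and bd: "\<forall>t\<in>countable_times T. \<bar>h t\<bar> \<le> \<delta>" and a: "a \<in> {0..T}"
  shows "\<bar>h a\<bar> \<le> \<delta>"
proof (cases "a = T")
  case True
  then show ?thesis using bd a by (auto simp: countable_times_def)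
next
  case False
  show ?thesis
  proof (rule field_le_epsilon)
    fix \<eta> :: real assume "0 < \<eta>"
    then obtain d where d: "d > 0" "\<And>t. a \<le> t \<Longrightarrow> t \<le> T \<Longrightarrow> t < a + d \<Longrightarrow> \<bar>h t - h a\<bar> \<le> \<eta>"
      using rc[OF a] by blast
    have "a < min T (a + d)" using False a d by auto
    from Rats_dense_in_real[OF this] obtain q where q: "q \<in> \<rat>" "a < q" "q < min T (a + d)" by blast
    have "q \<in> countable_times T" using q a by (auto simp: countable_times_def)
    then have "\<bar>h q\<bar> \<le> \<delta>" using bd by auto
    moreover have "\<bar>h q - h a\<bar> \<le> \<eta>" using d(2)[of q] q by auto
    ultimately show "\<bar>h a\<bar> \<le> \<delta> + \<eta>" by linarith
  qed
qed

text \<open>The subsequence principle. Almost sure convergence implies convergence in outer probability only for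
  measurable errors. Almost surely \<open>A\<close> is a limit of the measurable
  \<open>h\<close> along a sequence, and by right continuity the supremum over \<open>[0, T]\<close> is one over
  countably many times. So the supremum agrees almost surely with the
  measurable function \<open>S\<close> below.\<close>

lemma (in prob_space) ucp_limitI:
  fixes H h :: "real \<Rightarrow> real \<Rightarrow> 'a \<Rightarrow> real"
  assumes meas: "\<And>e t. 0 < e \<Longrightarrow> t \<in> {0..T} \<Longrightarrow> h e t \<in> borel_measurable M"
    and eq: "AE \<omega> in M. \<forall>e>0. \<forall>t\<in>{0..T}. H e t \<omega> = h e t \<omega>"
    and rc: "AE \<omega> in M. \<forall>e>0. \<forall>a\<in>{0..T}. \<forall>\<eta>>0. \<exists>d>0. \<forall>t.
       a \<le> t \<and> t \<le> T \<and> t < a + d \<longrightarrow> \<bar>H e t \<omega> - H e a \<omega>\<bar> \<le> \<eta>"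
    and sub: "\<And>\<epsilon>. (\<And>n. 0 < \<epsilon> n) \<Longrightarrow> \<epsilon> \<longlonglongrightarrow> 0 \<Longrightarrow> \<exists>r. strict_mono (r :: nat \<Rightarrow> nat) \<and>
       (AE \<omega> in M. uniform_limit {0..T} (\<lambda>n t. H (\<epsilon> (r n)) t \<omega>) (\<lambda>t. A t \<omega>) sequentially)"
  shows "ucp_limit M T H A"
proof -
  have "(\<lambda>n. 1 / real (Suc n)) \<longlonglongrightarrow> 0" by (rule LIMSEQ_Suc[OF lim_const_over_n])
  then obtain r0 :: "nat \<Rightarrow> nat" where r0: "strict_mono r0"
    "AE \<omega> in M. uniform_limit {0..T} (\<lambda>n t. H (1 / real (Suc (r0 n))) t \<omega>) (\<lambda>t. A t \<omega>) sequentially"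
    using sub[of "\<lambda>n. 1 / real (Suc n)"] by auto
  define e0 where "e0 n = 1 / real (Suc (r0 n))" for n
  have e0: "0 < e0 n" for n by (simp add: e0_def)
  define b where "b t \<omega> = lim (\<lambda>n. h (e0 n) t \<omega>)" for t \<omega>
  have b_meas: "b t \<in> borel_measurable M" if "t \<in> {0..T}" for t
    unfolding b_def using meas[OF e0 that] by (rule borel_measurable_lim_metric)
  have b_eq: "AE \<omega> in M. \<forall>t\<in>{0..T}. A t \<omega> = b t \<omega>"
    using eq r0(2)
  proof eventually_elim
    case (elim \<omega>)
    show ?case
    proof
      fix t assume t: "t \<in> {0..T}"
      have "(\<lambda>n. H (e0 n) t \<omega>) \<longlonglongrightarrow> A t \<omega>"
        using tendsto_uniform_limitI[OF elim(2) t] by (simp add: e0_def)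
      moreover have "H (e0 n) t \<omega> = h (e0 n) t \<omega>" for n using elim(1) e0 t by blast
      ultimately show "A t \<omega> = b t \<omega>" unfolding b_def by (simp add: limI)
    qed
  qed
  define S where "S e \<omega> = (SUP t\<in>countable_times T. ereal \<bar>h e t \<omega> - b t \<omega>\<bar>)" for e \<omega>
  have S_meas: "S e \<in> borel_measurable M" if "0 < e" for e
    unfolding S_def
  proof (rule borel_measurable_SUP[OF countable_countable_times])
    fix t assume "t \<in> countable_times T"
    then have "t \<in> {0..T}" by (auto simp: countable_times_def)
    from meas[OF that this] b_meas[OF this] show "(\<lambda>\<omega>. ereal \<bar>h e t \<omega> - b t \<omega>\<bar>) \<in> borel_measurable M"
      by measurable
  qed
  have S_eq: "AE \<omega> in M. \<forall>e>0. \<forall>\<delta>. S e \<omega> \<le> ereal \<delta> \<longleftrightarrow> (SUP t\<in>{0..T}. ereal \<bar>H e t \<omega> - A t \<omega>\<bar>) \<le> ereal \<delta>"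
    using eq rc r0(2) b_eq
  proof eventually_elim
    case (elim \<omega>)
    show ?case
    proof (intro allI impI)
      fix e \<delta> :: real assume e: "0 < e"
      have diff: "H e t \<omega> - A t \<omega> = h e t \<omega> - b t \<omega>" if "t \<in> {0..T}" for t
        using elim(1,4) e that by simp
      have rA: "\<exists>d>0. \<forall>t. a \<le> t \<and> t \<le> T \<and> t < a + d \<longrightarrow> \<bar>A t \<omega> - A a \<omega>\<bar> \<le> \<eta>" if "a \<in> {0..T}" "0 < \<eta>" for a \<eta>
        by (rule uniform_limit_right_cont[OF elim(3) that]) (use elim(2) that(1) in auto)
      have rd: "\<exists>d>0. \<forall>t. a \<le> t \<and> t \<le> T \<and> t < a + d \<longrightarrow> \<bar>(H e t \<omega> - A t \<omega>) - (H e a \<omega> - A a \<omega>)\<bar> \<le> \<eta>"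
        if a: "a \<in> {0..T}" "0 < \<eta>" for a \<eta>
      proof -
        have h: "0 < \<eta> / 2" using a by simp
        obtain d1 where d1: "d1 > 0" "\<And>t. a \<le> t \<Longrightarrow> t \<le> T \<Longrightarrow> t < a + d1 \<Longrightarrow> \<bar>A t \<omega> - A a \<omega>\<bar> \<le> \<eta> / 2"
          using rA[OF a(1) h] by blast
        obtain d2 where d2: "d2 > 0" "\<And>t. a \<le> t \<Longrightarrow> t \<le> T \<Longrightarrow> t < a + d2 \<Longrightarrow> \<bar>H e t \<omega> - H e a \<omega>\<bar> \<le> \<eta> / 2"
          using elim(2)[rule_format, OF e a(1) h] by (elim exE conjE) blast
        have "\<bar>(H e t \<omega> - A t \<omega>) - (H e a \<omega> - A a \<omega>)\<bar> \<le> \<eta>" if "a \<le> t" "t \<le> T" "t < a + min d1 d2" for t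
        proof -
          have "t < a + d1" "t < a + d2" using that by auto
          then show ?thesis using d1(2)[OF that(1,2)] d2(2)[OF that(1,2)] by linarith
        qed
        then show ?thesis using d1(1) d2(1) by (intro exI[of _ "min d1 d2"]) auto
      qed
      have "S e \<omega> \<le> ereal \<delta> \<longleftrightarrow> (\<forall>t\<in>countable_times T. \<bar>h e t \<omega> - b t \<omega>\<bar> \<le> \<delta>)"
        unfolding S_def SUP_ereal_le_iff ..
      also have "\<dots> \<longleftrightarrow> (\<forall>t\<in>countable_times T. \<bar>H e t \<omega> - A t \<omega>\<bar> \<le> \<delta>)"
        by (intro ball_cong refl) (simp add: diff countable_times_def)
      also have "\<dots> \<longleftrightarrow> (\<forall>t\<in>{0..T}. \<bar>H e t \<omega> - A t \<omega>\<bar> \<le> \<delta>)"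
      proof
        assume "\<forall>t\<in>countable_times T. \<bar>H e t \<omega> - A t \<omega>\<bar> \<le> \<delta>"
        from right_cont_bound_countable[of T "\<lambda>t. H e t \<omega> - A t \<omega>", OF rd this]
        show "\<forall>t\<in>{0..T}. \<bar>H e t \<omega> - A t \<omega>\<bar> \<le> \<delta>" by (intro ballI)
      next
        assume "\<forall>t\<in>{0..T}. \<bar>H e t \<omega> - A t \<omega>\<bar> \<le> \<delta>"
        then show "\<forall>t\<in>countable_times T. \<bar>H e t \<omega> - A t \<omega>\<bar> \<le> \<delta>"
          unfolding countable_times_def by (intro ballI) (elim IntE, erule bspec)
      qed
      finally show "S e \<omega> \<le> ereal \<delta> \<longleftrightarrow> (SUP t\<in>{0..T}. ereal \<bar>H e t \<omega> - A t \<omega>\<bar>) \<le> ereal \<delta>"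
        unfolding SUP_ereal_le_iff .
    qed
  qed
  define p where "p \<delta> e = {\<omega> \<in> space M. S e \<omega> > ereal \<delta>}" for \<delta> e
  have p_sets: "p \<delta> e \<in> sets M" if "0 < e" for \<delta> e
    unfolding p_def using S_meas[OF that] by measurable
  define q where "q \<delta> e = {\<omega> \<in> space M. (SUP t\<in>{0..T}. ereal \<bar>H e t \<omega> - A t \<omega>\<bar>) > ereal \<delta>}" for \<delta> e
  have outer_le: "outer_measure_of M (q \<delta> e) \<le> emeasure M (p \<delta> e)" if e: "0 < e" for \<delta> e
  proof -
    obtain N where N: "N \<in> null_sets M" "{\<omega> \<in> space M. \<not> (\<forall>e>0. \<forall>\<delta>. S e \<omega> \<le> ereal \<delta> \<longleftrightarrow>
        (SUP t\<in>{0..T}. ereal \<bar>H e t \<omega> - A t \<omega>\<bar>) \<le> ereal \<delta>)} \<subseteq> N"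
      using S_eq by (auto elim!: AE_E simp: null_sets_def)
    have "q \<delta> e \<subseteq> p \<delta> e \<union> N"
    proof
      fix \<omega> assume \<omega>: "\<omega> \<in> q \<delta> e"
      show "\<omega> \<in> p \<delta> e \<union> N"
      proof (rule ccontr)
        assume "\<omega> \<notin> p \<delta> e \<union> N"
        moreover have "\<omega> \<in> space M" using \<omega> by (simp add: q_def)
        ultimately have "S e \<omega> \<le> ereal \<delta>" "S e \<omega> \<le> ereal \<delta> \<longleftrightarrow>
          (SUP t\<in>{0..T}. ereal \<bar>H e t \<omega> - A t \<omega>\<bar>) \<le> ereal \<delta>"
          using N(2) e by (auto simp: p_def not_less)
        then have "\<not> (SUP t\<in>{0..T}. ereal \<bar>H e t \<omega> - A t \<omega>\<bar>) > ereal \<delta>" by (simp add: not_less)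
        then show False using \<omega> by (simp add: q_def)
      qed
    qed
    then have "outer_measure_of M (q \<delta> e) \<le> outer_measure_of M (p \<delta> e \<union> N)"
      by (rule outer_measure_of_mono)
    also have "\<dots> = emeasure M (p \<delta> e)"
      using p_sets[OF e, of \<delta>] N(1) by (subst outer_measure_of_eq) (auto simp: emeasure_Un_null_set)
    finally show ?thesis .
  qed
  show ?thesis unfolding ucp_limit_def
  proof (intro allI impI)
    fix \<delta> :: real assume \<delta>: "0 < \<delta>"
    have "((\<lambda>e. outer_measure_of M (q \<delta> e)) \<longlongrightarrow> 0) (at_right 0)"
      unfolding tendsto_at_iff_sequentially comp_def
    proof (intro allI impI)
      fix X :: "nat \<Rightarrow> real" assume X: "\<forall>i. X i \<in> {0<..} - {0}" "X \<longlonglongrightarrow> 0"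
      show "(\<lambda>n. outer_measure_of M (q \<delta> (X n))) \<longlonglongrightarrow> 0"
      proof (rule order_tendstoI)
        fix c :: ennreal assume c: "0 < c"
        show "\<forall>\<^sub>F n in sequentially. outer_measure_of M (q \<delta> (X n)) < c"
        proof (rule ccontr)
          assume "\<not> ?thesis"
          then obtain s :: "nat \<Rightarrow> nat" where s: "strict_mono s" "\<And>n. \<not> outer_measure_of M (q \<delta> (X (s n))) < c"
            using not_eventually_sequentiallyD by blast
          have Xs: "0 < X (s n)" for n using X(1) by auto
          have "(\<lambda>n. X (s n)) \<longlonglongrightarrow> 0" using LIMSEQ_subseq_LIMSEQ[OF X(2) s(1)] by (simp add: comp_def)
          from sub[OF Xs this] obtain r :: "nat \<Rightarrow> nat" where
            r: "AE \<omega> in M. uniform_limit {0..T} (\<lambda>n t. H (X (s (r n))) t \<omega>) (\<lambda>t. A t \<omega>) sequentially"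
            by blast
          let ?p = "\<lambda>n. p \<delta> (X (s (r n)))"
          have "(\<lambda>n. \<integral>\<omega>. indicator (?p n) \<omega> \<partial>M) \<longlonglongrightarrow> (\<integral>\<omega>. (0 :: real) \<partial>M)"
          proof (rule integral_dominated_convergence[where w = "\<lambda>_. 1"])
            show "AE \<omega> in M. (\<lambda>n. indicator (?p n) \<omega> :: real) \<longlonglongrightarrow> 0"
              using r S_eq
            proof eventually_elim
              case (elim \<omega>)
              note S_iff = elim(2)
              have "\<forall>\<^sub>F n in sequentially. (indicator (?p n) \<omega> :: real) = 0"
                using uniform_limitD_abs[OF elim(1) \<delta>]
              proof eventually_elim
                case (elim n)
                then have "(SUP t\<in>{0..T}. ereal \<bar>H (X (s (r n))) t \<omega> - A t \<omega>\<bar>) \<le> ereal \<delta>"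
                  unfolding SUP_ereal_le_iff .
                then have "\<not> S (X (s (r n))) \<omega> > ereal \<delta>" using S_iff Xs by (simp add: not_less)
                then show ?case by (simp add: p_def)
              qed
              then show ?case by (rule tendsto_eventually)
            qed
            show "indicator (?p n) \<in> borel_measurable M" for n
              using p_sets[OF Xs] by simp
          qed (auto simp: indicator_def)
          then have "(\<lambda>n. measure M (?p n)) \<longlonglongrightarrow> 0" using p_sets[OF Xs] by simp
          then have "(\<lambda>n. emeasure M (?p n)) \<longlonglongrightarrow> 0"
            unfolding emeasure_eq_measure using tendsto_ennrealI by fastforce
          from order_tendstoD(2)[OF this c] obtain n where "emeasure M (?p n) < c"
            by (auto dest!: eventually_happens)
          then show False using outer_le[OF Xs, of \<delta> "r n"] s(2)[of "r n"] by auto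
        qed
      qed simp
    qed
    then show "((\<lambda>e. outer_measure_of M {\<omega> \<in> space M. (SUP t\<in>{0..T}. ereal \<bar>H e t \<omega> - A t \<omega>\<bar>) > ereal \<delta>}) \<longlongrightarrow> 0) (at_right 0)"
      unfolding q_def .
  qed
qed

section \<open>Covariation of images of processes\<close>

lemma cadlag_process_compose:
  assumes "cadlag_process M T X" "continuous_on UNIV \<phi>"
  shows "cadlag_process M T (\<lambda>t \<omega>. \<phi> (X t \<omega>))"
proof -
  have "\<phi> \<in> borel_measurable borel" using assms(2) by (rule borel_measurable_continuous_onI)
  then show ?thesis
    using assms cadlag_on_compose[OF assms(2)] unfolding cadlag_process_def
    by (auto intro: measurable_compose[of _ M borel \<phi>] elim!: eventually_mono)
qed

text \<open>A version of the averages that is measurable in the outcome, whereas a path that fails to be cadlag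
  on a null set may spoil the measurability of \<open>covariation_approx\<close>.\<close>

definition grid_incr_avg ::
    "real \<Rightarrow> (real \<Rightarrow> 'a \<Rightarrow> real) \<Rightarrow> (real \<Rightarrow> 'a \<Rightarrow> real) \<Rightarrow> real \<Rightarrow> real \<Rightarrow> 'a \<Rightarrow> real" where
  "grid_incr_avg T Y Z e t \<omega> = incr_avg (grid_lim T (\<lambda>t. Y t \<omega>)) (grid_lim T (\<lambda>t. Z t \<omega>)) e 0 t"

lemma measurable_grid_incr_avg:
  assumes Y: "cadlag_process M T Y" and Z: "cadlag_process M T Z" and "0 \<le> T"
  shows "grid_incr_avg T Y Z e t \<in> borel_measurable M"
proof -
  have grid: "(\<lambda>p. grid_lim T (\<lambda>t. X t (fst p)) (\<tau> (snd p))) \<in> borel_measurable (M \<Otimes>\<^sub>M lborel)"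
    if "cadlag_process M T X" "\<tau> \<in> borel_measurable borel" for X and \<tau> :: "real \<Rightarrow> real"
  proof -
    have m: "(\<lambda>(s, \<omega>). grid_lim T (\<lambda>t. X t \<omega>) s) \<in> borel_measurable (borel \<Otimes>\<^sub>M M)"
      by (rule measurable_grid_lim) (use that \<open>0 \<le> T\<close> in \<open>auto simp: cadlag_process_def\<close>)
    have "(\<lambda>p. (\<tau> (snd p), fst p)) \<in> M \<Otimes>\<^sub>M lborel \<rightarrow>\<^sub>M borel \<Otimes>\<^sub>M M"
      using that(2) by measurable
    from measurable_compose[OF this m] show ?thesis by simp
  qed
  have [measurable]: "(\<lambda>s. min (s + e) t) \<in> borel_measurable borel" by measurable
  note g = grid[OF Y, of "\<lambda>s. s"] grid[OF Z, of "\<lambda>s. s"] grid[OF Y, of "\<lambda>s. min (s + e) t"] grid[OF Z, of "\<lambda>s. min (s + e) t"]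
  have "(\<lambda>(\<omega>, s). indicator {0..t} s *\<^sub>R incr_prod (grid_lim T (\<lambda>t. Y t \<omega>)) (grid_lim T (\<lambda>t. Z t \<omega>)) e t s)
     \<in> borel_measurable (M \<Otimes>\<^sub>M lborel)"
    unfolding incr_prod_def split_beta' using g by measurable
  then have "(\<lambda>\<omega>. LINT s|lborel. indicator {0..t} s *\<^sub>R incr_prod (grid_lim T (\<lambda>t. Y t \<omega>)) (grid_lim T (\<lambda>t. Z t \<omega>)) e t s)
     \<in> borel_measurable M"
    by (rule lborel.borel_measurable_lebesgue_integral)
  then show ?thesis
    unfolding grid_incr_avg_def[abs_def] incr_avg_def set_lebesgue_integral_def by measurable
qed

lemma covariation_approx_grid:
  assumes "cadlag_on T (\<lambda>t. Y t \<omega>)" "cadlag_on T (\<lambda>t. Z t \<omega>)" "0 < e" "t \<in> {0..T}"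
  shows "covariation_approx Y Z e t \<omega> = grid_incr_avg T Y Z e t \<omega>"
proof -
  have "incr_prod (\<lambda>t. Y t \<omega>) (\<lambda>t. Z t \<omega>) e t s
      = incr_prod (grid_lim T (\<lambda>t. Y t \<omega>)) (grid_lim T (\<lambda>t. Z t \<omega>)) e t s" if "s \<in> {0..t}" for s
  proof -
    have "s \<in> {0..T}" "min (s + e) t \<in> {0..T}" using that assms by auto
    then show ?thesis unfolding incr_prod_def by (simp add: grid_lim_eq[OF assms(1)] grid_lim_eq[OF assms(2)])
  qed
  then show ?thesis
    unfolding covariation_approx_eq grid_incr_avg_def incr_avg_def
    by (intro arg_cong[where f = "\<lambda>x. 1 / e * x"] set_lebesgue_integral_cong) auto
qed

locale mutual_covariations = prob_space M for M :: "'a measure" +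
  fixes T :: real and X1 X2 A11 A12 A22 :: "real \<Rightarrow> 'a \<Rightarrow> real"
  assumes T_pos: "0 < T" and X1: "cadlag_process M T X1" and X2: "cadlag_process M T X2"
    and A11: "is_covariation M T X1 X1 A11" and A12: "is_covariation M T X1 X2 A12"
    and A22: "is_covariation M T X2 X2 A22"
begin

lemma AE_covariation_paths:
  assumes \<epsilon>: "\<And>n. 0 < \<epsilon> n" "\<epsilon> \<longlonglongrightarrow> 0"
  shows "\<exists>r. strict_mono (r :: nat \<Rightarrow> nat) \<and> (AE \<omega> in M. covariation_paths T (\<lambda>t. X1 t \<omega>) (\<lambda>t. X2 t \<omega>)
    (\<lambda>n. \<epsilon> (r n)) (\<lambda>t. A11 t \<omega>) (\<lambda>t. A12 t \<omega>) (\<lambda>t. A22 t \<omega>))"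
proof -
  note sub = ucp_limit_AE_subseq[OF prob_space_axioms]
  obtain r1 :: "nat \<Rightarrow> nat" where r1: "strict_mono r1"
    "AE \<omega> in M. uniform_limit {0..T} (\<lambda>n t. covariation_approx X1 X1 (\<epsilon> (r1 n)) t \<omega>) (\<lambda>t. A11 t \<omega>) sequentially"
    by (rule sub[OF A11[unfolded is_covariation_def] \<epsilon>]) blast
  have \<epsilon>1: "0 < \<epsilon> (r1 n)" "(\<lambda>n. \<epsilon> (r1 n)) \<longlonglongrightarrow> 0" for n
    using \<epsilon>(1) LIMSEQ_subseq_LIMSEQ[OF \<epsilon>(2) r1(1)] by (auto simp: comp_def)
  obtain r2 :: "nat \<Rightarrow> nat" where r2: "strict_mono r2"
    "AE \<omega> in M. uniform_limit {0..T} (\<lambda>n t. covariation_approx X1 X2 (\<epsilon> (r1 (r2 n))) t \<omega>) (\<lambda>t. A12 t \<omega>) sequentially"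
    by (rule sub[OF A12[unfolded is_covariation_def] \<epsilon>1]) blast
  have \<epsilon>2: "0 < \<epsilon> (r1 (r2 n))" "(\<lambda>n. \<epsilon> (r1 (r2 n))) \<longlonglongrightarrow> 0" for n
    using \<epsilon>1(1) LIMSEQ_subseq_LIMSEQ[OF \<epsilon>1(2) r2(1)] by (auto simp: comp_def)
  obtain r3 :: "nat \<Rightarrow> nat" where r3: "strict_mono r3"
    "AE \<omega> in M. uniform_limit {0..T} (\<lambda>n t. covariation_approx X2 X2 (\<epsilon> (r1 (r2 (r3 n)))) t \<omega>) (\<lambda>t. A22 t \<omega>) sequentially"
    by (rule sub[OF A22[unfolded is_covariation_def] \<epsilon>2]) blast
  have \<epsilon>3: "0 < \<epsilon> (r1 (r2 (r3 n)))" "(\<lambda>n. \<epsilon> (r1 (r2 (r3 n)))) \<longlonglongrightarrow> 0" for n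
    using \<epsilon>2(1) LIMSEQ_subseq_LIMSEQ[OF \<epsilon>2(2) r3(1)] by (auto simp: comp_def)
  have r23: "strict_mono (\<lambda>n. r2 (r3 n))" using r2(1) r3(1) by (auto simp: strict_mono_def)
  have "AE \<omega> in M. cadlag_on T (\<lambda>t. X1 t \<omega>)" "AE \<omega> in M. cadlag_on T (\<lambda>t. X2 t \<omega>)"
    using X1 X2 by (auto simp: cadlag_process_def)
  then have "AE \<omega> in M. covariation_paths T (\<lambda>t. X1 t \<omega>) (\<lambda>t. X2 t \<omega>)
    (\<lambda>n. \<epsilon> (r1 (r2 (r3 n)))) (\<lambda>t. A11 t \<omega>) (\<lambda>t. A12 t \<omega>) (\<lambda>t. A22 t \<omega>)"
    using r1(2) r2(2) r3(2)
  proof eventually_elim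
    case (elim \<omega>)
    show ?case
    proof
      show "uniform_limit {0..T} (\<lambda>n. incr_avg (\<lambda>t. X1 t \<omega>) (\<lambda>t. X1 t \<omega>) (\<epsilon> (r1 (r2 (r3 n)))) 0) (\<lambda>t. A11 t \<omega>) sequentially"
        using uniform_limit_subseq[where h = "\<lambda>e. incr_avg (\<lambda>t. X1 t \<omega>) (\<lambda>t. X1 t \<omega>) e 0" and \<epsilon> = "\<lambda>n. \<epsilon> (r1 n)", OF _ r23] elim(3)
        by (simp add: covariation_approx_eq)
      show "uniform_limit {0..T} (\<lambda>n. incr_avg (\<lambda>t. X1 t \<omega>) (\<lambda>t. X2 t \<omega>) (\<epsilon> (r1 (r2 (r3 n)))) 0) (\<lambda>t. A12 t \<omega>) sequentially"
        using uniform_limit_subseq[where h = "\<lambda>e. incr_avg (\<lambda>t. X1 t \<omega>) (\<lambda>t. X2 t \<omega>) e 0" and \<epsilon> = "\<lambda>n. \<epsilon> (r1 (r2 n))", OF _ r3(1)] elim(4)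
        by (simp add: covariation_approx_eq)
      show "uniform_limit {0..T} (\<lambda>n. incr_avg (\<lambda>t. X2 t \<omega>) (\<lambda>t. X2 t \<omega>) (\<epsilon> (r1 (r2 (r3 n)))) 0) (\<lambda>t. A22 t \<omega>) sequentially"
        using elim(5) by (simp add: covariation_approx_eq)
    qed (use T_pos elim \<epsilon>3 in auto)
  qed
  moreover have "strict_mono (\<lambda>n. r1 (r2 (r3 n)))" using r1(1) r23 by (auto simp: strict_mono_def)
  ultimately show ?thesis by blast
qed

text \<open>The arguments \<open>U\<close> and \<open>V\<close> choose between a path and the path of its left limits in the
  integrand.\<close>

theorem covariation_C1_image:
  fixes \<phi> \<psi> :: "real \<Rightarrow> real" and U V :: "(real \<Rightarrow> real) \<Rightarrow> real \<Rightarrow> real"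
  assumes \<phi>: "\<phi> C1_differentiable_on UNIV" and \<psi>: "\<psi> C1_differentiable_on UNIV"
    and U: "U = (\<lambda>p. p) \<or> U = left_lim" and V: "V = (\<lambda>p. p) \<or> V = left_lim"
  defines "F \<equiv> \<lambda>\<omega> s. continuous_component X1 X2 A12 s \<omega>"
    and "k \<equiv> \<lambda>\<omega> s. deriv \<phi> (U (\<lambda>u. X1 u \<omega>) s) * deriv \<psi> (V (\<lambda>u. X2 u \<omega>) s)"
    and "J \<equiv> \<lambda>\<omega> s. jump (\<lambda>u. \<phi> (X1 u \<omega>)) s * jump (\<lambda>u. \<psi> (X2 u \<omega>)) s"
  shows "AE \<omega> in M. (\<lambda>s. jump (\<lambda>u. X1 u \<omega>) s * jump (\<lambda>u. X2 u \<omega>) s) summable_on {0<..T} \<and>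
      stieltjes_integrable (F \<omega>) T (k \<omega>) \<and> J \<omega> summable_on {0<..T}"
    and "is_covariation M T (\<lambda>t \<omega>. \<phi> (X1 t \<omega>)) (\<lambda>t \<omega>. \<psi> (X2 t \<omega>))
      (\<lambda>t \<omega>. stieltjes_integral (F \<omega>) t (k \<omega>) + infsum (J \<omega>) {0<..t})"
proof -
  have path: "(\<lambda>s. jump (\<lambda>u. X1 u \<omega>) s * jump (\<lambda>u. X2 u \<omega>) s) summable_on {0<..T} \<and>
      stieltjes_integrable (F \<omega>) T (k \<omega>) \<and> J \<omega> summable_on {0<..T} \<and>
      uniform_limit {0..T} (\<lambda>n t. covariation_approx (\<lambda>t \<omega>. \<phi> (X1 t \<omega>)) (\<lambda>t \<omega>. \<psi> (X2 t \<omega>)) (\<epsilon> n) t \<omega>)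
        (\<lambda>t. stieltjes_integral (F \<omega>) t (k \<omega>) + infsum (J \<omega>) {0<..t}) sequentially"
    if "covariation_paths T (\<lambda>t. X1 t \<omega>) (\<lambda>t. X2 t \<omega>) \<epsilon> (\<lambda>t. A11 t \<omega>) (\<lambda>t. A12 t \<omega>) (\<lambda>t. A22 t \<omega>)" for \<omega> \<epsilon>
  proof -
    interpret covariation_paths T "\<lambda>t. X1 t \<omega>" "\<lambda>t. X2 t \<omega>" \<epsilon> "\<lambda>t. A11 t \<omega>" "\<lambda>t. A12 t \<omega>" "\<lambda>t. A22 t \<omega>" by (rule that)
    interpret C1_paths T "\<lambda>t. X1 t \<omega>" "\<lambda>t. X2 t \<omega>" \<epsilon> "\<lambda>t. A11 t \<omega>" "\<lambda>t. A12 t \<omega>" "\<lambda>t. A22 t \<omega>"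
      \<phi> \<psi> "U (\<lambda>u. X1 u \<omega>)" "V (\<lambda>u. X2 u \<omega>)"
      by unfold_locales (use \<phi> \<psi> U V in auto)
    show ?thesis
      using C1_image_covariation
      unfolding F_def k_def J_def continuous_component_def covariation_approx_eq by blast
  qed
  have "(\<lambda>n. 1 / real (Suc n)) \<longlonglongrightarrow> 0" by (rule LIMSEQ_Suc[OF lim_const_over_n])
  then obtain r :: "nat \<Rightarrow> nat" where "AE \<omega> in M. covariation_paths T (\<lambda>t. X1 t \<omega>) (\<lambda>t. X2 t \<omega>)
    (\<lambda>n. 1 / real (Suc (r n))) (\<lambda>t. A11 t \<omega>) (\<lambda>t. A12 t \<omega>) (\<lambda>t. A22 t \<omega>)"
    using AE_covariation_paths[of "\<lambda>n. 1 / real (Suc n)"] by auto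
  then show "AE \<omega> in M. (\<lambda>s. jump (\<lambda>u. X1 u \<omega>) s * jump (\<lambda>u. X2 u \<omega>) s) summable_on {0<..T} \<and>
      stieltjes_integrable (F \<omega>) T (k \<omega>) \<and> J \<omega> summable_on {0<..T}"
    by eventually_elim (use path in blast)
  let ?Y = "\<lambda>t \<omega>. \<phi> (X1 t \<omega>)" and ?Z = "\<lambda>t \<omega>. \<psi> (X2 t \<omega>)"
  have Y: "cadlag_process M T ?Y" and Z: "cadlag_process M T ?Z"
    by (rule cadlag_process_compose[OF X1 C1_deriv(3)[OF \<phi>]], rule cadlag_process_compose[OF X2 C1_deriv(3)[OF \<psi>]])
  then have YZ: "AE \<omega> in M. cadlag_on T (\<lambda>t. ?Y t \<omega>)" "AE \<omega> in M. cadlag_on T (\<lambda>t. ?Z t \<omega>)"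
    by (auto simp: cadlag_process_def)
  show "is_covariation M T ?Y ?Z (\<lambda>t \<omega>. stieltjes_integral (F \<omega>) t (k \<omega>) + infsum (J \<omega>) {0<..t})"
    unfolding is_covariation_def
  proof (rule ucp_limitI[where h = "grid_incr_avg T ?Y ?Z"])
    show "grid_incr_avg T ?Y ?Z e t \<in> borel_measurable M" for e t
      using T_pos by (intro measurable_grid_incr_avg Y Z) auto
    show "AE \<omega> in M. \<forall>e>0. \<forall>t\<in>{0..T}. covariation_approx ?Y ?Z e t \<omega> = grid_incr_avg T ?Y ?Z e t \<omega>"
      using YZ by eventually_elim (use covariation_approx_grid[of T ?Y _ ?Z] in blast)
    show "AE \<omega> in M. \<forall>e>0. \<forall>a\<in>{0..T}. \<forall>\<eta>>0. \<exists>d>0. \<forall>t. a \<le> t \<and> t \<le> T \<and> t < a + d \<longrightarrow>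
        \<bar>covariation_approx ?Y ?Z e t \<omega> - covariation_approx ?Y ?Z e a \<omega>\<bar> \<le> \<eta>"
      using YZ
    proof eventually_elim
      case (elim \<omega>)
      show ?case
      proof (intro allI impI ballI)
        fix e a \<eta> :: real assume *: "0 < e" "a \<in> {0..T}" "0 < \<eta>"
        then have a: "0 \<le> a" "a \<le> T" by auto
        obtain d where "0 < d" "\<And>t. a \<le> t \<Longrightarrow> t \<le> T \<Longrightarrow> t < a + d \<Longrightarrow>
          \<bar>incr_avg (\<lambda>t. ?Y t \<omega>) (\<lambda>t. ?Z t \<omega>) e 0 t - incr_avg (\<lambda>t. ?Y t \<omega>) (\<lambda>t. ?Z t \<omega>) e 0 a\<bar> \<le> \<eta>"
          by (rule incr_avg_right_cont[OF elim T_pos a *(3,1)]) blast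
        then show "\<exists>d>0. \<forall>t. a \<le> t \<and> t \<le> T \<and> t < a + d \<longrightarrow>
            \<bar>covariation_approx ?Y ?Z e t \<omega> - covariation_approx ?Y ?Z e a \<omega>\<bar> \<le> \<eta>"
          unfolding covariation_approx_eq by blast
      qed
    qed
    fix \<epsilon> :: "nat \<Rightarrow> real" assume "\<And>n. 0 < \<epsilon> n" "\<epsilon> \<longlonglongrightarrow> 0"
    from AE_covariation_paths[OF this] obtain r :: "nat \<Rightarrow> nat" where r: "strict_mono r"
      "AE \<omega> in M. covariation_paths T (\<lambda>t. X1 t \<omega>) (\<lambda>t. X2 t \<omega>)
        (\<lambda>n. \<epsilon> (r n)) (\<lambda>t. A11 t \<omega>) (\<lambda>t. A12 t \<omega>) (\<lambda>t. A22 t \<omega>)" by blast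
    have "AE \<omega> in M. uniform_limit {0..T} (\<lambda>n t. covariation_approx ?Y ?Z (\<epsilon> (r n)) t \<omega>)
        (\<lambda>t. stieltjes_integral (F \<omega>) t (k \<omega>) + infsum (J \<omega>) {0<..t}) sequentially"
      using r(2) by eventually_elim (use path in blast)
    then show "\<exists>r. strict_mono (r :: nat \<Rightarrow> nat) \<and> (AE \<omega> in M. uniform_limit {0..T}
        (\<lambda>n t. covariation_approx ?Y ?Z (\<epsilon> (r n)) t \<omega>)
        (\<lambda>t. stieltjes_integral (F \<omega>) t (k \<omega>) + infsum (J \<omega>) {0<..t}) sequentially)"
      using r(1) by blast
  qed
qed

end

theorem lemma2p7:
  fixes M :: "'a measure" and T :: real
  assumes "prob_space M" and "T > 0"
  shows
    "(\<forall>(\<phi> :: real \<Rightarrow> real) X A.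
        \<phi> C1_differentiable_on UNIV \<and>
        finite_quadratic_variation M T X \<and> is_covariation M T X X A
        \<longrightarrow>
        (AE \<omega> in M.
           (\<lambda>s. (jump (\<lambda>u. X u \<omega>) s)\<^sup>2) summable_on {0<..T} \<and>
           stieltjes_integrable (\<lambda>s. continuous_component X X A s \<omega>) T
             (\<lambda>s. (deriv \<phi> (left_lim (\<lambda>u. X u \<omega>) s))\<^sup>2) \<and>
           (\<lambda>s. (jump (\<lambda>u. \<phi> (X u \<omega>)) s)\<^sup>2) summable_on {0<..T}) \<and>
        is_covariation M T (\<lambda>t \<omega>. \<phi> (X t \<omega>)) (\<lambda>t \<omega>. \<phi> (X t \<omega>))
          (\<lambda>t \<omega>. stieltjes_integral (\<lambda>s. continuous_component X X A s \<omega>) t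
                    (\<lambda>s. (deriv \<phi> (left_lim (\<lambda>u. X u \<omega>) s))\<^sup>2)
                 + (\<Sum>\<^sub>\<infinity>s\<in>{0<..t}. (jump (\<lambda>u. \<phi> (X u \<omega>)) s)\<^sup>2)) \<and>
        finite_quadratic_variation M T (\<lambda>t \<omega>. \<phi> (X t \<omega>)))
     \<and>
     (\<forall>(\<phi>1 :: real \<Rightarrow> real) (\<phi>2 :: real \<Rightarrow> real) X1 X2 A.
        \<phi>1 C1_differentiable_on UNIV \<and> \<phi>2 C1_differentiable_on UNIV \<and>
        cadlag_process M T X1 \<and> cadlag_process M T X2 \<and>
        all_mutual_covariations M T X1 X2 \<and> is_covariation M T X1 X2 A
        \<longrightarrow>
        (AE \<omega> in M.
           (\<lambda>s. jump (\<lambda>u. X1 u \<omega>) s * jump (\<lambda>u. X2 u \<omega>) s) summable_on {0<..T} \<and>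
           stieltjes_integrable (\<lambda>s. continuous_component X1 X2 A s \<omega>) T
             (\<lambda>s. deriv \<phi>1 (X1 s \<omega>) * deriv \<phi>2 (left_lim (\<lambda>u. X2 u \<omega>) s)) \<and>
           (\<lambda>s. jump (\<lambda>u. \<phi>1 (X1 u \<omega>)) s * jump (\<lambda>u. \<phi>2 (X2 u \<omega>)) s) summable_on {0<..T}) \<and>
        is_covariation M T (\<lambda>t \<omega>. \<phi>1 (X1 t \<omega>)) (\<lambda>t \<omega>. \<phi>2 (X2 t \<omega>))
          (\<lambda>t \<omega>. stieltjes_integral (\<lambda>s. continuous_component X1 X2 A s \<omega>) t
                    (\<lambda>s. deriv \<phi>1 (X1 s \<omega>) * deriv \<phi>2 (left_lim (\<lambda>u. X2 u \<omega>) s))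
                 + (\<Sum>\<^sub>\<infinity>s\<in>{0<..t}. jump (\<lambda>u. \<phi>1 (X1 u \<omega>)) s * jump (\<lambda>u. \<phi>2 (X2 u \<omega>)) s)))"
proof (intro conjI allI impI; elim conjE)
  fix \<phi> :: "real \<Rightarrow> real" and X A
  assume \<phi>: "\<phi> C1_differentiable_on UNIV" and fqv: "finite_quadratic_variation M T X"
    and A: "is_covariation M T X X A"
  have X: "cadlag_process M T X" using fqv by (simp add: finite_quadratic_variation_def)
  interpret mutual_covariations M T X X A A A
    using assms X A by (intro mutual_covariations.intro mutual_covariations_axioms.intro)
  note image = covariation_C1_image[OF \<phi> \<phi> disjI2[OF refl] disjI2[OF refl], folded power2_eq_square]
  show "AE \<omega> in M.
           (\<lambda>s. (jump (\<lambda>u. X u \<omega>) s)\<^sup>2) summable_on {0<..T} \<and>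
           stieltjes_integrable (\<lambda>s. continuous_component X X A s \<omega>) T
             (\<lambda>s. (deriv \<phi> (left_lim (\<lambda>u. X u \<omega>) s))\<^sup>2) \<and>
           (\<lambda>s. (jump (\<lambda>u. \<phi> (X u \<omega>)) s)\<^sup>2) summable_on {0<..T}"
    by (rule image(1))
  show cov: "is_covariation M T (\<lambda>t \<omega>. \<phi> (X t \<omega>)) (\<lambda>t \<omega>. \<phi> (X t \<omega>))
          (\<lambda>t \<omega>. stieltjes_integral (\<lambda>s. continuous_component X X A s \<omega>) t
                    (\<lambda>s. (deriv \<phi> (left_lim (\<lambda>u. X u \<omega>) s))\<^sup>2)
                 + (\<Sum>\<^sub>\<infinity>s\<in>{0<..t}. (jump (\<lambda>u. \<phi> (X u \<omega>)) s)\<^sup>2))"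
    by (rule image(2))
  show "finite_quadratic_variation M T (\<lambda>t \<omega>. \<phi> (X t \<omega>))"
    using cov cadlag_process_compose[OF X C1_deriv(3)[OF \<phi>]] by (auto simp: finite_quadratic_variation_def)
next
  fix \<phi>1 \<phi>2 :: "real \<Rightarrow> real" and X1 X2 A
  assume \<phi>: "\<phi>1 C1_differentiable_on UNIV" "\<phi>2 C1_differentiable_on UNIV"
    and X: "cadlag_process M T X1" "cadlag_process M T X2"
    and all: "all_mutual_covariations M T X1 X2" and A: "is_covariation M T X1 X2 A"
  obtain A11 A22 where "is_covariation M T X1 X1 A11" "is_covariation M T X2 X2 A22"
    using all by (auto simp: all_mutual_covariations_def)
  then interpret mutual_covariations M T X1 X2 A11 A A22
    using assms X A by (intro mutual_covariations.intro mutual_covariations_axioms.intro)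
  note image = covariation_C1_image[OF \<phi> disjI1[OF refl] disjI2[OF refl]]
  show "AE \<omega> in M.
           (\<lambda>s. jump (\<lambda>u. X1 u \<omega>) s * jump (\<lambda>u. X2 u \<omega>) s) summable_on {0<..T} \<and>
           stieltjes_integrable (\<lambda>s. continuous_component X1 X2 A s \<omega>) T
             (\<lambda>s. deriv \<phi>1 (X1 s \<omega>) * deriv \<phi>2 (left_lim (\<lambda>u. X2 u \<omega>) s)) \<and>
           (\<lambda>s. jump (\<lambda>u. \<phi>1 (X1 u \<omega>)) s * jump (\<lambda>u. \<phi>2 (X2 u \<omega>)) s) summable_on {0<..T}"
    by (rule image(1))
  show "is_covariation M T (\<lambda>t \<omega>. \<phi>1 (X1 t \<omega>)) (\<lambda>t \<omega>. \<phi>2 (X2 t \<omega>))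
          (\<lambda>t \<omega>. stieltjes_integral (\<lambda>s. continuous_component X1 X2 A s \<omega>) t
                    (\<lambda>s. deriv \<phi>1 (X1 s \<omega>) * deriv \<phi>2 (left_lim (\<lambda>u. X2 u \<omega>) s))
                 + (\<Sum>\<^sub>\<infinity>s\<in>{0<..t}. jump (\<lambda>u. \<phi>1 (X1 u \<omega>)) s * jump (\<lambda>u. \<phi>2 (X2 u \<omega>)) s))"
    by (rule image(2))
qed

end
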